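(* Let $1<p<\infty$, let $d\ge 2$ be an integer, and let $w\in A_p(\mathcal{R})$ be a weight on $\mathbb{R}^d$. Set $$\alpha=\frac{d}{p-1}-\frac{\lfloor d/2\rfloor}{2p(p-1)}.$$ Then $$\|\mathcal{M}_{\mathcal{R}}f\|_{L^p(w)}\le C_{p,d}\,[w]_{A_p(\mathcal{R})}^{\alpha}\,\|f\|_{L^p(w)}\qquad\text{for all } f\in L^p(w),$$ where $C_{p,d}$ is a constant depending only on $p$ and $d$ (not on $w$ or $f$).
   Context: $\mathcal{R}$ is the collection of all axis-parallel rectangles in $\mathbb{R}^d$, i.e. cartesian products of $d$ one-dimensional bounded intervals of positive length. $|E|$ is Lebesgue measure and $\langle f\rangle_R=\frac{1}{|R|}\int_R f$. The strong maximal function is $\mathcal{M}_{\mathcal{R}}f(x)=\sup_{R\in\mathcal{R}}\frac{\mathbf{1}_R(x)}{|R|}\int_R|f(y)|\,dy$. A weight is an a.e. positive, locally integrable function $w$. With the dual weight $\sigma=w^{1-p'}$, $p'=p/(p-1)$, put $$[w]_{A_p(\mathcal{R})}=\sup_{R\in\mathcal{R}}\langle w\rangle_R\,\langle\sigma\rangle_R^{p-1},$$ and write $w\in A_p(\mathcal{R})$ if this is finite. Finally $\|f\|_{L^p(w)}=\big(\int_{\mathbb{R}^d}|f|^p\,w\,dx\big)^{1/p}$. *)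

theory Defs
  imports "HOL-Analysis.Analysis"
begin

text \<open>
  Suprema, averages and norms take values in \<^typ>\<open>ennreal\<close>, so that they make sense before
  finiteness is known. \<open>epowr\<close> extends \<open>powr\<close> to infinite bases by \<open>\<infinity> powr a = \<infinity>\<close>; this is
  the usual value only for \<open>a > 0\<close>, and below it is only used with positive exponents.
\<close>

definition epowr :: "ennreal \<Rightarrow> real \<Rightarrow> ennreal" (infixr "epowr" 80) where
  "x epowr a = (if x = \<infinity> then \<infinity> else ennreal (enn2real x powr a))"

text \<open>
  The side intervals may be open, closed or half-open. Positive length excludes the
  degenerate sets \<open>{}\<close> and \<open>{a}\<close>, which also satisfy \<^const>\<open>is_interval\<close>.
\<close>

definition rectangles :: "(real ^ 'n::finite) set set" where
  "rectangles =
     {{x. \<forall>i. x $ i \<in> I i} | I :: 'n \<Rightarrow> real set.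
        \<forall>i. is_interval (I i) \<and> bounded (I i) \<and> 0 < measure lebesgue (I i)}"

definition average :: "(real ^ 'n::finite) set \<Rightarrow> (real ^ 'n \<Rightarrow> ennreal) \<Rightarrow> ennreal" where
  "average R g = (\<integral>\<^sup>+ y \<in> R. g y \<partial>lebesgue) / emeasure lebesgue R"

definition strong_maximal :: "(real ^ 'n::finite \<Rightarrow> real) \<Rightarrow> real ^ 'n \<Rightarrow> ennreal" where
  "strong_maximal f x =
     (SUP R \<in> rectangles. indicator R x * average R (\<lambda>y. ennreal \<bar>f y\<bar>))"

definition locally_integrable :: "(real ^ 'n::finite \<Rightarrow> real) \<Rightarrow> bool" where
  "locally_integrable w \<longleftrightarrow> (\<forall>K. compact K \<longrightarrow> set_integrable lebesgue K w)"

definition weight :: "(real ^ 'n::finite \<Rightarrow> real) \<Rightarrow> bool" where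
  "weight w \<longleftrightarrow> (AE x in lebesgue. 0 < w x) \<and> locally_integrable w"

definition conj_exponent :: "real \<Rightarrow> real" where
  "conj_exponent p = p / (p - 1)"

definition dual_weight :: "real \<Rightarrow> (real ^ 'n::finite \<Rightarrow> real) \<Rightarrow> real ^ 'n \<Rightarrow> real" where
  "dual_weight p w x = w x powr (1 - conj_exponent p)"

definition Ap_const :: "real \<Rightarrow> (real ^ 'n::finite \<Rightarrow> real) \<Rightarrow> ennreal" where
  "Ap_const p w =
     (SUP R \<in> rectangles.
        average R (\<lambda>y. ennreal (w y)) *
        average R (\<lambda>y. ennreal (dual_weight p w y)) epowr (p - 1))"

definition Ap :: "real \<Rightarrow> (real ^ 'n::finite \<Rightarrow> real) set" where
  "Ap p = {w. weight w \<and> Ap_const p w < \<infinity>}"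

text \<open>
  The norm is defined on nonnegative extended-valued functions, so that it applies both to
  \<open>\<bar>f\<bar>\<close> and to \<open>strong_maximal f\<close>.
\<close>

definition Lp_norm :: "real \<Rightarrow> (real ^ 'n::finite \<Rightarrow> real) \<Rightarrow> (real ^ 'n \<Rightarrow> ennreal) \<Rightarrow> ennreal" where
  "Lp_norm p w g = (\<integral>\<^sup>+ x. g x epowr p * ennreal (w x) \<partial>lebesgue) epowr (1 / p)"

definition Lp :: "real \<Rightarrow> (real ^ 'n::finite \<Rightarrow> real) \<Rightarrow> (real ^ 'n \<Rightarrow> real) set" where
  "Lp p w = {f \<in> borel_measurable lebesgue. Lp_norm p w (\<lambda>x. ennreal \<bar>f x\<bar>) < \<infinity>}"

definition strong_exponent :: "real \<Rightarrow> nat \<Rightarrow> real" where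
  "strong_exponent p d =
     real d / (p - 1) - of_int \<lfloor>real d / 2\<rfloor> / (2 * p * (p - 1))"

end

theory Submission
  imports Defs
begin

text \<open>
  The coordinates are treated in pairs: a maximal operator in two parameters costs
  \<open>A powr (2 + 3 / (2 * (p - 1)))\<close> with \<open>A = [w]\<close>, where two one-parameter operators would cost
  \<open>A powr (2 + 2 / (p - 1))\<close>; an unpaired coordinate costs \<open>A powr (p / (p - 1))\<close>.

  In two parameters put \<open>K = A powr (1 / (p - 1))\<close> and consider the dyadic rectangles on which \<open>f\<close> has
  average about \<open>2 ^ k\<close>. The points of such a rectangle \<open>R\<close> are sorted by the size of \<open>f\<close>, in blocks of
  about \<open>K\<close> dyadic levels, and by the size of the smaller of the averages of \<open>f\<close> over the column and the
  row of \<open>R\<close> through the point, in blocks of about \<open>sqrt K\<close> levels. Some class, the sources of \<open>R\<close>, carries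
  a definite fraction of the mass of \<open>f\<close> on \<open>R\<close>. For high blocks the dual weight of the sources
  is small: a set of density \<open>4 powr (- m)\<close> has relative dual measure about \<open>K / m\<close>, while a product of two sets
  that both have this density has relative dual measure about \<open>K / m\<^sup>2\<close>, which is why \<open>sqrt K\<close> levels suffice for
  the second sorting. A Cordoba-Fefferman selection bounds the union of the rectangles, with one
  factor \<open>A\<close> for the selected rectangles, one for the lines through the others, and an overlap of
  the sources of at most \<open>sqrt K\<close>; each point is a source for at most \<open>K\<close> values of \<open>k\<close>.

  The continuous operator reduces to grids of cells, with \<open>f\<close>, \<open>w\<close> and \<open>\<sigma>\<close> replaced by their averages over
  cells. Grids with corners in two positions per coordinate capture every rectangle up to
  a factor (the one-third trick), and Fatou's lemma lets the mesh tend to 0.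
\<close>

text \<open>After averaging over cells \<open>w\<close> and \<open>s\<close> are no longer dual.
  What survives is the A_p bound on products of dyadic sets and Hoelder's lower bound
  \<open>1 \<le> w * s powr (p - 1)\<close>. Every estimate therefore has \<open>w\<close> on the
  left and the smaller weight \<open>s powr (1 - p)\<close> on the right: such estimates can be
  chained, and Hoelder on each cell turns the last right-hand side back into the integral of
  \<open>\<bar>f\<bar> powr p * w\<close> without a further factor \<open>A\<close>.

  Line averages enter because the selection charges a point at most once for each dyadic size of its
  column average. Sorting by the smaller of the column and row averages makes both large in a high
  block, which puts the sources into a product of two sparse sets.

  Sparse sets decay only harmonically: in a growing chain of \<open>m\<close> sets the increments
  are disjoint and each carries a share of about \<open>1 / K\<close>. Two chains have
  \<open>m\<^sup>2\<close> disjoint products of increments, each with such a share, and this is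
  where the saving comes from.\<close>

section \<open>Young and Hoelder inequalities\<close>

lemma powr_young:
  fixes g c p :: real
  assumes "1 < p" "0 \<le> g" "0 \<le> c"
  shows "p * c powr (p - 1) * g \<le> g powr p + (p - 1) * c powr p"
proof -
  have "g * c powr (p - 1) \<le> g powr p / p + (c powr (p - 1)) powr (p / (p - 1)) / (p / (p - 1))"
    using assms by (intro Youngs_inequality) (auto simp: field_simps)
  also have "(c powr (p - 1)) powr (p / (p - 1)) = c powr p"
    using assms by (simp add: powr_powr)
  finally have "g * c powr (p - 1) * p \<le> (g powr p / p + c powr p / (p / (p - 1))) * p"
    using assms by (intro mult_right_mono) auto
  also have "\<dots> = g powr p + (p - 1) * c powr p"
    using assms by (simp add: field_simps)
  finally show ?thesis by (simp add: mult_ac)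
qed

lemma powr_young_weighted:
  fixes f s c p :: real
  assumes "1 < p" "0 \<le> f" "0 \<le> c" "0 < s"
  shows "p * c powr (p - 1) * f \<le> f powr p * s powr (1 - p) + (p - 1) * c powr p * s"
proof -
  have "p * c powr (p - 1) * (f / s) * s \<le> ((f / s) powr p + (p - 1) * c powr p) * s"
    using powr_young[OF assms(1) _ assms(3), of "f / s"] assms by (intro mult_right_mono) auto
  moreover have "(f / s) powr p * s = f powr p * s powr (1 - p)"
    using assms by (simp add: powr_divide powr_diff)
  ultimately show ?thesis
    using assms(4) by (simp add: distrib_right)
qed

text \<open>The choice \<open>c = F / S\<close> is optimal and makes both sides multiples of
  \<open>c powr p * S\<close>. Young's inequality with a free parameter \<open>c\<close> passes
  through sums and integrals by linearity, so both forms of Hoelder's inequality below reduce to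
  this lemma.\<close>

lemma holder_of_young:
  fixes F G S p :: real
  assumes p: "1 < p" and "0 \<le> F" "0 < S"
    and young: "\<And>c. 0 \<le> c \<Longrightarrow> p * c powr (p - 1) * F \<le> G + (p - 1) * c powr p * S"
  shows "F powr p \<le> G * S powr (p - 1)"
proof -
  define c where "c = F / S"
  have c: "0 \<le> c" "F = c * S"
    using assms by (auto simp: c_def)
  have "c powr (p - 1) * c = c powr p"
    using c(1) by (cases "c = 0") (auto simp: powr_diff)
  then have *: "c powr (p - 1) * F = c powr p * S"
    by (metis c(2) mult.assoc)
  have "p * (c powr (p - 1) * F) \<le> G + (p - 1) * c powr p * S"
    using young[OF c(1)] by (simp add: mult.assoc)
  then have "c powr p * S \<le> G"
    unfolding * by (simp add: algebra_simps)
  then have "c powr p * S * S powr (p - 1) \<le> G * S powr (p - 1)"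
    by (intro mult_right_mono) auto
  also have "c powr p * S * S powr (p - 1) = F powr p"
    using c assms by (simp add: powr_mult powr_diff)
  finally show ?thesis .
qed

lemma holder_sum:
  fixes f s :: "'c \<Rightarrow> real"
  assumes p: "1 < p" and fin: "finite E"
    and f: "\<And>z. z \<in> E \<Longrightarrow> 0 \<le> f z" and s: "\<And>z. z \<in> E \<Longrightarrow> 0 < s z"
  shows "sum f E powr p \<le> (\<Sum>z\<in>E. f z powr p * s z powr (1 - p)) * sum s E powr (p - 1)"
proof (cases "E = {}")
  case False
  show ?thesis
  proof (rule holder_of_young[OF p])
    show "0 \<le> sum f E" using f by (rule sum_nonneg)
    show "0 < sum s E" using s False fin by (intro sum_pos) auto
    fix c :: real assume c: "0 \<le> c"
    have "p * c powr (p - 1) * sum f E = (\<Sum>z\<in>E. p * c powr (p - 1) * f z)"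
      by (simp add: sum_distrib_left)
    also have "\<dots> \<le> (\<Sum>z\<in>E. f z powr p * s z powr (1 - p) + (p - 1) * c powr p * s z)"
      using f s c p by (intro sum_mono powr_young_weighted) auto
    also have "\<dots> = (\<Sum>z\<in>E. f z powr p * s z powr (1 - p)) + (p - 1) * c powr p * sum s E"
      by (simp add: sum.distrib sum_distrib_left)
    finally show "p * c powr (p - 1) * sum f E
      \<le> (\<Sum>z\<in>E. f z powr p * s z powr (1 - p)) + (p - 1) * c powr p * sum s E" .
  qed
qed auto

section \<open>Dyadic systems\<close>

text \<open>Counting measure on a finite set of cells stands for Lebesgue measure.
  \<open>D_parent\<close> is the regularity of a dyadic tree: a maximal set with some property has
  at least half the size of a slightly larger set in which the property fails.\<close>

locale dyadic_system =
  fixes D :: "'a set set" and X :: "'a set"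
  assumes finite_X: "finite X"
    and D_subset: "Q \<in> D \<Longrightarrow> Q \<subseteq> X"
    and D_nonempty: "Q \<in> D \<Longrightarrow> Q \<noteq> {}"
    and D_singleton: "x \<in> X \<Longrightarrow> {x} \<in> D"
    and D_laminar: "Q \<in> D \<Longrightarrow> Q' \<in> D \<Longrightarrow> Q \<inter> Q' \<noteq> {} \<Longrightarrow> Q \<subseteq> Q' \<or> Q' \<subseteq> Q"
    and D_parent: "Q \<in> D \<Longrightarrow> Q' \<in> D \<Longrightarrow> Q \<subset> Q' \<Longrightarrow>
      \<exists>P \<in> D. Q \<subset> P \<and> P \<subseteq> Q' \<and> card P \<le> 2 * card Q"
begin

lemma D_finite: "Q \<in> D \<Longrightarrow> finite Q"
  using D_subset finite_X finite_subset by blast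

lemma D_card_pos: "Q \<in> D \<Longrightarrow> 0 < card Q"
  using D_finite D_nonempty by (simp add: card_gt_0_iff)

lemma finite_D: "finite D"
  by (rule finite_subset[of _ "Pow X"]) (use D_subset finite_X in auto)

definition maximal :: "'a set set \<Rightarrow> 'a set set" where
  "maximal F = {Q \<in> F. \<forall>Q' \<in> F. Q \<subseteq> Q' \<longrightarrow> Q' = Q}"

lemma maximal_subset: "maximal F \<subseteq> F"
  by (auto simp: maximal_def)

lemma ex_maximal:
  assumes "F \<subseteq> D" "Q \<in> F"
  shows "\<exists>Q' \<in> maximal F. Q \<subseteq> Q'"
proof -
  have "finite {Q' \<in> F. Q \<subseteq> Q'}"
    using assms finite_subset[OF _ finite_D] by auto
  then obtain M where "M \<in> {Q' \<in> F. Q \<subseteq> Q'}" "\<forall>P \<in> {Q' \<in> F. Q \<subseteq> Q'}. M \<subseteq> P \<longrightarrow> M = P"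
    using finite_has_maximal[of "{Q' \<in> F. Q \<subseteq> Q'}"] assms by auto
  then show ?thesis
    unfolding maximal_def by blast
qed

lemma Union_maximal: "F \<subseteq> D \<Longrightarrow> \<Union>(maximal F) = \<Union>F"
  using ex_maximal maximal_subset by blast

lemma disjoint_maximal:
  assumes "F \<subseteq> D"
  shows "disjoint (maximal F)"
proof (rule disjointI)
  fix Q Q' assume *: "Q \<in> maximal F" "Q' \<in> maximal F" "Q \<noteq> Q'"
  then have "Q \<in> D" "Q' \<in> D"
    using assms maximal_subset by blast+
  with * show "Q \<inter> Q' = {}"
    using D_laminar[of Q Q'] unfolding maximal_def by blast
qed

text \<open>Passing from the level set at \<open>4 ^ -i\<close> to the one at \<open>4 ^ -(i + 1)\<close> adds at least
  half of every maximal set of the larger one, because the parent of such a set is not dense.\<close>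

lemma dense_hull:
  assumes I: "I \<in> D" and S: "S \<subseteq> I" and sparse: "4 ^ n * card S < card I"
  obtains \<C> :: "nat \<Rightarrow> 'a set set" where
    "\<And>i. \<C> i \<subseteq> D" "\<And>i Q. Q \<in> \<C> i \<Longrightarrow> Q \<subseteq> I" "\<And>i. disjoint (\<C> i)"
    "S \<subseteq> \<Union>(\<C> 0)" "\<And>i. \<Union>(\<C> i) \<subseteq> \<Union>(\<C> (Suc i))"
    "\<And>i Q. i < n \<Longrightarrow> Q \<in> \<C> (Suc i) \<Longrightarrow> card Q \<le> 2 * card (Q - \<Union>(\<C> i))"
proof -
  \<comment> \<open>The maximal members of \<open>F i\<close> tile the part of \<open>I\<close>
    where the dyadic maximal function of the indicator of \<open>S\<close>, formed inside
    \<open>I\<close>, is at least \<open>4 ^ -i\<close>.\<close>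
  define F where "F i = {Q \<in> D. Q \<subseteq> I \<and> card Q \<le> 4 ^ i * card (S \<inter> Q)}" for i
  have FD: "F i \<subseteq> D" for i by (auto simp: F_def)
  have finS: "finite S" using S I D_finite finite_subset by blast
  have mono: "\<Union>(maximal (F i)) \<subseteq> \<Union>(maximal (F (Suc i)))" for i
  proof -
    have "F i \<subseteq> F (Suc i)" by (auto simp: F_def)
    then show ?thesis using FD by (simp add: Union_maximal Union_mono)
  qed
  show thesis
  proof (rule that[of "\<lambda>i. maximal (F i)"])
    show "maximal (F i) \<subseteq> D" for i using maximal_subset FD by blast
    show "Q \<subseteq> I" if "Q \<in> maximal (F i)" for i Q
      using that maximal_subset by (fastforce simp: F_def)
    show "disjoint (maximal (F i))" for i using FD by (rule disjoint_maximal)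
    show "S \<subseteq> \<Union>(maximal (F 0))"
    proof
      fix x assume "x \<in> S"
      moreover have "x \<in> X" using \<open>x \<in> S\<close> S I D_subset by blast
      ultimately have "{x} \<in> F 0" using S D_singleton by (auto simp: F_def)
      then show "x \<in> \<Union>(maximal (F 0))" using FD by (simp add: Union_maximal) blast
    qed
    show "\<Union>(maximal (F i)) \<subseteq> \<Union>(maximal (F (Suc i)))" for i by (rule mono)
    fix i Q assume i: "i < n" and Q: "Q \<in> maximal (F (Suc i))"
    have QF: "Q \<in> F (Suc i)" using Q maximal_subset by blast
    have QD: "Q \<in> D" "Q \<subseteq> I" "finite Q" using QF D_finite by (auto simp: F_def)
    \<comment> \<open>Sparsity of \<open>S\<close> stops the growth before \<open>I\<close> is
      reached, so each maximal set still has a parent inside \<open>I\<close>.\<close>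
    have "I \<notin> F (Suc i)"
    proof
      assume "I \<in> F (Suc i)"
      then have "card I \<le> 4 ^ Suc i * card S" using S by (simp add: F_def Int_absorb2)
      also have "\<dots> \<le> 4 ^ n * card S" using i by (intro mult_right_mono power_increasing) auto
      finally show False using sparse by simp
    qed
    then have "Q \<subset> I" using QF QD by auto
    then obtain P where P: "P \<in> D" "Q \<subset> P" "P \<subseteq> I" "card P \<le> 2 * card Q"
      using D_parent QD I by blast
    have "P \<notin> F (Suc i)" using Q P unfolding maximal_def by blast
    then have "4 ^ Suc i * card (S \<inter> P) < card P" using P by (simp add: F_def)
    moreover have "card (S \<inter> Q) \<le> card (S \<inter> P)" using P finS by (intro card_mono) auto
    ultimately have sp: "4 ^ Suc i * card (S \<inter> Q) < 2 * card Q"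
      using P(4) mult_le_mono2[of "card (S \<inter> Q)" "card (S \<inter> P)" "4 ^ Suc i"] by linarith
    define G where "G = {Q' \<in> maximal (F i). Q' \<subseteq> Q}"
    have GF: "G \<subseteq> F i" using maximal_subset by (auto simp: G_def)
    have GD: "G \<subseteq> D" using GF FD by blast
    have Gdisj: "disjoint G"
      using disjoint_maximal[OF FD[of i]] by (rule pairwise_subset) (auto simp: G_def)
    have eq: "Q \<inter> \<Union>(maximal (F i)) = \<Union>G"
    proof
      show "Q \<inter> \<Union>(maximal (F i)) \<subseteq> \<Union>G"
      proof
        fix x assume "x \<in> Q \<inter> \<Union>(maximal (F i))"
        then obtain Q' where Q': "Q' \<in> maximal (F i)" "x \<in> Q'" "x \<in> Q" by blast
        then have Q'F: "Q' \<in> F (Suc i)" "Q' \<in> D"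
          using maximal_subset[of "F i"] by (auto simp: F_def)
        then have "Q' \<subseteq> Q \<or> Q \<subseteq> Q'" using D_laminar[of Q' Q] QD Q' by blast
        then have "Q' \<subseteq> Q" using Q Q'F unfolding maximal_def by blast
        then show "x \<in> \<Union>G" using Q' by (auto simp: G_def)
      qed
    qed (auto simp: G_def)
    have finG: "finite G" using GD finite_D finite_subset by blast
    have "card (\<Union>G) = (\<Sum>Q'\<in>G. card Q')"
      using Gdisj GD D_finite by (intro card_Union_disjoint) auto
    also have "\<dots> \<le> (\<Sum>Q'\<in>G. 4 ^ i * card (S \<inter> Q'))"
      using GF by (intro sum_mono) (auto simp: F_def)
    also have "\<dots> = 4 ^ i * (\<Sum>Q'\<in>G. card (S \<inter> Q'))" by (simp add: sum_distrib_left)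
    also have "(\<Sum>Q'\<in>G. card (S \<inter> Q')) = card (\<Union>Q'\<in>G. S \<inter> Q')"
      using finG finS Gdisj
      by (intro card_UN_disjoint[symmetric]) (auto simp: pairwise_def disjnt_def)
    also have "\<dots> \<le> card (S \<inter> Q)" using finS by (intro card_mono) (auto simp: G_def)
    finally have "card (\<Union>G) \<le> 4 ^ i * card (S \<inter> Q)" by simp
    then have "2 * card (Q \<inter> \<Union>(maximal (F i))) \<le> card Q"
      using sp eq by (simp add: mult.commute)
    moreover have "card Q = card (Q \<inter> \<Union>(maximal (F i))) + card (Q - \<Union>(maximal (F i)))"
      using QD by (metis card_Int_Diff)
    ultimately show "card Q \<le> 2 * card (Q - \<Union>(maximal (F i)))" by linarith
  qed
qed

end

lemma sum_UNION_disjoint_family: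
  fixes v :: "'c \<Rightarrow> real"
  assumes "disjoint \<C>" "\<And>Q. Q \<in> \<C> \<Longrightarrow> finite Q" "finite \<C>"
  shows "sum v (\<Union>\<C> - B) = (\<Sum>Q\<in>\<C>. sum v (Q - B))"
proof -
  have "\<Union>\<C> - B = (\<Union>Q\<in>\<C>. Q - B)" by auto
  then show ?thesis using assms
    by (simp only:) (intro sum.UNION_disjoint, auto simp: disjoint_def)
qed

text \<open>Iterates the gain of one block of \<open>m\<close> generations over \<open>r\<close>
  blocks. In the applications \<open>M\<close> is \<open>m\<close> for a single chain of sets and
  \<open>m\<^sup>2\<close> for a product of two.\<close>

lemma geometric_chain:
  fixes V :: "nat \<Rightarrow> real"
  assumes k: "0 < \<kappa>" and nn: "\<And>i. 0 \<le> V i"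
    and step: "\<And>q. q < r \<Longrightarrow> M * V (q * m) \<le> \<kappa> * V (Suc q * m)" and M: "0 \<le> M"
  shows "M ^ r * V 0 \<le> \<kappa> ^ r * V (r * m)"
  using step
proof (induction r)
  case (Suc r)
  have "M ^ Suc r * V 0 = M * (M ^ r * V 0)" by simp
  also have "\<dots> \<le> M * (\<kappa> ^ r * V (r * m))" using Suc M by (intro mult_left_mono) auto
  also have "\<dots> = \<kappa> ^ r * (M * V (r * m))" by simp
  also have "\<dots> \<le> \<kappa> ^ r * (\<kappa> * V (Suc r * m))" using Suc k by (intro mult_left_mono) auto
  finally show ?case by (simp add: mult_ac)
qed auto

text \<open>Each set of generation \<open>i + 1\<close> is at least half new, so by doubling the
  increment carries a share \<open>1 / \<kappa>\<close> of the mass of that generation. The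
  increments of \<open>m\<close> generations are disjoint, which gains \<open>m / \<kappa>\<close>;
  cutting \<open>r * m\<close> generations into \<open>r\<close> blocks turns this linear gain into
  a power.\<close>

lemma (in dyadic_system) sparse_decay:
  fixes v :: "'a \<Rightarrow> real"
  assumes I: "I \<in> D" and S: "S \<subseteq> I" and sparse: "4 ^ (r * m) * card S < card I"
    and v: "\<And>x. x \<in> I \<Longrightarrow> 0 \<le> v x" and k: "0 < \<kappa>"
    and doubling: "\<And>Q E. Q \<in> D \<Longrightarrow> Q \<subseteq> I \<Longrightarrow> E \<subseteq> Q \<Longrightarrow> card Q \<le> 2 * card E \<Longrightarrow> sum v Q \<le> \<kappa> * sum v E"
  shows "real m ^ r * sum v S \<le> \<kappa> ^ r * sum v I"
proof -
  obtain \<C> :: "nat \<Rightarrow> 'a set set" where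
    C: "\<And>i. \<C> i \<subseteq> D" "\<And>i Q. Q \<in> \<C> i \<Longrightarrow> Q \<subseteq> I" "\<And>i. disjoint (\<C> i)"
    "S \<subseteq> \<Union>(\<C> 0)" "\<And>i. \<Union>(\<C> i) \<subseteq> \<Union>(\<C> (Suc i))"
    "\<And>i Q. i < r * m \<Longrightarrow> Q \<in> \<C> (Suc i) \<Longrightarrow> card Q \<le> 2 * card (Q - \<Union>(\<C> i))"
    using dense_hull[OF I S sparse] by blast
  have finI: "finite I" using I D_finite by blast
  have finC: "finite (\<C> i)" "\<And>Q. Q \<in> \<C> i \<Longrightarrow> finite Q" for i
    using C(1) finite_D D_finite finite_subset by blast+
  define U where "U i = \<Union>(\<C> i)" for i
  have UI: "U i \<subseteq> I" for i using C(2) by (auto simp: U_def)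
  have finU: "finite (U i)" for i using UI finI finite_subset by blast
  have U_Suc: "U i \<subseteq> U (Suc i)" for i using C(5) by (simp add: U_def)
  have U_mono: "U i \<subseteq> U j" if "i \<le> j" for i j
    using U_Suc that by (rule lift_Suc_mono_le)
  define V where "V i = sum v (U i)" for i
  have layer: "sum v (U i - B) = (\<Sum>Q\<in>\<C> i. sum v (Q - B))" for i B
    unfolding U_def by (rule sum_UNION_disjoint_family) (use C(3) finC in auto)
  have mono: "V i \<le> V j" if "i \<le> j" for i j
    unfolding V_def using U_mono[OF that] UI v finU by (intro sum_mono2) blast+
  have inc: "V (Suc i) \<le> \<kappa> * (V (Suc i) - V i)" if "i < r * m" for i
  proof -
    have "V (Suc i) = (\<Sum>Q\<in>\<C> (Suc i). sum v Q)"
      using layer[of "Suc i" "{}"] by (simp add: V_def)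
    also have "\<dots> \<le> (\<Sum>Q\<in>\<C> (Suc i). \<kappa> * sum v (Q - U i))"
    proof (intro sum_mono doubling)
      fix Q assume Q: "Q \<in> \<C> (Suc i)"
      show "Q \<in> D" "Q \<subseteq> I" using C(1,2) Q by blast+
      show "card Q \<le> 2 * card (Q - U i)" unfolding U_def using C(6) that Q .
    qed auto
    also have "\<dots> = \<kappa> * sum v (U (Suc i) - U i)"
      using layer[of "Suc i" "U i"] by (simp add: sum_distrib_left)
    also have "sum v (U (Suc i) - U i) = V (Suc i) - V i"
      unfolding V_def using U_Suc finU by (intro sum_diff) 
    finally show ?thesis .
  qed
  have Vnn: "0 \<le> V i" for i unfolding V_def using UI v by (intro sum_nonneg) blast
  have "real m ^ r * V 0 \<le> \<kappa> ^ r * V (r * m)"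
  proof (rule geometric_chain[OF k Vnn])
    fix q assume "q < r"
    then have qm: "Suc q * m \<le> r * m" by (intro mult_right_mono) auto
    \<comment> \<open>The hulls grow, so each of the \<open>m\<close> increments, times
      \<open>\<kappa>\<close>, dominates the hull at the start of the block; the sum of the
      increments telescopes.\<close>
    have "real m * V (q * m) = (\<Sum>i\<in>{q * m..<q * m + m}. V (q * m))" by simp
    also have "\<dots> \<le> (\<Sum>i\<in>{q * m..<q * m + m}. \<kappa> * (V (Suc i) - V i))"
    proof (rule sum_mono)
      fix i assume i: "i \<in> {q * m..<q * m + m}"
      then have "V (q * m) \<le> V (Suc i)" by (intro mono) auto
      with inc[of i] i qm show "V (q * m) \<le> \<kappa> * (V (Suc i) - V i)" by auto
    qed
    also have "\<dots> = \<kappa> * (V (q * m + m) - V (q * m))"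
      by (simp add: sum_distrib_left[symmetric] sum_Suc_diff')
    also have "\<dots> \<le> \<kappa> * V (Suc q * m)"
      using k Vnn by (intro mult_left_mono) (auto simp: add_ac)
    finally show "real m * V (q * m) \<le> \<kappa> * V (Suc q * m)" .
  qed auto
  moreover have "sum v S \<le> V 0" unfolding V_def
    using C(4) UI v finU U_def by (intro sum_mono2) blast+
  moreover have "V (r * m) \<le> sum v I" unfolding V_def
    using UI v finI by (intro sum_mono2) blast+
  ultimately show ?thesis using k
    by (meson mult_left_mono of_nat_0_le_iff order_trans zero_le_power less_imp_le)
qed

lemma sum_layers_telescope:
  fixes v :: "'c \<Rightarrow> real"
  assumes "\<And>i. finite (S i)" "\<And>i. S i \<subseteq> S (Suc i)" "l \<le> u"
  shows "(\<Sum>i\<in>{l..<u}. sum v (S (Suc i) - S i)) = sum v (S u - S l)"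
proof -
  have "(\<Sum>i\<in>{l..<u}. sum v (S (Suc i) - S i)) = (\<Sum>i\<in>{l..<u}. sum v (S (Suc i)) - sum v (S i))"
    using assms by (intro sum.cong refl sum_diff) auto
  also have "\<dots> = sum v (S u) - sum v (S l)"
    using sum_Suc_diff'[OF assms(3), of "\<lambda>i. sum v (S i)"] by simp
  also have "\<dots> = sum v (S u - S l)"
    using assms lift_Suc_mono_le[of S, OF assms(2)] by (intro sum_diff[symmetric]) auto
  finally show ?thesis .
qed

lemma sum_Times: "sum g (P \<times> Q) = (\<Sum>x\<in>P. \<Sum>y\<in>Q. g (x, y))"
  by (simp add: sum.cartesian_product)

section \<open>Two parameters: doubling and decay of the dual weight\<close>

text \<open>\<open>w\<close> and \<open>s\<close> model the cell averages of a weight and of its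
  dual; \<open>ws\<close> is Hoelder's inequality on a cell. As singletons are dyadic,
  \<open>Ap\<close> includes single rows and columns, and this is how one-parameter estimates are
  obtained.\<close>

locale biparam = X: dyadic_system D1 X + Y: dyadic_system D2 Y
  for D1 :: "'a set set" and X :: "'a set" and D2 :: "'b set set" and Y :: "'b set" +
  fixes w s :: "'a \<times> 'b \<Rightarrow> real" and p A :: real
  assumes p: "1 < p" and A: "1 \<le> A"
    and w_pos: "z \<in> X \<times> Y \<Longrightarrow> 0 < w z"
    and s_pos: "z \<in> X \<times> Y \<Longrightarrow> 0 < s z"
    and ws: "z \<in> X \<times> Y \<Longrightarrow> 1 \<le> w z * s z powr (p - 1)"
    and Ap: "I \<in> D1 \<Longrightarrow> J \<in> D2 \<Longrightarrow>
      sum w (I \<times> J) * sum s (I \<times> J) powr (p - 1) \<le> A * real (card (I \<times> J)) powr p"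
begin

text \<open>The doubling constant of \<open>s\<close> for subsets of density at least 1/4, the
  density of a product of two sets that fill half of their factors.\<close>

definition \<kappa> :: real where "\<kappa> = (A * 4 powr p) powr (1 / (p - 1))"

lemma \<kappa>_ge_1: "1 \<le> \<kappa>"
proof -
  have "1 \<le> 4 powr p" using p by (simp add: ge_one_powr_ge_zero)
  then have "1 \<le> A * 4 powr p" using A by (metis mult_mono' mult_1 zero_le_one)
  then show ?thesis using p by (simp add: \<kappa>_def ge_one_powr_ge_zero)
qed

lemma fin_rect: "I \<in> D1 \<Longrightarrow> J \<in> D2 \<Longrightarrow> finite (I \<times> J)"
  using X.D_finite Y.D_finite by blast

lemma rect_subset: "I \<in> D1 \<Longrightarrow> J \<in> D2 \<Longrightarrow> I \<times> J \<subseteq> X \<times> Y"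
  using X.D_subset Y.D_subset by blast

lemma sum_w_nonneg: "E \<subseteq> X \<times> Y \<Longrightarrow> 0 \<le> sum w E"
  by (intro sum_nonneg) (use w_pos in force)

lemma sum_s_nonneg: "E \<subseteq> X \<times> Y \<Longrightarrow> 0 \<le> sum s E"
  by (intro sum_nonneg) (use s_pos in force)

lemma rect_pos:
  assumes "I \<in> D1" "J \<in> D2"
  shows "0 < sum w (I \<times> J)" "0 < sum s (I \<times> J)" "0 < real (card (I \<times> J))"
proof -
  have *: "I \<times> J \<noteq> {}" using assms X.D_nonempty Y.D_nonempty by blast
  show "0 < sum w (I \<times> J)" using * fin_rect[OF assms] rect_subset[OF assms] w_pos
    by (intro sum_pos) auto
  show "0 < sum s (I \<times> J)" using * fin_rect[OF assms] rect_subset[OF assms] s_pos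
    by (intro sum_pos) auto
  show "0 < real (card (I \<times> J))" using * fin_rect[OF assms] by (simp add: card_gt_0_iff)
qed

lemma s_nonneg: "z \<in> X \<times> Y \<Longrightarrow> 0 \<le> s z"
  using s_pos less_imp_le by blast

lemma mem_XY: "I \<in> D1 \<Longrightarrow> J \<in> D2 \<Longrightarrow> x \<in> I \<Longrightarrow> y \<in> J \<Longrightarrow> (x, y) \<in> X \<times> Y"
  using X.D_subset Y.D_subset by blast

lemma finite_subset_XY: "E \<subseteq> X \<times> Y \<Longrightarrow> finite E"
  using X.finite_X Y.finite_X by (meson finite_SigmaI finite_subset)

lemma dual_le_w: "z \<in> X \<times> Y \<Longrightarrow> s z powr (1 - p) \<le> w z"
  using ws[of z] s_pos[of z] by (simp add: powr_diff field_simps)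

lemma card_powr_le:
  assumes "E \<subseteq> X \<times> Y"
  shows "real (card E) powr p \<le> sum w E * sum s E powr (p - 1)"
proof -
  have "sum (\<lambda>z. 1) E powr p \<le> (\<Sum>z\<in>E. 1 powr p * s z powr (1 - p)) * sum s E powr (p - 1)"
    using assms s_pos finite_subset_XY[OF assms] by (intro holder_sum p) auto
  also have "\<dots> \<le> sum w E * sum s E powr (p - 1)"
    using assms dual_le_w by (intro mult_right_mono sum_mono) auto
  finally show ?thesis by simp
qed

text \<open>The A_p condition tested on an indicator: Hoelder on \<open>E\<close>, after which the
  dual mass of \<open>E\<close> is enlarged to that of the rectangle.\<close>

lemma restricted_weak:
  assumes IJ: "I \<in> D1" "J \<in> D2" and E: "E \<subseteq> I \<times> J"
  shows "sum w (I \<times> J) * real (card E) powr p \<le> A * real (card (I \<times> J)) powr p * sum w E"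
proof -
  have EXY: "E \<subseteq> X \<times> Y" using E rect_subset[OF IJ] by blast
  have sE: "sum s E \<le> sum s (I \<times> J)"
    using E fin_rect[OF IJ] rect_subset[OF IJ] s_pos by (intro sum_mono2) (auto simp: less_imp_le)
  have "sum w (I \<times> J) * real (card E) powr p \<le> sum w (I \<times> J) * (sum w E * sum s E powr (p - 1))"
    using card_powr_le[OF EXY] rect_pos[OF IJ] by (intro mult_left_mono) auto
  also have "\<dots> \<le> sum w (I \<times> J) * (sum w E * sum s (I \<times> J) powr (p - 1))"
    using sE rect_pos[OF IJ] sum_w_nonneg[OF EXY] sum_s_nonneg[OF EXY] p
    by (intro mult_left_mono powr_mono2) auto
  also have "\<dots> = (sum w (I \<times> J) * sum s (I \<times> J) powr (p - 1)) * sum w E" by simp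
  also have "\<dots> \<le> A * real (card (I \<times> J)) powr p * sum w E"
    using Ap[OF IJ] sum_w_nonneg[OF EXY] by (intro mult_right_mono)
  finally show ?thesis .
qed

text \<open>Dual to \<open>restricted_weak\<close>: here the \<open>w\<close>-mass of
  \<open>E\<close> is enlarged, and solving for \<open>s\<close> takes a root of order
  \<open>p - 1\<close>. This is why \<open>\<kappa>\<close> grows like
  \<open>A powr (1 / (p - 1))\<close>.\<close>

lemma s_doubling:
  assumes IJ: "I \<in> D1" "J \<in> D2" and E: "E \<subseteq> I \<times> J" and card: "card (I \<times> J) \<le> 4 * card E"
  shows "sum s (I \<times> J) \<le> \<kappa> * sum s E"
proof -
  have EXY: "E \<subseteq> X \<times> Y" using E rect_subset[OF IJ] by blast
  have wE: "sum w E \<le> sum w (I \<times> J)"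
    using E fin_rect[OF IJ] rect_subset[OF IJ] w_pos by (intro sum_mono2) (auto simp: less_imp_le)
  have "real (card (I \<times> J)) powr p \<le> (4 * real (card E)) powr p"
    using card p by (intro powr_mono2) (auto simp flip: of_nat_mult)
  also have "\<dots> = 4 powr p * real (card E) powr p" by (simp add: powr_mult)
  also have "\<dots> \<le> 4 powr p * (sum w E * sum s E powr (p - 1))"
    using card_powr_le[OF EXY] by (intro mult_left_mono) auto
  also have "\<dots> \<le> 4 powr p * (sum w (I \<times> J) * sum s E powr (p - 1))"
    using wE by (intro mult_left_mono mult_right_mono) auto
  finally have "A * real (card (I \<times> J)) powr p \<le> A * (4 powr p * (sum w (I \<times> J) * sum s E powr (p - 1)))"
    using A by (intro mult_left_mono) auto
  with Ap[OF IJ] have "sum w (I \<times> J) * sum s (I \<times> J) powr (p - 1)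
      \<le> sum w (I \<times> J) * ((A * 4 powr p) * sum s E powr (p - 1))"
    by (simp add: mult_ac)
  then have "sum s (I \<times> J) powr (p - 1) \<le> (A * 4 powr p) * sum s E powr (p - 1)"
    using rect_pos[OF IJ] by simp
  then have "(sum s (I \<times> J) powr (p - 1)) powr (1 / (p - 1))
      \<le> ((A * 4 powr p) * sum s E powr (p - 1)) powr (1 / (p - 1))"
    using p by (intro powr_mono2) auto
  then show ?thesis
    using p A rect_pos[OF IJ] sum_s_nonneg[OF EXY]
    by (simp add: powr_mult powr_powr \<kappa>_def)
qed

text \<open>Both factors have a chain of hulls. For sets \<open>Q\<close> and \<open>P\<close> of
  two generations the product of their new parts fills a quarter of \<open>Q \<times> P\<close>, so
  doubling is applied once for both indices. A block contains \<open>m\<^sup>2\<close> pairs of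
  generations with disjoint products of increments, hence the squared gain.\<close>

lemma sparse_product:
  assumes I: "I \<in> D1" and S: "S \<subseteq> I" "4 ^ (r * m) * card S < card I"
    and J: "J \<in> D2" and T: "T \<subseteq> J" "4 ^ (r * m) * card T < card J"
  shows "(real m)\<^sup>2 ^ r * sum s (S \<times> T) \<le> \<kappa> ^ r * sum s (I \<times> J)"
proof -
  obtain \<C> :: "nat \<Rightarrow> 'a set set" where
    C: "\<And>i. \<C> i \<subseteq> D1" "\<And>i Q. Q \<in> \<C> i \<Longrightarrow> Q \<subseteq> I" "\<And>i. disjoint (\<C> i)"
    "S \<subseteq> \<Union>(\<C> 0)" "\<And>i. \<Union>(\<C> i) \<subseteq> \<Union>(\<C> (Suc i))"
    "\<And>i Q. i < r * m \<Longrightarrow> Q \<in> \<C> (Suc i) \<Longrightarrow> card Q \<le> 2 * card (Q - \<Union>(\<C> i))"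
    using X.dense_hull[OF I S] by blast
  obtain \<E> :: "nat \<Rightarrow> 'b set set" where
    E: "\<And>i. \<E> i \<subseteq> D2" "\<And>i Q. Q \<in> \<E> i \<Longrightarrow> Q \<subseteq> J" "\<And>i. disjoint (\<E> i)"
    "T \<subseteq> \<Union>(\<E> 0)" "\<And>i. \<Union>(\<E> i) \<subseteq> \<Union>(\<E> (Suc i))"
    "\<And>i Q. i < r * m \<Longrightarrow> Q \<in> \<E> (Suc i) \<Longrightarrow> card Q \<le> 2 * card (Q - \<Union>(\<E> i))"
    using Y.dense_hull[OF J T] by blast
  define U where "U i = \<Union>(\<C> i)" for i
  define V where "V i = \<Union>(\<E> i)" for i
  have UI: "U i \<subseteq> I" for i using C(2) by (auto simp: U_def)
  have VJ: "V i \<subseteq> J" for i using E(2) by (auto simp: V_def)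
  have finU: "finite (U i)" "finite (V i)" for i
    by (rule finite_subset[OF UI X.D_finite[OF I]], rule finite_subset[OF VJ Y.D_finite[OF J]])
  have finC: "finite (\<C> i)" "\<And>Q. Q \<in> \<C> i \<Longrightarrow> finite Q" for i
    using C(1) X.finite_D X.D_finite finite_subset by blast+
  have finE: "finite (\<E> i)" "\<And>Q. Q \<in> \<E> i \<Longrightarrow> finite Q" for i
    using E(1) Y.finite_D Y.D_finite finite_subset by blast+
  have sub: "U i \<times> V j \<subseteq> X \<times> Y" for i j
    using Sigma_mono[OF UI VJ] rect_subset[OF I J] by (rule order_trans)
  have mono: "U i \<subseteq> U j" "V i \<subseteq> V j" if "i \<le> j" for i j
    by (rule lift_Suc_mono_le[OF _ that], simp add: U_def V_def C(5) E(5))+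
  have s_mono: "sum s (U i \<times> V i') \<le> sum s (U j \<times> V j')" if "i \<le> j" "i' \<le> j'" for i j i' j'
  proof (rule sum_mono2)
    show "U i \<times> V i' \<subseteq> U j \<times> V j'" using mono that by (intro Sigma_mono)
    show "0 \<le> s z" if "z \<in> U j \<times> V j' - U i \<times> V i'" for z
      using that sub[of j j'] by (intro s_nonneg) blast
  qed (use finU in auto)
  have layer: "sum s ((U i - B) \<times> (V j - B')) = (\<Sum>Q\<in>\<C> i. \<Sum>P\<in>\<E> j. sum s ((Q - B) \<times> (P - B')))"
    for i j B B'
  proof -
    have "sum s ((U i - B) \<times> (V j - B')) = (\<Sum>x\<in>U i - B. \<Sum>y\<in>V j - B'. s (x, y))"
      by (simp add: sum.cartesian_product)
    also have "\<dots> = (\<Sum>Q\<in>\<C> i. \<Sum>x\<in>Q - B. \<Sum>y\<in>V j - B'. s (x, y))"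
      unfolding U_def by (rule sum_UNION_disjoint_family) (use C(3) finC in auto)
    also have "\<dots> = (\<Sum>Q\<in>\<C> i. \<Sum>x\<in>Q - B. \<Sum>P\<in>\<E> j. \<Sum>y\<in>P - B'. s (x, y))"
      unfolding V_def by (intro sum.cong refl sum_UNION_disjoint_family) (use E(3) finE in auto)
    also have "\<dots> = (\<Sum>Q\<in>\<C> i. \<Sum>P\<in>\<E> j. \<Sum>x\<in>Q - B. \<Sum>y\<in>P - B'. s (x, y))"
      by (intro sum.cong refl sum.swap)
    also have "\<dots> = (\<Sum>Q\<in>\<C> i. \<Sum>P\<in>\<E> j. sum s ((Q - B) \<times> (P - B')))"
      by (simp add: sum.cartesian_product)
    finally show ?thesis .
  qed
  \<comment> \<open>One factor \<open>\<kappa>\<close> is paid for the two chains together; treating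
    the factors one after the other would cost \<open>\<kappa>\<^sup>2\<close>.\<close>
  have inc: "sum s (U (Suc i) \<times> V (Suc j)) \<le> \<kappa> * sum s ((U (Suc i) - U i) \<times> (V (Suc j) - V j))"
    if ij: "i < r * m" "j < r * m" for i j
  proof -
    have "sum s (U (Suc i) \<times> V (Suc j)) = (\<Sum>Q\<in>\<C> (Suc i). \<Sum>P\<in>\<E> (Suc j). sum s (Q \<times> P))"
      using layer[of "Suc i" "{}" "Suc j" "{}"] by simp
    also have "\<dots> \<le> (\<Sum>Q\<in>\<C> (Suc i). \<Sum>P\<in>\<E> (Suc j). \<kappa> * sum s ((Q - U i) \<times> (P - V j)))"
    proof (intro sum_mono s_doubling)
      fix Q P assume QP: "Q \<in> \<C> (Suc i)" "P \<in> \<E> (Suc j)"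
      show "Q \<in> D1" "P \<in> D2" using C(1)[of "Suc i"] E(1)[of "Suc j"] QP by blast+
      have "card Q * card P \<le> (2 * card (Q - U i)) * (2 * card (P - V j))"
        using C(6)[OF ij(1) QP(1)] E(6)[OF ij(2) QP(2)] unfolding U_def V_def by (rule mult_le_mono)
      then show "card (Q \<times> P) \<le> 4 * card ((Q - U i) \<times> (P - V j))"
        by (simp add: card_cartesian_product)
    qed auto
    also have "\<dots> = \<kappa> * sum s ((U (Suc i) - U i) \<times> (V (Suc j) - V j))"
      by (simp add: layer sum_distrib_left)
    finally show ?thesis .
  qed
  have "(real m)\<^sup>2 ^ r * sum s (U 0 \<times> V 0) \<le> \<kappa> ^ r * sum s (U (r * m) \<times> V (r * m))"
  proof (rule geometric_chain[where V = "\<lambda>i. sum s (U i \<times> V i)"])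
    fix q assume "q < r"
    then have qm: "Suc q * m \<le> r * m" by (intro mult_right_mono) auto
    define N where "N = {q * m..<q * m + m}"
    have "(real m)\<^sup>2 * sum s (U (q * m) \<times> V (q * m)) = (\<Sum>i\<in>N. \<Sum>j\<in>N. sum s (U (q * m) \<times> V (q * m)))"
      by (simp add: N_def power2_eq_square)
    also have "\<dots> \<le> (\<Sum>i\<in>N. \<Sum>j\<in>N. \<kappa> * sum s ((U (Suc i) - U i) \<times> (V (Suc j) - V j)))"
    proof (intro sum_mono)
      fix i j assume ij: "i \<in> N" "j \<in> N"
      have "sum s (U (q * m) \<times> V (q * m)) \<le> sum s (U (Suc i) \<times> V (Suc j))"
        using ij by (intro s_mono) (auto simp: N_def)
      with inc[of i j] ij qm
      show "sum s (U (q * m) \<times> V (q * m)) \<le> \<kappa> * sum s ((U (Suc i) - U i) \<times> (V (Suc j) - V j))"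
        by (auto simp: N_def)
    qed
    also have "\<dots> = \<kappa> * (\<Sum>i\<in>N. \<Sum>j\<in>N. \<Sum>x\<in>U (Suc i) - U i. \<Sum>y\<in>V (Suc j) - V j. s (x, y))"
      by (simp only: sum_Times sum_distrib_left)
    also have "(\<Sum>i\<in>N. \<Sum>j\<in>N. \<Sum>x\<in>U (Suc i) - U i. \<Sum>y\<in>V (Suc j) - V j. s (x, y))
      = (\<Sum>i\<in>N. \<Sum>x\<in>U (Suc i) - U i. \<Sum>j\<in>N. \<Sum>y\<in>V (Suc j) - V j. s (x, y))"
      by (intro sum.cong refl sum.swap)
    also have "\<dots> = (\<Sum>x\<in>U (q * m + m) - U (q * m). \<Sum>y\<in>V (q * m + m) - V (q * m). s (x, y))"
    proof -
      have "(\<Sum>j\<in>N. \<Sum>y\<in>V (Suc j) - V j. s (x, y)) = (\<Sum>y\<in>V (q * m + m) - V (q * m). s (x, y))" for x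
        unfolding N_def by (rule sum_layers_telescope) (use finU mono(2) in auto)
      moreover have "(\<Sum>i\<in>N. \<Sum>x\<in>U (Suc i) - U i. g x) = (\<Sum>x\<in>U (q * m + m) - U (q * m). g x)" for g :: "'a \<Rightarrow> real"
        unfolding N_def by (rule sum_layers_telescope) (use finU mono(1) in auto)
      ultimately show ?thesis by simp
    qed
    also have "\<dots> = sum s ((U (q * m + m) - U (q * m)) \<times> (V (q * m + m) - V (q * m)))"
      by (simp add: sum.cartesian_product)
    also have "\<dots> \<le> sum s (U (Suc q * m) \<times> V (Suc q * m))"
    proof (rule sum_mono2)
      show "0 \<le> s z" if "z \<in> U (Suc q * m) \<times> V (Suc q * m) - (U (q * m + m) - U (q * m)) \<times> (V (q * m + m) - V (q * m))" for z
        using that sub[of "Suc q * m" "Suc q * m"] by (intro s_nonneg) blast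
    qed (use finU in \<open>auto simp: add.commute\<close>)
    finally show "(real m)\<^sup>2 * sum s (U (q * m) \<times> V (q * m)) \<le> \<kappa> * sum s (U (Suc q * m) \<times> V (Suc q * m))"
      using \<kappa>_ge_1 by (simp add: mult_left_mono)
  qed (use \<kappa>_ge_1 sub sum_s_nonneg in auto)
  moreover have "sum s (S \<times> T) \<le> sum s (U 0 \<times> V 0)"
  proof (rule sum_mono2)
    show "S \<times> T \<subseteq> U 0 \<times> V 0" using C(4) E(4) by (auto simp: U_def V_def)
    show "0 \<le> s z" if "z \<in> U 0 \<times> V 0 - S \<times> T" for z
      using that sub[of 0 0] by (intro s_nonneg) blast
  qed (use finU in auto)
  moreover have "sum s (U (r * m) \<times> V (r * m)) \<le> sum s (I \<times> J)"
  proof (rule sum_mono2)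
    show "U (r * m) \<times> V (r * m) \<subseteq> I \<times> J" using UI VJ by (intro Sigma_mono)
    show "0 \<le> s z" if "z \<in> I \<times> J - U (r * m) \<times> V (r * m)" for z
      using that rect_subset[OF I J] by (intro s_nonneg) blast
  qed (rule fin_rect[OF I J])
  ultimately show ?thesis using \<kappa>_ge_1
    by (meson mult_left_mono order_trans zero_le_power less_imp_le zero_less_one less_le_trans zero_le_power2)
qed

text \<open>A general sparse set is split by Chebyshev's inequality. The columns in which
  \<open>E\<close> is relatively dense form a sparse set, which is bounded with the full height
  \<open>J\<close>; in every other column \<open>E\<close> itself is sparse. The two densities
  multiply, hence the 2 in the exponent, and the two parts add up to the 2 in the
  conclusion.\<close>

lemma sparse_subset:
  assumes I: "I \<in> D1" and J: "J \<in> D2" and E: "E \<subseteq> I \<times> J"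
    and sparse: "4 ^ (2 * (r * m)) * card E < card (I \<times> J)"
  shows "real m ^ r * sum s E \<le> 2 * \<kappa> ^ r * sum s (I \<times> J)"
proof -
  define E' where "E' x = {y. (x, y) \<in> E}" for x
  define S where "S = {x \<in> I. card J \<le> 4 ^ (r * m) * card (E' x)}"
  have SI: "S \<subseteq> I" by (auto simp: S_def)
  have finI: "finite I" "finite J" using I J X.D_finite Y.D_finite by auto
  have E'J: "E' x \<subseteq> J" for x using E by (auto simp: E'_def)
  have finE': "finite (E' x)" for x using E'J finI finite_subset by blast
  have E_eq: "E = (SIGMA x:I. E' x)" using E by (auto simp: E'_def)
  have "card J * card S = (\<Sum>x\<in>S. card J)" by simp
  also have "\<dots> \<le> (\<Sum>x\<in>S. 4 ^ (r * m) * card (E' x))" by (intro sum_mono) (auto simp: S_def)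
  also have "\<dots> \<le> (\<Sum>x\<in>I. 4 ^ (r * m) * card (E' x))" using SI finI by (intro sum_mono2) auto
  also have "\<dots> = 4 ^ (r * m) * card E"
    using finI finE' by (simp add: E_eq sum_distrib_left)
  finally have "4 ^ (r * m) * (card J * card S) \<le> 4 ^ (r * m) * (4 ^ (r * m) * card E)"
    by (rule mult_le_mono2)
  also have "\<dots> = 4 ^ (2 * (r * m)) * card E" by (simp add: mult_2 power_add)
  also have "\<dots> < card J * card I" using sparse by (simp add: card_cartesian_product mult.commute)
  finally have "card J * (4 ^ (r * m) * card S) < card J * card I" by (simp add: mult_ac)
  then have S_sparse: "4 ^ (r * m) * card S < card I" by simp
  \<comment> \<open>The marginal of \<open>s\<close> on the first factor inherits doubling from
    rectangles with second side \<open>J\<close>.\<close>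
  have 1: "real m ^ r * (\<Sum>x\<in>S. \<Sum>y\<in>J. s (x, y)) \<le> \<kappa> ^ r * (\<Sum>x\<in>I. \<Sum>y\<in>J. s (x, y))"
  proof (rule X.sparse_decay[OF I SI S_sparse])
    show "0 \<le> (\<Sum>y\<in>J. s (x, y))" if "x \<in> I" for x
      using that by (intro sum_nonneg s_nonneg mem_XY[OF I J])
    fix Q B assume Q: "Q \<in> D1" "Q \<subseteq> I" "B \<subseteq> Q" "card Q \<le> 2 * card B"
    have "sum s (Q \<times> J) \<le> \<kappa> * sum s (B \<times> J)"
      using Q J mult_right_mono[OF Q(4), of "card J"]
      by (intro s_doubling) (auto simp: card_cartesian_product)
    then show "(\<Sum>x\<in>Q. \<Sum>y\<in>J. s (x, y)) \<le> \<kappa> * (\<Sum>x\<in>B. \<Sum>y\<in>J. s (x, y))"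
      by (simp add: sum.cartesian_product)
  qed (use \<kappa>_ge_1 in auto)
  \<comment> \<open>A column is a rectangle with a one-point first side, so doubling holds in it
    with the same \<open>\<kappa>\<close>.\<close>
  have 2: "real m ^ r * (\<Sum>y\<in>E' x. s (x, y)) \<le> \<kappa> ^ r * (\<Sum>y\<in>J. s (x, y))" if x: "x \<in> I - S" for x
  proof (rule Y.sparse_decay[OF J E'J])
    have xX: "x \<in> X" using x I X.D_subset by blast
    show "4 ^ (r * m) * card (E' x) < card J" using x by (auto simp: S_def)
    show "0 \<le> s (x, y)" if "y \<in> J" for y
      using x that by (intro s_nonneg mem_XY[OF I J]) auto
    fix Q B assume Q: "Q \<in> D2" "Q \<subseteq> J" "B \<subseteq> Q" "card Q \<le> 2 * card B"
    have "sum s ({x} \<times> Q) \<le> \<kappa> * sum s ({x} \<times> B)"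
      using Q X.D_singleton[OF xX] by (intro s_doubling) (auto simp: card_cartesian_product)
    moreover have "sum s ({x} \<times> P) = (\<Sum>y\<in>P. s (x, y))" for P
      using sum.cartesian_product[of "\<lambda>x y. s (x, y)" P "{x}"] by simp
    ultimately show "(\<Sum>y\<in>Q. s (x, y)) \<le> \<kappa> * (\<Sum>y\<in>B. s (x, y))" by simp
  qed (use \<kappa>_ge_1 in auto)
  have snn: "0 \<le> (\<Sum>y\<in>J. s (x, y))" if "x \<in> I" for x
    using that by (intro sum_nonneg s_nonneg mem_XY[OF I J])
  have "sum s E = (\<Sum>x\<in>I. \<Sum>y\<in>E' x. s (x, y))"
    unfolding E_eq using finI finE' by (subst sum.Sigma) auto
  also have "\<dots> = (\<Sum>x\<in>S. \<Sum>y\<in>E' x. s (x, y)) + (\<Sum>x\<in>I - S. \<Sum>y\<in>E' x. s (x, y))"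
    using sum.subset_diff[OF SI finI(1), of "\<lambda>x. \<Sum>y\<in>E' x. s (x, y)"] by simp
  also have "\<dots> \<le> (\<Sum>x\<in>S. \<Sum>y\<in>J. s (x, y)) + (\<Sum>x\<in>I - S. \<Sum>y\<in>E' x. s (x, y))"
  proof (intro add_right_mono sum_mono sum_mono2 s_nonneg)
    show "(x, y) \<in> X \<times> Y" if "x \<in> S" "y \<in> J - E' x" for x y
      using that SI by (intro mem_XY[OF I J]) auto
  qed (use E'J finI in auto)
  finally have "real m ^ r * sum s E
      \<le> real m ^ r * ((\<Sum>x\<in>S. \<Sum>y\<in>J. s (x, y)) + (\<Sum>x\<in>I - S. \<Sum>y\<in>E' x. s (x, y)))"
    by (rule mult_left_mono) simp
  also have "\<dots> = real m ^ r * (\<Sum>x\<in>S. \<Sum>y\<in>J. s (x, y))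
      + (\<Sum>x\<in>I - S. real m ^ r * (\<Sum>y\<in>E' x. s (x, y)))"
    by (simp only: distrib_left sum_distrib_left)
  also have "\<dots> \<le> \<kappa> ^ r * (\<Sum>x\<in>I. \<Sum>y\<in>J. s (x, y)) + (\<Sum>x\<in>I - S. \<kappa> ^ r * (\<Sum>y\<in>J. s (x, y)))"
    using 1 2 by (intro add_mono sum_mono) auto
  also have "\<dots> \<le> \<kappa> ^ r * (\<Sum>x\<in>I. \<Sum>y\<in>J. s (x, y)) + (\<Sum>x\<in>I. \<kappa> ^ r * (\<Sum>y\<in>J. s (x, y)))"
    using finI snn \<kappa>_ge_1 by (intro add_left_mono sum_mono2) auto
  also have "\<dots> = 2 * \<kappa> ^ r * sum s (I \<times> J)"
    by (simp only: sum_Times sum_distrib_left[symmetric])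
  finally show ?thesis .
qed

end

section \<open>Dyadic levels and the selection of rectangles\<close>

definition lev :: "real \<Rightarrow> int" where "lev u = \<lfloor>log 2 u\<rfloor>"

lemma powr_lev_le: "0 < u \<Longrightarrow> 2 powr real_of_int (lev u) \<le> u"
  unfolding lev_def by (metis floor_correct le_log_iff one_less_numeral_iff semiring_norm(76))

lemma less_powr_lev: "0 < u \<Longrightarrow> u < 2 * 2 powr real_of_int (lev u)"
proof -
  assume u: "0 < u"
  have "log 2 u < real_of_int (lev u) + 1" unfolding lev_def by linarith
  then have "u < 2 powr (real_of_int (lev u) + 1)" using u by (simp add: log_less_iff)
  then show ?thesis by (simp add: powr_add)
qed

lemma lev_eq_le_double:
  assumes "0 < u" "0 < v" "lev u = lev v"
  shows "u \<le> 2 * v"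
proof -
  have "u < 2 * 2 powr real_of_int (lev v)" using less_powr_lev[OF assms(1)] assms(3) by simp
  also have "\<dots> \<le> 2 * v" using powr_lev_le[OF assms(2)] by simp
  finally show ?thesis by simp
qed

text \<open>The decision about \<open>n\<close> depends only on the indices kept before it, so a
  selection on \<open>{..<N}\<close> extends by one index without being changed.\<close>

lemma ex_greedy_selection:
  fixes P :: "nat set \<Rightarrow> nat \<Rightarrow> bool"
  shows "\<exists>G \<subseteq> {..<N}. \<forall>n<N. n \<in> G \<longleftrightarrow> P (G \<inter> {..<n}) n"
proof (induction N)
  case (Suc N)
  then obtain G where G: "G \<subseteq> {..<N}" "\<forall>n<N. n \<in> G \<longleftrightarrow> P (G \<inter> {..<n}) n" by blast
  define G' where "G' = (if P G N then insert N G else G)"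
  have eq: "G' \<inter> {..<n} = G \<inter> {..<n}" if "n \<le> N" for n
    using that by (auto simp: G'_def)
  have "n \<in> G' \<longleftrightarrow> P (G' \<inter> {..<n}) n" if "n < Suc N" for n
  proof (cases "n = N")
    case True
    have "G \<inter> {..<N} = G" using G(1) by blast
    then show ?thesis using eq[of N] G(1) True by (auto simp: G'_def)
  next
    case False
    then have "n < N" using that by simp
    then show ?thesis using eq[of n] G(2) by (auto simp: G'_def)
  qed
  moreover have "G' \<subseteq> {..<Suc N}" using G(1) by (auto simp: G'_def)
  ultimately show ?case by blast
qed simp

lemma sum_UN_le:
  fixes g :: "'c \<Rightarrow> real"
  assumes "finite K" "\<And>i. i \<in> K \<Longrightarrow> finite (S i)" "\<And>i z. i \<in> K \<Longrightarrow> z \<in> S i \<Longrightarrow> 0 \<le> g z"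
  shows "sum g (\<Union>i\<in>K. S i) \<le> (\<Sum>i\<in>K. sum g (S i))"
  using assms
proof (induction K rule: finite_induct)
  case (insert i K)
  have "sum g (S i \<union> (\<Union>i\<in>K. S i)) \<le> sum g (S i) + sum g (\<Union>i\<in>K. S i)"
    using insert by (subst sum.union_inter[symmetric]) (auto intro!: sum_nonneg)
  also have "\<dots> \<le> sum g (S i) + (\<Sum>i\<in>K. sum g (S i))"
    using insert by (intro add_left_mono insert.IH) auto
  finally show ?case using insert by simp
qed auto

definition col_avg :: "('a \<times> 'b \<Rightarrow> real) \<Rightarrow> 'b set \<Rightarrow> 'a \<Rightarrow> real" where
  "col_avg f J x = (\<Sum>y\<in>J. f (x, y)) / real (card J)"

context biparam begin

abbreviation energy :: "('a \<times> 'b \<Rightarrow> real) \<Rightarrow> ('a \<times> 'b) set \<Rightarrow> real" where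
  "energy f E \<equiv> (\<Sum>z\<in>E. f z powr p * s z powr (1 - p))"

text \<open>In each row the maximal covering intervals are disjoint, and
  \<open>restricted_weak\<close> applies to them as rectangles of height one. Passing from
  \<open>U\<close> to a set whose rows are filled by \<open>U\<close> to the fraction
  \<open>e\<close> thus costs one factor \<open>A\<close>.\<close>

lemma row_weak:
  assumes U: "U \<subseteq> X \<times> Y" and \<Omega>: "\<Omega> \<subseteq> X \<times> Y" and e: "0 < e"
    and cover: "\<And>x y. (x, y) \<in> \<Omega> \<Longrightarrow> \<exists>Q \<in> D1. x \<in> Q \<and> e * real (card Q) \<le> real (card {x \<in> Q. (x, y) \<in> U})"
  shows "sum w \<Omega> \<le> A * (1 / e) powr p * sum w U"
proof -
  define F where "F y = {Q \<in> D1. e * real (card Q) \<le> real (card {x \<in> Q. (x, y) \<in> U})}" for y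
  have FD: "F y \<subseteq> D1" for y by (auto simp: F_def)
  have finM: "finite (X.maximal (F y))" for y
    using FD X.maximal_subset X.finite_D by (meson finite_subset)
  have MD: "Q \<in> D1" "Q \<in> F y" if "Q \<in> X.maximal (F y)" for Q y
    using that FD X.maximal_subset by blast+
  have disj: "disjoint (X.maximal (F y))" for y using FD by (rule X.disjoint_maximal)
  have wnn: "0 \<le> w (x, y)" if "Q \<in> X.maximal (F y)" "x \<in> Q" "y \<in> Y" for Q x y
    using w_pos[of "(x, y)"] X.D_subset[OF MD(1)[OF that(1)]] that by auto
  have piece: "(\<Sum>x\<in>Q. w (x, y)) \<le> A * (1 / e) powr p * (\<Sum>x\<in>{x \<in> Q. (x, y) \<in> U}. w (x, y))"
    if Q: "Q \<in> X.maximal (F y)" and y: "y \<in> Y" for Q y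
  proof -
    note QD = MD[OF Q]
    have rect: "sum w (B \<times> {y}) = (\<Sum>x\<in>B. w (x, y))" for B by (simp add: sum_Times)
    have sub: "{x \<in> Q. (x, y) \<in> U} \<times> {y} \<subseteq> Q \<times> {y}" by auto
    have n: "0 < real (card Q)" using X.D_card_pos QD by simp
    have le: "e * real (card Q) \<le> real (card {x \<in> Q. (x, y) \<in> U})" using QD by (simp add: F_def)
    have nn: "0 \<le> (\<Sum>x\<in>Q. w (x, y))" using wnn[OF Q] y by (intro sum_nonneg)
    have "(\<Sum>x\<in>Q. w (x, y)) * (e * real (card Q)) powr p
        \<le> (\<Sum>x\<in>Q. w (x, y)) * real (card {x \<in> Q. (x, y) \<in> U}) powr p"
      using le n e p nn by (intro mult_left_mono powr_mono2) auto
    also have "\<dots> \<le> A * real (card Q) powr p * (\<Sum>x\<in>{x \<in> Q. (x, y) \<in> U}. w (x, y))"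
      using restricted_weak[OF QD(1) Y.D_singleton[OF y] sub] by (simp add: rect card_cartesian_product)
    finally have "real (card Q) powr p * ((\<Sum>x\<in>Q. w (x, y)) * e powr p)
        \<le> real (card Q) powr p * (A * (\<Sum>x\<in>{x \<in> Q. (x, y) \<in> U}. w (x, y)))"
      by (simp add: powr_mult mult_ac)
    then have "(\<Sum>x\<in>Q. w (x, y)) * e powr p \<le> A * (\<Sum>x\<in>{x \<in> Q. (x, y) \<in> U}. w (x, y))"
      using n by simp
    then show ?thesis using e by (simp add: powr_divide field_simps)
  qed
  have sub: "\<Omega> \<subseteq> (SIGMA y:Y. \<Union>(X.maximal (F y)))\<inverse>"
  proof (rule subrelI)
    fix x y assume xy: "(x, y) \<in> \<Omega>"
    then obtain Q where "Q \<in> F y" "x \<in> Q" using cover[OF xy] by (auto simp: F_def)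
    then have "x \<in> \<Union>(X.maximal (F y))" using FD by (auto simp: X.Union_maximal)
    then show "(x, y) \<in> (SIGMA y:Y. \<Union>(X.maximal (F y)))\<inverse>" using xy \<Omega> by auto
  qed
  have finQ: "finite Q" if "Q \<in> X.maximal (F y)" for Q y using MD(1)[OF that] by (rule X.D_finite)
  have finS: "finite (SIGMA y:Y. \<Union>(X.maximal (F y)))"
    using Y.finite_X finM finQ by (intro finite_SigmaI finite_Union) auto
  have rows: "sum g ((SIGMA y:Y. B y)\<inverse>) = (\<Sum>y\<in>Y. \<Sum>x\<in>B y. g (x, y))"
    if "\<And>y. finite (B y)" for g :: "'a \<times> 'b \<Rightarrow> real" and B
  proof -
    have "sum g ((SIGMA y:Y. B y)\<inverse>) = (\<Sum>(y, x)\<in>(SIGMA y:Y. B y). g (x, y))"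
      by (rule sum.reindex_bij_witness[of _ "\<lambda>(y, x). (x, y)" "\<lambda>(x, y). (y, x)"]) auto
    also have "\<dots> = (\<Sum>y\<in>Y. \<Sum>x\<in>B y. g (x, y))"
      using that Y.finite_X by (simp add: sum.Sigma)
    finally show ?thesis .
  qed
  have Uy: "finite {x. (x, y) \<in> U}" for y
    by (rule finite_subset[OF _ X.finite_X]) (use U in auto)
  have U_eq: "U = (SIGMA y:Y. {x. (x, y) \<in> U})\<inverse>" using U by auto
  have "sum w \<Omega> \<le> sum w ((SIGMA y:Y. \<Union>(X.maximal (F y)))\<inverse>)"
  proof (rule sum_mono2)
    show "0 \<le> w z" if "z \<in> (SIGMA y:Y. \<Union>(X.maximal (F y)))\<inverse> - \<Omega>" for z
      using that wnn by auto
  qed (use sub finS in auto)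
  also have "\<dots> = (\<Sum>y\<in>Y. \<Sum>x\<in>\<Union>(X.maximal (F y)). w (x, y))"
    by (rule rows) (use finM finQ in auto)
  also have "\<dots> = (\<Sum>y\<in>Y. \<Sum>Q\<in>X.maximal (F y). \<Sum>x\<in>Q. w (x, y))"
    using sum_UNION_disjoint_family[OF disj finQ finM, where B = "{}"] by simp
  also have "\<dots> \<le> (\<Sum>y\<in>Y. \<Sum>Q\<in>X.maximal (F y). A * (1 / e) powr p * (\<Sum>x\<in>{x \<in> Q. (x, y) \<in> U}. w (x, y)))"
    by (intro sum_mono piece)
  also have "\<dots> = A * (1 / e) powr p * (\<Sum>y\<in>Y. \<Sum>Q\<in>X.maximal (F y). \<Sum>x\<in>{x \<in> Q. (x, y) \<in> U}. w (x, y))"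
    by (simp only: sum_distrib_left)
  also have "\<dots> \<le> A * (1 / e) powr p * (\<Sum>y\<in>Y. \<Sum>x\<in>{x. (x, y) \<in> U}. w (x, y))"
  proof (intro mult_left_mono sum_mono)
    fix y assume y: "y \<in> Y"
    have eqQ: "{x \<in> Q. (x, y) \<in> U} = Q - {x. (x, y) \<notin> U}" for Q by auto
    have "(\<Sum>Q\<in>X.maximal (F y). \<Sum>x\<in>{x \<in> Q. (x, y) \<in> U}. w (x, y))
        = (\<Sum>x\<in>\<Union>(X.maximal (F y)) - {x. (x, y) \<notin> U}. w (x, y))"
      unfolding eqQ by (rule sum_UNION_disjoint_family[OF disj finQ finM, symmetric])
    also have "\<dots> \<le> (\<Sum>x\<in>{x. (x, y) \<in> U}. w (x, y))"
      using Uy U w_pos by (intro sum_mono2) (auto simp: less_imp_le)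
    finally show "(\<Sum>Q\<in>X.maximal (F y). \<Sum>x\<in>{x \<in> Q. (x, y) \<in> U}. w (x, y))
        \<le> (\<Sum>x\<in>{x. (x, y) \<in> U}. w (x, y))" .
  qed (use A in auto)
  also have "(\<Sum>y\<in>Y. \<Sum>x\<in>{x. (x, y) \<in> U}. w (x, y)) = sum w U"
    using rows[of "\<lambda>y. {x. (x, y) \<in> U}" w] Uy U_eq by simp
  finally show ?thesis .
qed

text \<open>Hoelder on the sources combined with the A_p condition on the whole rectangle; the small
  dual mass improves the usual bound by \<open>\<eta> powr (p - 1)\<close>. Two sets occur because
  smallness is known for all sources \<open>Z\<close>, while the mass is located in the part
  \<open>E\<close> that survives the selection.\<close>

lemma source_estimate:
  assumes IJ: "I \<in> D1" "J \<in> D2" and E: "E \<subseteq> Z" "Z \<subseteq> I \<times> J"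
    and f: "\<And>z. z \<in> X \<times> Y \<Longrightarrow> 0 \<le> f z" and l: "0 < l"
    and mass: "l * real (card (I \<times> J)) \<le> sum f E"
    and small: "sum s Z \<le> \<eta> * sum s (I \<times> J)" and eta: "0 \<le> \<eta>"
  shows "sum w (I \<times> J) \<le> A * \<eta> powr (p - 1) * (1 / l) powr p * energy f E"
proof -
  have EXY: "Z \<subseteq> X \<times> Y" "E \<subseteq> X \<times> Y" using E rect_subset[OF IJ] by blast+
  have finE: "finite Z" "finite E" using EXY finite_subset_XY by blast+
  define n where "n = real (card (I \<times> J))"
  have n: "0 < n" using rect_pos[OF IJ] by (simp add: n_def)
  have enn: "0 \<le> energy f E" using f EXY by (intro sum_nonneg) auto
  have "(l * n) powr p \<le> sum f E powr p"
    using mass n l p by (intro powr_mono2) (auto simp: n_def)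
  also have "\<dots> \<le> energy f E * sum s E powr (p - 1)"
    using EXY f s_pos finE by (intro holder_sum p) auto
  also have "\<dots> \<le> energy f E * (\<eta> * sum s (I \<times> J)) powr (p - 1)"
  proof (intro mult_left_mono powr_mono2)
    have "sum s E \<le> sum s Z"
      using E finE EXY by (intro sum_mono2 s_nonneg) auto
    then show "sum s E \<le> \<eta> * sum s (I \<times> J)" using small by (rule order_trans)
  qed (use enn p sum_s_nonneg[OF EXY(2)] in auto)
  finally have "(l * n) powr p \<le> energy f E * (\<eta> * sum s (I \<times> J)) powr (p - 1)" .
  then have "sum w (I \<times> J) * (l * n) powr p
      \<le> sum w (I \<times> J) * (energy f E * (\<eta> * sum s (I \<times> J)) powr (p - 1))"
    using rect_pos[OF IJ] by (intro mult_left_mono) auto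
  also have "\<dots> = energy f E * \<eta> powr (p - 1) * (sum w (I \<times> J) * sum s (I \<times> J) powr (p - 1))"
    using eta rect_pos[OF IJ] by (simp add: powr_mult mult_ac)
  also have "\<dots> \<le> energy f E * \<eta> powr (p - 1) * (A * n powr p)"
    using Ap[OF IJ] enn by (intro mult_left_mono) (auto simp: n_def)
  finally have "n powr p * (sum w (I \<times> J) * l powr p) \<le> n powr p * (A * \<eta> powr (p - 1) * energy f E)"
    using l n by (simp add: powr_mult mult_ac)
  then have "sum w (I \<times> J) * l powr p \<le> A * \<eta> powr (p - 1) * energy f E"
    using n by simp
  then show ?thesis using l by (simp add: powr_divide field_simps)
qed

text \<open>The selection of Cordoba and Fefferman: rectangles are taken in the order of decreasing height
  and kept unless the union of those kept before covers a fixed fraction of them. In a kept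
  rectangle the sources that lie in an earlier kept one with a column average of the same
  size carry little mass, so they can be dropped; after that every point is a source at most
  once per size.\<close>

lemma block_weak:
  fixes f :: "'a \<times> 'b \<Rightarrow> real" and \<R> :: "('a set \<times> 'b set) set"
    and Z :: "'a set \<Rightarrow> 'b set \<Rightarrow> ('a \<times> 'b) set" and \<L> :: "int set"
  assumes f: "\<And>z. z \<in> X \<times> Y \<Longrightarrow> 0 \<le> f z"
    and R: "\<R> \<subseteq> D1 \<times> D2" and lam: "0 < l" and c: "0 < c" "c \<le> 1" and eta: "0 \<le> \<eta>"
    and upper: "\<And>I J. (I, J) \<in> \<R> \<Longrightarrow> sum f (I \<times> J) \<le> 2 * l * real (card (I \<times> J))"
    and lower: "\<And>I J. (I, J) \<in> \<R> \<Longrightarrow> c * l * real (card (I \<times> J)) < sum f (Z I J)"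
    and Z: "\<And>I J. (I, J) \<in> \<R> \<Longrightarrow> Z I J \<subseteq> (I \<times> J) \<inter> B" and B: "B \<subseteq> X \<times> Y"
    and level: "\<And>I J x y. (I, J) \<in> \<R> \<Longrightarrow> (x, y) \<in> Z I J \<Longrightarrow> 0 < col_avg f J x \<and> lev (col_avg f J x) \<in> \<L>"
    and L: "finite \<L>" "card \<L> \<le> L"
    and small: "\<And>I J. (I, J) \<in> \<R> \<Longrightarrow> sum s (Z I J) \<le> \<eta> * sum s (I \<times> J)"
  shows "sum w (\<Union>(I, J)\<in>\<R>. I \<times> J)
    \<le> A\<^sup>2 * \<eta> powr (p - 1) * (16 / c) powr p * (2 / (c * l)) powr p * real L * energy f B"
proof -
  have finR: "finite \<R>" by (rule finite_subset[OF R]) (use X.finite_D Y.finite_D in auto)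
  then obtain xs0 where "set xs0 = \<R>" using finite_list by blast
  then obtain xs where xs: "set xs = \<R>" "sorted (map (\<lambda>R. - int (card (snd R))) xs)"
    by (metis sorted_sort_key set_sort)
  define N where "N = length xs"
  define I where "I n = fst (xs ! n)" for n
  define J where "J n = snd (xs ! n)" for n
  have R_iff: "(P, Q) \<in> \<R> \<longleftrightarrow> (\<exists>n<N. P = I n \<and> Q = J n)" for P Q
    unfolding xs(1)[symmetric] in_set_conv_nth N_def I_def J_def by (metis fst_conv prod.collapse snd_conv)
  have inR: "(I n, J n) \<in> \<R>" if "n < N" for n using that R_iff by blast
  have ID: "I n \<in> D1" and JD: "J n \<in> D2" if "n < N" for n using inR[OF that] R by auto
  have J_sorted: "card (J n) \<le> card (J i)" if "i < n" "n < N" for i n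
    using sorted_nth_mono[OF xs(2), of i n] that by (simp add: N_def J_def)
  have J_nested: "J n \<subseteq> J i" if "i < n" "n < N" "J i \<inter> J n \<noteq> {}" for i n
  proof -
    have iN: "i < N" and nN: "n < N" and le: "card (J n) \<le> card (J i)" and meet: "J i \<inter> J n \<noteq> {}"
      using that J_sorted[OF that(1,2)] by auto
    consider "J n \<subseteq> J i" | "J i \<subseteq> J n" using Y.D_laminar[OF JD[OF iN] JD[OF nN] meet] by blast
    then show ?thesis
    proof cases
      case 2
      then have "J i = J n" using le Y.D_finite[OF JD[OF nN]] by (metis card_seteq)
      then show ?thesis by simp
    qed
  qed
  \<comment> \<open>Chosen so that the mass dropped in \<open>old\<close>, which is at most
    \<open>8 * e * l\<close> times the area, is at most half of the source mass.\<close>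
  define e where "e = c / 16"
  have e: "0 < e" "e \<le> 1/16" using c by (auto simp: e_def)
  define crd where "crd n = real (card (I n \<times> J n))" for n
  obtain G where G: "G \<subseteq> {..<N}"
    "\<forall>n<N. n \<in> G \<longleftrightarrow> real (card ((I n \<times> J n) \<inter> (\<Union>i\<in>G \<inter> {..<n}. I i \<times> J i))) \<le> e * crd n"
    using ex_greedy_selection[of N "\<lambda>G n. real (card ((I n \<times> J n) \<inter> (\<Union>i\<in>G. I i \<times> J i))) \<le> e * crd n"]
    by blast
  have finG: "finite G" using G(1) finite_subset by blast
  define U where "U = (\<Union>i\<in>G. I i \<times> J i)"
  have GN: "i < N" if "i \<in> G" for i using G(1) that by blast
  have rectXY: "I n \<times> J n \<subseteq> X \<times> Y" if "n < N" for n using rect_subset[OF ID JD] that by blast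
  have UXY: "U \<subseteq> X \<times> Y" using rectXY GN by (auto simp: U_def)
  \<comment> \<open>By the sorting and the nestedness of the second sides, these are exactly the
    earlier kept rectangles that meet rectangle \<open>n\<close>, and each of them spans its full
    height. The part already covered is therefore the cylinder over \<open>V n\<close>.\<close>
  define H where "H n = {i \<in> G. i < n \<and> J n \<subseteq> J i \<and> I i \<inter> I n \<noteq> {}}" for n
  define V where "V n = (\<Union>i\<in>H n. I i \<inter> I n)" for n
  have cover_eq: "(I n \<times> J n) \<inter> (\<Union>i\<in>G \<inter> {..<n}. I i \<times> J i) = V n \<times> J n" if n: "n < N" for n
  proof
    show "(I n \<times> J n) \<inter> (\<Union>i\<in>G \<inter> {..<n}. I i \<times> J i) \<subseteq> V n \<times> J n"
    proof (rule subrelI)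
      fix x y assume "(x, y) \<in> (I n \<times> J n) \<inter> (\<Union>i\<in>G \<inter> {..<n}. I i \<times> J i)"
      then obtain i where i: "i \<in> G" "i < n" "x \<in> I i" "y \<in> J i" "x \<in> I n" "y \<in> J n" by blast
      then have "i \<in> H n" using J_nested[of i n] n by (auto simp: H_def)
      then show "(x, y) \<in> V n \<times> J n" using i by (auto simp: V_def)
    qed
    show "V n \<times> J n \<subseteq> (I n \<times> J n) \<inter> (\<Union>i\<in>G \<inter> {..<n}. I i \<times> J i)"
      by (auto simp: V_def H_def)
  qed
  have crd_eq: "crd n = real (card (I n)) * real (card (J n))" for n
    by (simp add: crd_def card_cartesian_product)
  have I_pos: "0 < real (card (I n))" "0 < real (card (J n))" "finite (I n)" "finite (J n)" if "n < N" for n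
    using X.D_card_pos[OF ID[OF that]] Y.D_card_pos[OF JD[OF that]]
      X.D_finite[OF ID[OF that]] Y.D_finite[OF JD[OF that]] by auto
  have sel_iff: "n \<in> G \<longleftrightarrow> real (card (V n)) \<le> e * real (card (I n))" if "n < N" for n
    using G(2) that cover_eq[OF that] I_pos[OF that] by (simp add: crd_eq card_cartesian_product)

  \<comment> \<open>Otherwise \<open>I i\<close> would contain \<open>I n\<close>, and rectangle
    \<open>n\<close>, being covered completely, would have been rejected.\<close>
  have nested: "I i \<subseteq> I n" if n: "n \<in> G" and i: "i \<in> H n" for i n
  proof (rule ccontr)
    assume "\<not> I i \<subseteq> I n"
    moreover have nN: "n < N" "i < N" using GN n i by (auto simp: H_def)
    ultimately have "I n \<subseteq> I i" using X.D_laminar[OF ID ID, of i n] i by (auto simp: H_def)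
    then have "V n = I n" using i by (auto simp: V_def)
    then show False using sel_iff[OF nN(1)] n e I_pos[OF nN(1)] by simp
  qed
  have finH: "finite (H n)" for n using finG by (auto simp: H_def)
  have HG: "i \<in> G" "i < N" "i < n" "J n \<subseteq> J i" if "i \<in> H n" for i n using that GN by (auto simp: H_def)
  \<comment> \<open>Each kept \<open>I i\<close> is at least half free of its predecessors. All
    members of \<open>H n\<close> span \<open>J n\<close>, so their second sides are nested; this
    makes the free parts disjoint, and they lie in the small set \<open>V n\<close>.\<close>
  have packing: "(\<Sum>i\<in>H n. real (card (I i))) \<le> 2 * e * real (card (I n))" if n: "n \<in> G" for n
  proof -
    have nN: "n < N" using GN n .
    have finV: "finite (V i)" for i
    proof (rule finite_subset[OF _ X.finite_X])
      show "V i \<subseteq> X" using X.D_subset[OF ID[OF HG(2)]] unfolding V_def by blast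
    qed
    have "(\<Sum>i\<in>H n. real (card (I i))) \<le> (\<Sum>i\<in>H n. 2 * real (card (I i - V i)))"
    proof (rule sum_mono)
      fix i assume "i \<in> H n"
      then have i: "i \<in> G" "i < N" using HG by blast+
      have "real (card (V i)) \<le> e * real (card (I i))" using sel_iff i by blast
      also have "\<dots> \<le> 1/2 * real (card (I i))" using e by (intro mult_right_mono) auto
      finally have "2 * real (card (V i)) \<le> real (card (I i))" by simp
      moreover have "real (card (I i)) - real (card (V i)) \<le> real (card (I i - V i))"
        using diff_card_le_card_Diff[OF finV, of "I i" i] by linarith
      ultimately show "real (card (I i)) \<le> 2 * real (card (I i - V i))" by linarith
    qed
    also have "\<dots> = 2 * real (\<Sum>i\<in>H n. card (I i - V i))" by (simp add: sum_distrib_left)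
    also have "(\<Sum>i\<in>H n. card (I i - V i)) = card (\<Union>i\<in>H n. I i - V i)"
    proof (rule card_UN_disjoint[symmetric])
      show "\<forall>i\<in>H n. finite (I i - V i)" using I_pos(3)[OF HG(2)] by blast
      have aux: "(I i - V i) \<inter> (I k - V k) = {}" if ik: "i \<in> H n" "k \<in> H n" "i < k" for i k
      proof (rule ccontr)
        assume "(I i - V i) \<inter> (I k - V k) \<noteq> {}"
        then obtain x where x: "x \<in> I i" "x \<in> I k" "x \<notin> V k" by blast
        have "J i \<inter> J k \<noteq> {}" using HG(4)[OF ik(1)] HG(4)[OF ik(2)] Y.D_nonempty[OF JD[OF nN]] by blast
        then have "J k \<subseteq> J i" using J_nested[OF ik(3) HG(2)[OF ik(2)]] by blast
        then have "i \<in> H k" using ik HG(1)[OF ik(1)] x by (auto simp: H_def)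
        then show False using x by (auto simp: V_def)
      qed
      show "\<forall>i\<in>H n. \<forall>j\<in>H n. i \<noteq> j \<longrightarrow> (I i - V i) \<inter> (I j - V j) = {}"
        using aux by (metis Int_commute linorder_neqE_nat)
    qed (rule finH)
    also have "card (\<Union>i\<in>H n. I i - V i) \<le> card (V n)"
      using nested[OF n] by (intro card_mono finV) (auto simp: V_def)
    also have "real (card (V n)) \<le> e * real (card (I n))" using sel_iff[OF nN] n by simp
    finally show ?thesis by simp
  qed

  \<comment> \<open>Equal levels mean comparable column averages. The mass over an old column is
    thus controlled by the average over the earlier rectangle, whose base is small by
    \<open>packing\<close>.\<close>
  define Old where "Old n = {x \<in> I n. \<exists>i\<in>H n. x \<in> I i \<and> 0 < col_avg f (J i) x
      \<and> 0 < col_avg f (J n) x \<and> lev (col_avg f (J n) x) = lev (col_avg f (J i) x)}" for n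
  define New where "New n = Z (I n) (J n) - Old n \<times> J n" for n
  have col_sum: "(\<Sum>x\<in>Q. real (card (J n)) * col_avg f (J n) x) = sum f (Q \<times> J n)" if "n < N" for Q n
    using Y.D_nonempty[OF JD[OF that]] I_pos[OF that] by (simp add: col_avg_def sum_Times)
  have col_nn: "0 \<le> col_avg f (J n) x" if "n < N" "x \<in> X" for n x
    using that f Y.D_subset[OF JD[OF that(1)]] by (auto simp: col_avg_def intro!: sum_nonneg divide_nonneg_nonneg)
  have old: "sum f (Old n \<times> J n) \<le> c / 2 * l * crd n" if n: "n \<in> G" for n
  proof -
    have nN: "n < N" using GN n .
    have IX: "I i \<subseteq> X" if "i < N" for i using X.D_subset[OF ID[OF that]] .
    define O' where "O' i = {x \<in> I i \<inter> I n. 0 < col_avg f (J i) x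
      \<and> 0 < col_avg f (J n) x \<and> lev (col_avg f (J n) x) = lev (col_avg f (J i) x)}" for i
    have finO: "finite (O' i)" for i
      by (rule finite_subset[OF _ I_pos(3)[OF nN]]) (auto simp: O'_def)
    have "Old n = (\<Union>i\<in>H n. O' i)" by (auto simp: Old_def O'_def)
    then have "sum f (Old n \<times> J n) = (\<Sum>x\<in>(\<Union>i\<in>H n. O' i). real (card (J n)) * col_avg f (J n) x)"
      using col_sum[OF nN] by simp
    also have "\<dots> \<le> (\<Sum>i\<in>H n. \<Sum>x\<in>O' i. real (card (J n)) * col_avg f (J n) x)"
    proof (rule sum_UN_le[OF finH finO])
      fix i z assume "z \<in> O' i"
      then show "0 \<le> real (card (J n)) * col_avg f (J n) z" by (auto simp: O'_def)
    qed
    also have "\<dots> \<le> (\<Sum>i\<in>H n. \<Sum>x\<in>O' i. real (card (J n)) * (2 * col_avg f (J i) x))"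
      by (intro sum_mono mult_left_mono lev_eq_le_double) (auto simp: O'_def)
    also have "\<dots> \<le> (\<Sum>i\<in>H n. \<Sum>x\<in>I i. real (card (J n)) * (2 * col_avg f (J i) x))"
    proof (intro sum_mono sum_mono2)
      fix i assume i: "i \<in> H n"
      show "finite (I i)" by (rule I_pos(3)[OF HG(2)[OF i]])
      show "0 \<le> real (card (J n)) * (2 * col_avg f (J i) x)" if "x \<in> I i - O' i" for x
        using col_nn[OF HG(2)[OF i], of x] that IX[OF HG(2)[OF i]] by auto
    qed (auto simp: O'_def)
    also have "\<dots> \<le> (\<Sum>i\<in>H n. real (card (J n)) * (4 * l * real (card (I i))))"
    proof (rule sum_mono)
      fix i assume i: "i \<in> H n"
      have iN: "i < N" using HG(2)[OF i] .
      have "real (card (J i)) * (\<Sum>x\<in>I i. col_avg f (J i) x) = sum f (I i \<times> J i)"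
        using col_sum[OF iN, of "I i"] by (simp add: sum_distrib_left)
      also have "\<dots> \<le> 2 * l * (real (card (I i)) * real (card (J i)))"
        using upper[OF inR[OF iN]] by (simp add: card_cartesian_product)
      finally have "real (card (J i)) * (\<Sum>x\<in>I i. col_avg f (J i) x)
          \<le> real (card (J i)) * (2 * l * real (card (I i)))" by (simp add: mult_ac)
      then have "(\<Sum>x\<in>I i. col_avg f (J i) x) \<le> 2 * l * real (card (I i))"
        using I_pos[OF iN] by simp
      then have "real (card (J n)) * (2 * (\<Sum>x\<in>I i. col_avg f (J i) x))
          \<le> real (card (J n)) * (2 * (2 * l * real (card (I i))))"
        by (intro mult_left_mono) auto
      then show "(\<Sum>x\<in>I i. real (card (J n)) * (2 * col_avg f (J i) x))
          \<le> real (card (J n)) * (4 * l * real (card (I i)))"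
        by (simp add: sum_distrib_left)
    qed
    also have "\<dots> = real (card (J n)) * (4 * l) * (\<Sum>i\<in>H n. real (card (I i)))"
      by (simp add: sum_distrib_left mult_ac)
    also have "\<dots> \<le> real (card (J n)) * (4 * l) * (2 * e * real (card (I n)))"
      using packing[OF n] lam by (intro mult_left_mono) auto
    also have "\<dots> = c / 2 * l * crd n" by (simp add: crd_eq e_def)
    finally show ?thesis .
  qed
  have New_sub: "New n \<subseteq> Z (I n) (J n)" "Z (I n) (J n) \<subseteq> I n \<times> J n" "New n \<subseteq> B" if "n < N" for n
    using Z[OF inR[OF that]] by (auto simp: New_def)
  have piece: "sum w (I n \<times> J n) \<le> A * \<eta> powr (p - 1) * (2 / (c * l)) powr p * energy f (New n)"
    if n: "n \<in> G" for n
  proof -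
    have nN: "n < N" using GN n .
    have finR: "finite (I n \<times> J n)" using I_pos[OF nN] by simp
    have OldI: "Old n \<times> J n \<subseteq> I n \<times> J n" by (auto simp: Old_def)
    have fnn: "0 \<le> f z" if "z \<in> I n \<times> J n" for z using that f rectXY[OF nN] by blast
    have "sum f (Z (I n) (J n)) \<le> sum f (New n \<union> Old n \<times> J n)"
    proof (rule sum_mono2)
      show "finite (New n \<union> Old n \<times> J n)"
        by (rule finite_subset[OF _ finR]) (use New_sub[OF nN] OldI in blast)
      show "0 \<le> f z" if "z \<in> New n \<union> Old n \<times> J n - Z (I n) (J n)" for z
        using that New_sub[OF nN] OldI by (intro fnn) blast
    qed (auto simp: New_def)
    also have "\<dots> = sum f (New n) + sum f (Old n \<times> J n)"
    proof (rule sum.union_disjoint)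
      show "finite (New n)" by (rule finite_subset[OF _ finR]) (use New_sub[OF nN] in blast)
      show "finite (Old n \<times> J n)" using OldI finR by (rule finite_subset)
    qed (auto simp: New_def)
    finally have "c / 2 * l * real (card (I n \<times> J n)) \<le> sum f (New n)"
      using lower[OF inR[OF nN]] old[OF n] by (simp add: crd_def)
    then have "sum w (I n \<times> J n) \<le> A * \<eta> powr (p - 1) * (1 / (c / 2 * l)) powr p * energy f (New n)"
      using c lam by (intro source_estimate[OF ID[OF nN] JD[OF nN] New_sub(1,2)[OF nN] f _ _ small[OF inR[OF nN]] eta]) auto
    then show ?thesis by simp
  qed
  \<comment> \<open>If \<open>z\<close> is new in two kept rectangles, the earlier one belongs to
    \<open>H\<close> of the later one, and equal levels at \<open>x\<close> would have put
    \<open>x\<close> into \<open>Old\<close>. So the levels are distinct, and only those in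
    \<open>\<L>\<close> are available.\<close>
  have count: "card {n \<in> G. z \<in> New n} \<le> L" for z
  proof -
    obtain x y where z: "z = (x, y)" by force
    have "inj_on (\<lambda>n. lev (col_avg f (J n) x)) {n \<in> G. z \<in> New n}"
    proof (rule linorder_inj_onI')
      fix i n assume in': "i \<in> {n \<in> G. z \<in> New n}" "n \<in> {n \<in> G. z \<in> New n}" "i < n"
      then have N': "i < N" "n < N" using GN by auto
      have zi: "(x, y) \<in> Z (I i) (J i)" "(x, y) \<in> Z (I n) (J n)" "(x, y) \<notin> Old n \<times> J n"
        using in' z by (auto simp: New_def)
      have mem: "x \<in> I i" "y \<in> J i" "x \<in> I n" "y \<in> J n"
        using zi Z[OF inR[OF N'(1)]] Z[OF inR[OF N'(2)]] by auto
      have "J n \<subseteq> J i" using J_nested[OF in'(3) N'(2)] mem by blast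
      then have "i \<in> H n" using in' mem by (auto simp: H_def)
      moreover have "x \<notin> Old n" using zi(3) mem by auto
      ultimately show "lev (col_avg f (J i) x) \<noteq> lev (col_avg f (J n) x)"
        using level[OF inR[OF N'(1)] zi(1)] level[OF inR[OF N'(2)] zi(2)] mem by (auto simp: Old_def)
    qed
    then have "card {n \<in> G. z \<in> New n} = card ((\<lambda>n. lev (col_avg f (J n) x)) ` {n \<in> G. z \<in> New n})"
      by (rule card_image[symmetric])
    also have "\<dots> \<le> card \<L>"
    proof (rule card_mono[OF L(1)], rule image_subsetI)
      fix n assume n: "n \<in> {n \<in> G. z \<in> New n}"
      then have "(x, y) \<in> Z (I n) (J n)" "n < N" using z GN by (auto simp: New_def)
      then show "lev (col_avg f (J n) x) \<in> \<L>" using level inR by blast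
    qed
    finally show ?thesis using L(2) by simp
  qed

  \<comment> \<open>A rejected rectangle is covered by a cylinder of density more than
    \<open>e\<close>, so every one of its rows is filled by \<open>U\<close> to that fraction; in a
    kept one the rows are full. The one-parameter \<open>row_weak\<close> therefore
    suffices.\<close>
  have "sum w (\<Union>(I, J)\<in>\<R>. I \<times> J) \<le> A * (1 / e) powr p * sum w U"
  proof (rule row_weak[OF UXY _ e(1)])
    show "(\<Union>(I, J)\<in>\<R>. I \<times> J) \<subseteq> X \<times> Y" using R rect_subset by blast
    fix x y assume "(x, y) \<in> (\<Union>(I, J)\<in>\<R>. I \<times> J)"
    then obtain n where n: "n < N" "x \<in> I n" "y \<in> J n" using R_iff by auto
    show "\<exists>Q\<in>D1. x \<in> Q \<and> e * real (card Q) \<le> real (card {x \<in> Q. (x, y) \<in> U})"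
    proof (intro bexI[OF _ ID[OF n(1)]] conjI n(2))
      show "e * real (card (I n)) \<le> real (card {x \<in> I n. (x, y) \<in> U})"
      proof (cases "n \<in> G")
        case True
        then have "{x \<in> I n. (x, y) \<in> U} = I n" using n by (auto simp: U_def)
        then show ?thesis using e I_pos[OF n(1)] by (simp add: mult_left_le_one_le)
      next
        case False
        then have "e * real (card (I n)) \<le> real (card (V n))" using sel_iff[OF n(1)] by simp
        also have "card (V n) \<le> card {x \<in> I n. (x, y) \<in> U}"
          using I_pos[OF n(1)] n by (intro card_mono) (auto simp: V_def H_def U_def)
        finally show ?thesis by simp
      qed
    qed
  qed
  also have "sum w U \<le> (\<Sum>n\<in>G. sum w (I n \<times> J n))"
    unfolding U_def
  proof (rule sum_UN_le[OF finG])
    show "finite (I i \<times> J i)" if "i \<in> G" for i using I_pos[OF GN[OF that]] by simp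
    show "0 \<le> w z" if "i \<in> G" "z \<in> I i \<times> J i" for i z
      using rectXY[OF GN[OF that(1)]] w_pos[of z] that(2) by (meson less_imp_le subsetD)
  qed
  also have "(\<Sum>n\<in>G. sum w (I n \<times> J n)) \<le> (\<Sum>n\<in>G. A * \<eta> powr (p - 1) * (2 / (c * l)) powr p * energy f (New n))"
    by (intro sum_mono piece)
  also have "\<dots> = A * \<eta> powr (p - 1) * (2 / (c * l)) powr p * (\<Sum>n\<in>G. energy f (New n))"
    by (simp add: sum_distrib_left)
  also have "(\<Sum>n\<in>G. energy f (New n)) \<le> real L * energy f B"
  proof -
    have finB: "finite B" using B finite_subset_XY by blast
    have \<phi>: "0 \<le> f z powr p * s z powr (1 - p)" for z by simp
    have "(\<Sum>n\<in>G. energy f (New n)) = (\<Sum>n\<in>G. \<Sum>z\<in>{z \<in> B. z \<in> New n}. f z powr p * s z powr (1 - p))"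
      using New_sub(3)[OF GN] by (intro sum.cong refl) auto
    also have "\<dots> = (\<Sum>z\<in>B. \<Sum>n\<in>{n \<in> G. z \<in> New n}. f z powr p * s z powr (1 - p))"
      by (rule sum.swap_restrict[OF finG finB])
    also have "\<dots> = (\<Sum>z\<in>B. real (card {n \<in> G. z \<in> New n}) * (f z powr p * s z powr (1 - p)))"
      by simp
    also have "\<dots> \<le> (\<Sum>z\<in>B. real L * (f z powr p * s z powr (1 - p)))"
      using count by (intro sum_mono mult_right_mono) auto
    finally show ?thesis by (simp add: sum_distrib_left)
  qed
  finally have "sum w (\<Union>(I, J)\<in>\<R>. I \<times> J)
    \<le> A * (1 / e) powr p * (A * \<eta> powr (p - 1) * (2 / (c * l)) powr p * (real L * energy f B))"
    using A by (simp add: mult_left_mono)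
  then show ?thesis by (simp add: e_def power2_eq_square mult_ac)
qed

end

text \<open>Of the \<open>2 * a + 5\<close> levels of a block, \<open>2 * a\<close> produce the
  density \<open>4 ^ -a\<close>; the other 5 give at least 32, which absorbs the 16 with room for
  strictness.\<close>

lemma sparse_of_level:
  fixes a t :: nat
  assumes t: "1 \<le> t" and le: "2 powr (real t * real (2 * a + 5)) * real cS \<le> 16 * real cI" and pos: "0 < cI"
  shows "4 ^ (t * a) * cS < cI"
proof -
  have "2 powr (real t * real (2 * a + 5)) = (2::real) ^ (t * (2 * a + 5))"
    by (simp only: of_nat_mult[symmetric] powr_realpow[of 2, simplified])
  then have "(2::real) ^ (t * (2 * a + 5)) * real cS \<le> 16 * real cI" using le by simp
  then have "real (2 ^ (t * (2 * a + 5)) * cS) \<le> real (16 * cI)" by simp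
  then have n: "2 ^ (t * (2 * a + 5)) * cS \<le> 16 * cI" by (simp only: of_nat_le_iff)
  have "32 \<le> (2::nat) ^ (t * 5)"
    using power_increasing[of 5 "t * 5" "2::nat"] t by simp
  then have "32 * (4 ^ (t * a) * cS) \<le> 2 ^ (t * 5) * (4 ^ (t * a) * cS)"
    by (rule mult_le_mono1)
  also have "\<dots> = 2 ^ (t * (2 * a + 5)) * cS"
  proof -
    have "(4::nat) ^ (t * a) = 2 ^ (2 * (t * a))" by (simp add: power_mult)
    moreover have "t * (2 * a + 5) = t * 5 + 2 * (t * a)" by (simp add: algebra_simps)
    ultimately show ?thesis by (simp add: power_add)
  qed
  finally show ?thesis using n pos by linarith
qed

lemma powr_lev_ge:
  fixes k :: int and u :: real and n K :: nat
  assumes "0 < u" "0 < K" "(lev u - k + 3) div int K = int n"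
  shows "2 powr (real_of_int k - 3 + real n * real K) \<le> u"
proof -
  have "int n * int K + (lev u - k + 3) mod int K = lev u - k + 3"
    using div_mult_mod_eq[of "lev u - k + 3" "int K"] unfolding assms(3) .
  moreover have "0 \<le> (lev u - k + 3) mod int K" using assms(2) by simp
  ultimately have "int n * int K \<le> lev u - k + 3" by linarith
  then have "real_of_int (int n * int K) \<le> real_of_int (lev u - k + 3)" by (simp only: of_int_le_iff)
  then have "real n * real K \<le> real_of_int (lev u) - real_of_int k + 3" by simp
  then have "2 powr (real_of_int k - 3 + real n * real K) \<le> 2 powr real_of_int (lev u)"
    by (intro powr_mono) auto
  also have "\<dots> \<le> u" by (rule powr_lev_le[OF assms(1)])
  finally show ?thesis .
qed

text \<open>The 16 is the 2 of the upper bound for the average times the 8 of the shift by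
  3.\<close>

lemma cancel_level:
  fixes q u n m :: real and k :: int
  assumes le: "q * 2 powr (real_of_int k - 3 + u) * n \<le> 2 * 2 powr real_of_int k * m"
  shows "q * (2 powr u * n) \<le> 16 * m"
proof -
  define a b :: real where "a = 2 powr real_of_int k" and "b = 2 powr u"
  have a: "0 < a" by (simp add: a_def)
  have eq: "2 powr (real_of_int k - 3 + u) = a * b / 8"
    by (simp add: a_def b_def powr_add powr_diff)
  have "a * (q * (b * n)) = 8 * (q * (a * b / 8) * n)" by simp
  also have "\<dots> \<le> 8 * (2 * a * m)" using le unfolding eq a_def[symmetric] by simp
  also have "\<dots> = a * (16 * m)" by simp
  finally show ?thesis using a unfolding b_def by (simp only: mult_le_cancel_left_pos)
qed

section \<open>Sources\<close>

text \<open>The values of \<open>f\<close> below \<open>2 ^ (k - 3)\<close> carry a small part of the mass of a rectangle of average \<open>2 ^ k\<close>,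
  hence the shift by 3. Only points whose column average is at most the row average are sources; the
  others are reached by exchanging the two factors.\<close>

definition sources :: "('a \<times> 'b \<Rightarrow> real) \<Rightarrow> nat \<Rightarrow> nat \<Rightarrow> int \<Rightarrow> nat \<Rightarrow> nat \<Rightarrow> 'a set \<Rightarrow> 'b set \<Rightarrow> ('a \<times> 'b) set" where
  "sources f K L k i j I J = {(x, y) \<in> I \<times> J. 0 < f (x, y) \<and> (lev (f (x, y)) - k + 3) div int K = int i
     \<and> 0 < col_avg f J x \<and> (lev (col_avg f J x) - k + 3) div int L = int j
     \<and> col_avg f J x \<le> col_avg (f \<circ> prod.swap) I y}"

context biparam begin

text \<open>Calibrated against the pigeonhole loss. The mass fraction
  \<open>2 powr (- (i + j + 4))\<close> enters \<open>block_weak\<close> inverted and to the power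
  \<open>p\<close> twice, so each step of \<open>i + j\<close> loses \<open>2 powr (2 * p)\<close>.
  The dual mass decays like \<open>\<rho> powr ((i + j) / 2)\<close>, which to the power
  \<open>p - 1\<close> gains \<open>2 powr (2 * p + 1)\<close> per step and leaves a factor
  1/2.\<close>

definition \<rho> :: real where "\<rho> = 2 powr (- (4 * p + 2) / (p - 1))"

text \<open>\<open>mK\<close> and \<open>mL\<^sup>2\<close> are at least \<open>\<kappa> / \<rho>\<close>, so that about \<open>mK\<close> generations of density \<open>1 / 4\<close> in a rectangle, or \<open>mL\<close> generations
  in both factors of a product, gain a factor \<open>\<rho>\<close> of dual measure.\<close>

definition mK :: nat where "mK = nat \<lceil>\<kappa> / \<rho>\<rceil>"
definition mL :: nat where "mL = nat \<lceil>sqrt (\<kappa> / \<rho>)\<rceil>"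
text \<open>Block lengths of the form \<open>2 * a + 5\<close> required by
  \<open>sparse_of_level\<close>: \<open>a = 2 * mK\<close> for \<open>K\<close>, since
  \<open>sparse_subset\<close> needs twice the number of generations, and \<open>a = mL\<close> for
  \<open>L\<close>.\<close>

definition K :: nat where "K = 4 * mK + 5"
definition L :: nat where "L = 2 * mL + 5"

lemma \<rho>: "0 < \<rho>" "\<rho> < 1"
proof -
  show "0 < \<rho>" by (simp add: \<rho>_def)
  have "- (4 * p + 2) / (p - 1) < 0" using p by (intro divide_neg_pos) auto
  then have "2 powr (- (4 * p + 2) / (p - 1)) < 2 powr (0::real)" by (intro powr_less_mono) auto
  then show "\<rho> < 1" by (simp add: \<rho>_def)
qed

lemma \<kappa>\<rho>: "1 \<le> \<kappa> / \<rho>" using \<kappa>_ge_1 \<rho> by (simp add: field_simps)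

lemma mK_ge: "\<kappa> / \<rho> \<le> real mK" unfolding mK_def by linarith

lemma mL_ge: "\<kappa> / \<rho> \<le> (real mL)\<^sup>2"
proof -
  have "sqrt (\<kappa> / \<rho>) \<le> real mL" unfolding mL_def by linarith
  then have "(sqrt (\<kappa> / \<rho>))\<^sup>2 \<le> (real mL)\<^sup>2" using \<kappa>\<rho> by (intro power_mono) auto
  then show ?thesis using \<kappa>\<rho> by simp
qed

lemma K_le: "real K \<le> 13 * (\<kappa> / \<rho>)"
proof -
  have "real mK \<le> \<kappa> / \<rho> + 1" unfolding mK_def using \<kappa>\<rho> by linarith
  then show ?thesis unfolding K_def using \<kappa>\<rho> by simp
qed

lemma L_le: "real L \<le> 9 * sqrt (\<kappa> / \<rho>)"
proof -
  have 1: "1 \<le> sqrt (\<kappa> / \<rho>)" using \<kappa>\<rho> by simp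
  have "real mL \<le> sqrt (\<kappa> / \<rho>) + 1" unfolding mL_def using 1 by linarith
  then have "2 * real mL + 5 \<le> 9 * sqrt (\<kappa> / \<rho>)" using 1 by linarith
  then show ?thesis by (simp add: L_def)
qed

lemma sigma_decay:
  assumes le: "M ^ n * a \<le> b * \<kappa> ^ n * c" and M: "\<kappa> / \<rho> \<le> M" and "0 \<le> a" "0 \<le> c" "0 \<le> b"
  shows "a \<le> b * \<rho> ^ n * c"
proof -
  have "(\<kappa> / \<rho>) ^ n * a \<le> M ^ n * a"
    using M \<kappa>\<rho> assms by (intro mult_right_mono power_mono) auto
  also have "\<dots> \<le> b * \<kappa> ^ n * c" by (rule le)
  finally have "\<kappa> ^ n * a \<le> \<kappa> ^ n * (b * \<rho> ^ n * c)"
    using \<rho> by (simp add: power_divide field_simps)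
  then show ?thesis using \<kappa>_ge_1 by simp
qed

lemma sum_level_le:
  fixes g :: "'c \<Rightarrow> real"
  assumes "finite P" "S \<subseteq> P" "\<And>x. x \<in> P \<Longrightarrow> 0 \<le> g x" "\<And>x. x \<in> S \<Longrightarrow> v \<le> g x"
  shows "v * real (card S) \<le> sum g P"
proof -
  have "v * real (card S) = (\<Sum>x\<in>S. v)" by simp
  also have "\<dots> \<le> sum g S" using assms by (intro sum_mono) auto
  also have "\<dots> \<le> sum g P" using assms by (intro sum_mono2) auto
  finally show ?thesis .
qed

text \<open>Chebyshev's inequality makes \<open>E\<close> sparse enough for
  \<open>sparse_subset\<close> with \<open>i\<close> blocks of \<open>mK\<close> generations, each
  of which gains \<open>\<rho>\<close>.\<close>

lemma high_small:
  assumes IJ: "I \<in> D1" "J \<in> D2" and f: "\<And>z. z \<in> X \<times> Y \<Longrightarrow> 0 \<le> f z"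
    and upper: "sum f (I \<times> J) \<le> 2 * 2 powr real_of_int k * real (card (I \<times> J))"
    and E: "E \<subseteq> I \<times> J" "\<And>z. z \<in> E \<Longrightarrow> 2 powr (real_of_int k - 3 + real i * real K) \<le> f z"
  shows "sum s E \<le> 2 * \<rho> ^ i * sum s (I \<times> J)"
proof -
  have fin: "finite (I \<times> J)" by (rule fin_rect[OF IJ])
  have pos: "0 < card I" "0 < card J" using IJ X.D_card_pos Y.D_card_pos by auto
  have fnn: "0 \<le> f z" if "z \<in> I \<times> J" for z using f that rect_subset[OF IJ] by blast
  have EXY: "E \<subseteq> X \<times> Y" using E rect_subset[OF IJ] by blast
  have nn: "0 \<le> sum s E" "0 \<le> sum s (I \<times> J)" using sum_s_nonneg EXY rect_subset[OF IJ] by auto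
  show ?thesis
  proof (cases "i = 0")
    case True
    have "sum s E \<le> sum s (I \<times> J)"
      using E fin rect_subset[OF IJ] by (intro sum_mono2 s_nonneg) auto
    then show ?thesis using True nn by simp
  next
    case False
    have "1 * 2 powr (real_of_int k - 3 + real i * real K) * real (card E) \<le> sum f (I \<times> J)"
      unfolding mult_1 by (rule sum_level_le[OF fin E(1) fnn E(2)])
    also note upper
    finally have "2 powr (real i * real K) * real (card E) \<le> 16 * real (card (I \<times> J))"
      using cancel_level[of 1] by simp
    then have "4 ^ (i * (2 * mK)) * card E < card (I \<times> J)"
      using False pos by (intro sparse_of_level) (auto simp: K_def card_cartesian_product)
    then have "real mK ^ i * sum s E \<le> 2 * \<kappa> ^ i * sum s (I \<times> J)"
      by (intro sparse_subset[OF IJ E(1)]) (simp add: mult.left_commute)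
    then show ?thesis using mK_ge nn by (intro sigma_decay) auto
  qed
qed

text \<open>Two separate bounds hold, with \<open>\<rho> ^ i\<close> from the size of
  \<open>f\<close> and \<open>\<rho> ^ j\<close> from the line averages. The better of them is at
  least as good as the one with the mean exponent.\<close>

lemma sources_small:
  assumes IJ: "I \<in> D1" "J \<in> D2" and f: "\<And>z. z \<in> X \<times> Y \<Longrightarrow> 0 \<le> f z"
    and upper: "sum f (I \<times> J) \<le> 2 * 2 powr real_of_int k * real (card (I \<times> J))"
  shows "sum s (sources f K L k i j I J) \<le> 2 * \<rho> powr ((real i + real j) / 2) * sum s (I \<times> J)"
proof -
  define E where "E = sources f K L k i j I J"
  have EIJ: "E \<subseteq> I \<times> J" by (auto simp: E_def sources_def)
  have EXY: "E \<subseteq> X \<times> Y" using EIJ rect_subset[OF IJ] by blast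
  have fin: "finite (I \<times> J)" "finite I" "finite J" using IJ X.D_finite Y.D_finite by auto
  have pos: "0 < card I" "0 < card J" using IJ X.D_card_pos Y.D_card_pos by auto
  have fnn: "0 \<le> f z" if "z \<in> I \<times> J" for z using f that rect_subset[OF IJ] by blast
  have sE: "sum s E \<le> sum s (I \<times> J)"
    using EIJ fin rect_subset[OF IJ] by (intro sum_mono2 s_nonneg) auto
  have nn: "0 \<le> sum s E" "0 \<le> sum s (I \<times> J)" using sum_s_nonneg EXY rect_subset[OF IJ] by auto
  have A: "sum s E \<le> 2 * \<rho> ^ i * sum s (I \<times> J)"
  proof (rule high_small[OF IJ f upper EIJ])
    fix z assume "z \<in> E"
    then show "2 powr (real_of_int k - 3 + real i * real K) \<le> f z"
      by (intro powr_lev_ge) (auto simp: E_def sources_def K_def)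
  qed
  have B: "sum s E \<le> 1 * \<rho> ^ j * sum s (I \<times> J)"
  proof (cases "j = 0")
    case True then show ?thesis using sE nn by simp
  next
    case False
    define v where "v = 2 powr (real_of_int k - 3 + real j * real L)"
    define S where "S = {x \<in> I. v \<le> col_avg f J x}"
    define T where "T = {y \<in> J. v \<le> col_avg (f \<circ> prod.swap) I y}"
    have colJ: "(\<Sum>x\<in>I. real (card J) * col_avg f J x) = sum f (I \<times> J)"
      using pos by (simp add: col_avg_def sum_Times)
    have rowI: "(\<Sum>y\<in>J. real (card I) * col_avg (f \<circ> prod.swap) I y) = sum f (I \<times> J)"
      using pos by (simp add: col_avg_def sum_Times sum.swap[of _ J I])
    have "real (card J) * v * real (card S) \<le> sum f (I \<times> J)"
      unfolding colJ[symmetric]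
    proof (rule sum_level_le)
      show "0 \<le> real (card J) * col_avg f J x" if "x \<in> I" for x
        using that fnn by (auto simp: col_avg_def intro!: sum_nonneg mult_nonneg_nonneg divide_nonneg_nonneg)
      show "real (card J) * v \<le> real (card J) * col_avg f J x" if "x \<in> S" for x
        using that by (intro mult_left_mono) (auto simp: S_def)
    qed (use fin in \<open>auto simp: S_def\<close>)
    also note upper
    finally have "real (card J) * (2 powr (real j * real L) * real (card S)) \<le> 16 * real (card (I \<times> J))"
      unfolding v_def by (rule cancel_level)
    also have "\<dots> = real (card J) * (16 * real (card I))" by (simp add: card_cartesian_product)
    finally have "2 powr (real j * real L) * real (card S) \<le> 16 * real (card I)"
      using pos by simp
    then have S: "4 ^ (j * mL) * card S < card I"
      using False pos by (intro sparse_of_level) (auto simp: L_def)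
    have "real (card I) * v * real (card T) \<le> sum f (I \<times> J)"
      unfolding rowI[symmetric]
    proof (rule sum_level_le)
      show "0 \<le> real (card I) * col_avg (f \<circ> prod.swap) I y" if "y \<in> J" for y
        using that fnn by (auto simp: col_avg_def intro!: sum_nonneg mult_nonneg_nonneg divide_nonneg_nonneg)
      show "real (card I) * v \<le> real (card I) * col_avg (f \<circ> prod.swap) I y" if "y \<in> T" for y
        using that by (intro mult_left_mono) (auto simp: T_def)
    qed (use fin in \<open>auto simp: T_def\<close>)
    also note upper
    finally have "real (card I) * (2 powr (real j * real L) * real (card T)) \<le> 16 * real (card (I \<times> J))"
      unfolding v_def by (rule cancel_level)
    also have "\<dots> = real (card I) * (16 * real (card J))" by (simp add: card_cartesian_product)
    finally have "2 powr (real j * real L) * real (card T) \<le> 16 * real (card J)"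
      using pos by simp
    then have T: "4 ^ (j * mL) * card T < card J"
      using False pos by (intro sparse_of_level) (auto simp: L_def)
    \<comment> \<open>The column average reaches \<open>v\<close> by the level condition, and the
      row average is at least as large. Both coordinates are thus confined to sparse sets, as
      \<open>sparse_product\<close> requires.\<close>
    have "E \<subseteq> S \<times> T"
    proof (rule subrelI)
      fix x y assume "(x, y) \<in> E"
      then have *: "x \<in> I" "y \<in> J" "0 < col_avg f J x" "(lev (col_avg f J x) - k + 3) div int L = int j"
        "col_avg f J x \<le> col_avg (f \<circ> prod.swap) I y"
        by (auto simp: E_def sources_def)
      have "v \<le> col_avg f J x" unfolding v_def by (rule powr_lev_ge[OF *(3) _ *(4)]) (simp add: L_def)
      then show "(x, y) \<in> S \<times> T" using * by (auto simp: S_def T_def)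
    qed
    moreover have ST: "S \<times> T \<subseteq> I \<times> J" by (auto simp: S_def T_def)
    ultimately have "sum s E \<le> sum s (S \<times> T)"
      using ST rect_subset[OF IJ] fin by (intro sum_mono2 s_nonneg) (auto intro: finite_subset)
    also have "\<dots> \<le> 1 * \<rho> ^ j * sum s (I \<times> J)"
    proof (rule sigma_decay[OF _ mL_ge])
      show "(real mL)\<^sup>2 ^ j * sum s (S \<times> T) \<le> 1 * \<kappa> ^ j * sum s (I \<times> J)"
        using sparse_product[OF IJ(1) _ S IJ(2) _ T] by (auto simp: S_def T_def)
      show "0 \<le> sum s (S \<times> T)" using ST rect_subset[OF IJ] by (intro sum_s_nonneg) blast
    qed (use nn in auto)
    finally show ?thesis .
  qed
  have pw: "\<rho> powr real n = \<rho> ^ n" for n using \<rho> by (simp add: powr_realpow)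
  have "sum s E \<le> 2 * \<rho> ^ max i j * sum s (I \<times> J)"
    using A B nn by (cases "i \<le> j") (auto simp: max_def)
  also have "\<rho> ^ max i j \<le> \<rho> powr ((real i + real j) / 2)"
    unfolding pw[symmetric] using \<rho> by (intro powr_mono') auto
  finally show ?thesis using nn by (simp add: E_def mult_left_mono mult_right_mono)
qed

end

lemma sum_half_powers: "(\<Sum>i<n. (1/2::real) ^ i) \<le> 2"
  by (subst sum_gp_strict) (auto simp: field_simps)

text \<open>One condition read in two directions: for fixed \<open>k\<close> it leaves an interval
  of \<open>K\<close> levels \<open>u\<close>, which limits the column levels in the selection; for
  a fixed level it leaves \<open>K\<close> values of \<open>k\<close>, which limits how often a
  point is a source.\<close>

lemma div_eq_interval:
  fixes u k :: int
  assumes "(u - k + 3) div int K = int i" "0 < K"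
  shows "u \<in> {k - 3 + int i * int K..<k - 3 + int i * int K + int K}"
    "k \<in> {u + 3 - int i * int K - int K<..u + 3 - int i * int K}"
proof -
  have "int i * int K + (u - k + 3) mod int K = u - k + 3"
    using div_mult_mod_eq[of "u - k + 3" "int K"] unfolding assms(1) .
  moreover have "0 \<le> (u - k + 3) mod int K" "(u - k + 3) mod int K < int K" using assms(2) by auto
  ultimately show "u \<in> {k - 3 + int i * int K..<k - 3 + int i * int K + int K}"
    "k \<in> {u + 3 - int i * int K - int K<..u + 3 - int i * int K}" by auto
qed

lemma lev_index:
  assumes "2 powr real_of_int k / 8 \<le> u"
  shows "(lev u - k + 3) div int m = int (nat ((lev u - k + 3) div int m))"
proof -
  have "2 powr real_of_int k / 8 = 2 powr (real_of_int k - 3)" by (simp add: powr_diff)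
  moreover have "0 < 2 powr real_of_int k / (8::real)" by simp
  then have "0 < u" using assms by linarith
  ultimately have "real_of_int k - 3 \<le> log 2 u" using assms by (simp add: le_log_iff)
  then have "k - 3 \<le> lev u" unfolding lev_def by linarith
  then show ?thesis by (simp add: div_int_pos_iff)
qed

lemma powr_le_lev:
  assumes "0 < u" "0 \<le> p"
  shows "u powr p \<le> 2 powr p * 2 powr (p * real_of_int (lev u))"
proof -
  have "u powr p \<le> (2 * 2 powr real_of_int (lev u)) powr p"
    using less_powr_lev[OF assms(1)] assms by (intro powr_mono2) auto
  also have "\<dots> = 2 powr p * 2 powr (p * real_of_int (lev u))"
    by (simp add: powr_mult powr_powr mult.commute)
  finally show ?thesis .
qed

section \<open>From the weak estimates to the two-parameter bound\<close>

context biparam begin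

definition level_set :: "('a \<times> 'b \<Rightarrow> real) \<Rightarrow> int \<Rightarrow> nat \<Rightarrow> ('a \<times> 'b) set" where
  "level_set f k i = {z \<in> X \<times> Y. 0 < f z \<and> (lev (f z) - k + 3) div int K = int i}"

lemma sources_weak:
  assumes f: "\<And>z. z \<in> X \<times> Y \<Longrightarrow> 0 \<le> f z" and R: "\<R> \<subseteq> D1 \<times> D2"
    and upper: "\<And>I J. (I, J) \<in> \<R> \<Longrightarrow> sum f (I \<times> J) \<le> 2 * 2 powr real_of_int k * real (card (I \<times> J))"
    and lower: "\<And>I J. (I, J) \<in> \<R> \<Longrightarrow>
      2 powr (- (real i + real j + 4)) * 2 powr real_of_int k * real (card (I \<times> J)) < sum f (sources f K L k i j I J)"
  shows "2 powr (p * real_of_int k) * sum w (\<Union>(I, J)\<in>\<R>. I \<times> J)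
    \<le> 2 powr (14 * p) * A\<^sup>2 * real L * ((1/2) ^ i * (1/2) ^ j * energy f (level_set f k i))"
proof -
  define m where "m = real i + real j"
  define c where "c = 2 powr (- (m + 4))"
  define \<eta> where "\<eta> = 2 * \<rho> powr (m / 2)"
  define \<L> where "\<L> = {k - 3 + int j * int L..<k - 3 + int j * int L + int L}"
  have K0: "0 < K" "0 < L" by (auto simp: K_def L_def)
  have bound: "sum w (\<Union>(I, J)\<in>\<R>. I \<times> J)
    \<le> A\<^sup>2 * \<eta> powr (p - 1) * (16 / c) powr p * (2 / (c * 2 powr real_of_int k)) powr p * real L
      * energy f (level_set f k i)"
  proof (rule block_weak[OF f R, where Z = "sources f K L k i j" and \<L> = \<L>])
    have "2 powr (- (m + 4)) \<le> 2 powr (0::real)" by (intro powr_mono) (auto simp: m_def)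
    then show "c \<le> 1" by (simp add: c_def)
    fix I J assume IJ: "(I, J) \<in> \<R>"
    then have ID: "I \<in> D1" "J \<in> D2" using R by auto
    show "sum f (I \<times> J) \<le> 2 * 2 powr real_of_int k * real (card (I \<times> J))" by (rule upper[OF IJ])
    show "c * 2 powr real_of_int k * real (card (I \<times> J)) < sum f (sources f K L k i j I J)"
      using lower[OF IJ] by (simp add: c_def m_def)
    show "sources f K L k i j I J \<subseteq> I \<times> J \<inter> level_set f k i"
      using rect_subset[OF ID] by (auto simp: sources_def level_set_def)
    show "sum s (sources f K L k i j I J) \<le> \<eta> * sum s (I \<times> J)"
      using sources_small[OF ID f upper[OF IJ]] by (simp add: \<eta>_def m_def)
    fix x y assume "(x, y) \<in> sources f K L k i j I J"
    then show "0 < col_avg f J x \<and> lev (col_avg f J x) \<in> \<L>"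
      using div_eq_interval(1)[OF _ K0(2), of "lev (col_avg f J x)" k j]
      by (auto simp: sources_def \<L>_def)
  qed (auto simp: c_def \<eta>_def \<L>_def level_set_def)
  \<comment> \<open>The first factor is \<open>2 powr (p - 1 - (2 * p + 1) * m)\<close>; the other
    two together are \<open>2 powr (2 * p * m + 13 * p - p * k)\<close>. The sum of the exponents
    keeps \<open>- m\<close>, which makes the sum over the classes converge.\<close>
  have const: "\<eta> powr (p - 1) * (16 / c) powr p * (2 / (c * 2 powr real_of_int k)) powr p
      = 2 powr (14 * p - 1 - m - p * real_of_int k)"
  proof -
    have "\<rho> powr (m / 2) = 2 powr (- (4 * p + 2) / (p - 1) * (m / 2))"
      by (simp only: \<rho>_def powr_powr)
    then have "\<eta> = 2 powr 1 * 2 powr (- (4 * p + 2) / (p - 1) * (m / 2))"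
      by (simp only: \<eta>_def powr_one)
    also have "\<dots> = 2 powr (1 - (4 * p + 2) / (p - 1) * (m / 2))"
      by (simp only: powr_add[symmetric] minus_divide_left[symmetric] mult_minus_left diff_conv_add_uminus)
    finally have "\<eta> powr (p - 1) = 2 powr ((1 - (4 * p + 2) / (p - 1) * (m / 2)) * (p - 1))"
      by (simp only: powr_powr)
    also have "(1 - (4 * p + 2) / (p - 1) * (m / 2)) * (p - 1) = (p - 1) - (2 * p + 1) * m"
      using p by (simp add: field_simps)
    finally have 1: "\<eta> powr (p - 1) = 2 powr ((p - 1) - (2 * p + 1) * m)" .
    have ic: "1 / c = 2 powr (m + 4)" unfolding c_def powr_minus_divide by simp
    have "16 / c = 2 powr 4 * (1 / c)" by simp
    also have "\<dots> = 2 powr 4 * 2 powr (m + 4)" by (simp only: ic)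
    also have "\<dots> = 2 powr (m + 8)" by (simp only: powr_add[symmetric]) (simp add: add_ac)
    finally have 2: "(16 / c) powr p = 2 powr ((m + 8) * p)" by (simp only: powr_powr)
    have "2 / (c * 2 powr real_of_int k) = 2 powr 1 * (1 / c) * 2 powr (- real_of_int k)"
      by (simp add: powr_minus_divide)
    also have "\<dots> = 2 powr 1 * 2 powr (m + 4) * 2 powr (- real_of_int k)" by (simp only: ic)
    also have "\<dots> = 2 powr (m + 5 - real_of_int k)"
      by (simp only: powr_add[symmetric]) (simp add: algebra_simps)
    finally have 3: "(2 / (c * 2 powr real_of_int k)) powr p = 2 powr ((m + 5 - real_of_int k) * p)"
      by (simp only: powr_powr)
    show ?thesis
      unfolding 1 2 3 powr_add[symmetric] by (simp add: algebra_simps)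
  qed
  have "sum w (\<Union>(I, J)\<in>\<R>. I \<times> J)
    \<le> A\<^sup>2 * (\<eta> powr (p - 1) * (16 / c) powr p * (2 / (c * 2 powr real_of_int k)) powr p) * real L
      * energy f (level_set f k i)"
    using bound by (simp only: mult.assoc)
  then have "2 powr (p * real_of_int k) * sum w (\<Union>(I, J)\<in>\<R>. I \<times> J)
    \<le> 2 powr (p * real_of_int k) * (A\<^sup>2 * 2 powr (14 * p - 1 - m - p * real_of_int k) * real L
      * energy f (level_set f k i))"
    unfolding const by (rule mult_left_mono) simp
  also have "\<dots> = (2 powr (p * real_of_int k) * 2 powr (14 * p - 1 - m - p * real_of_int k))
      * (A\<^sup>2 * real L * energy f (level_set f k i))" by (simp only: mult_ac)
  also have "\<dots> \<le> 2 powr (14 * p) * ((1/2) ^ i * (1/2) ^ j) * (A\<^sup>2 * real L * energy f (level_set f k i))"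
  proof (intro mult_right_mono)
    have "2 powr (p * real_of_int k) * 2 powr (14 * p - 1 - m - p * real_of_int k)
        = 2 powr (14 * p - 1) * 2 powr (- m)"
      by (simp only: powr_add[symmetric]) (simp add: algebra_simps)
    also have "\<dots> \<le> 2 powr (14 * p) * 2 powr (- m)" by (intro mult_right_mono powr_mono) auto
    also have "2 powr (- m) = (1/2) ^ i * (1/2) ^ j"
    proof -
      have "2 powr (- m) = 2 powr (- real i) * 2 powr (- real j)"
        by (simp only: m_def powr_add[symmetric] minus_add_distrib)
      then show ?thesis by (simp only: powr_minus_divide powr_realpow[of 2, simplified] power_one_over)
    qed
    finally show "2 powr (p * real_of_int k) * 2 powr (14 * p - 1 - m - p * real_of_int k)
        \<le> 2 powr (14 * p) * ((1/2) ^ i * (1/2) ^ j)" .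
  qed (auto intro!: sum_nonneg mult_nonneg_nonneg)
  finally show ?thesis by (simp only: mult_ac)
qed

text \<open>For each \<open>i\<close> a point lies in \<open>level_set f k i\<close> for at most
  \<open>K\<close> values of \<open>k\<close>, and the two geometric series contribute at most 2
  each: hence \<open>4 * K\<close>.\<close>

lemma level_sum:
  fixes k :: "'a \<times> 'b \<Rightarrow> int" and i j :: "'a \<times> 'b \<Rightarrow> nat"
  assumes P: "P \<subseteq> X \<times> Y" and C0: "0 \<le> C"
    and weak: "\<And>k' i' j'. 2 powr (p * real_of_int k') * sum w {z \<in> P. k z = k' \<and> i z = i' \<and> j z = j'}
      \<le> C * ((1/2) ^ i' * (1/2) ^ j' * energy f (level_set f k' i'))"
  shows "(\<Sum>z\<in>P. 2 powr (p * real_of_int (k z)) * w z) \<le> 4 * C * real K * energy f (X \<times> Y)"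
proof -
  have K0: "0 < K" by (simp add: K_def)
  define cls where "cls z = (k z, i z, j z)" for z
  have finP: "finite P" using P finite_subset_XY by blast
  have "finite (i ` P \<union> j ` P)" using finP by simp
  then obtain N where N: "i ` P \<union> j ` P \<subseteq> {..<N}" using finite_nat_bounded by blast
  define \<phi> where "\<phi> z = f z powr p * s z powr (1 - p)" for z
  have \<phi>0: "0 \<le> \<phi> z" for z by (simp add: \<phi>_def)
  have "(\<Sum>z\<in>P. 2 powr (p * real_of_int (k z)) * w z)
      = (\<Sum>q\<in>cls ` P. \<Sum>z\<in>{z \<in> P. cls z = q}. 2 powr (p * real_of_int (k z)) * w z)"
    by (rule sum.image_gen[OF finP])
  also have "\<dots> \<le> (\<Sum>(k', i', j')\<in>cls ` P. C * ((1/2) ^ i' * (1/2) ^ j' * energy f (level_set f k' i')))"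
  proof (rule sum_mono)
    fix q assume q: "q \<in> cls ` P"
    obtain k' i' j' where q_eq: "q = (k', i', j')" by (metis prod_cases3)
    have P': "{z \<in> P. cls z = q} = {z \<in> P. k z = k' \<and> i z = i' \<and> j z = j'}"
      by (auto simp: cls_def q_eq)
    have "(\<Sum>z\<in>{z \<in> P. cls z = q}. 2 powr (p * real_of_int (k z)) * w z)
        = 2 powr (p * real_of_int k') * sum w {z \<in> P. k z = k' \<and> i z = i' \<and> j z = j'}"
      unfolding P' by (simp add: sum_distrib_left)
    also note weak
    finally show "(\<Sum>z\<in>{z \<in> P. cls z = q}. 2 powr (p * real_of_int (k z)) * w z)
      \<le> (case q of (k', i', j') \<Rightarrow> C * ((1/2) ^ i' * (1/2) ^ j' * energy f (level_set f k' i')))"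
      by (simp add: q_eq)
  qed
  also have "\<dots> = C * (\<Sum>q\<in>cls ` P. \<Sum>z\<in>{z \<in> X \<times> Y. z \<in> level_set f (fst q) (fst (snd q))}.
      (1/2) ^ fst (snd q) * (1/2) ^ snd (snd q) * \<phi> z)"
  proof -
    have *: "{z \<in> X \<times> Y. z \<in> level_set f a b} = level_set f a b" for a b by (auto simp: level_set_def)
    show ?thesis unfolding * by (simp add: sum_distrib_left case_prod_unfold \<phi>_def)
  qed
  also have "\<dots>
    = C * (\<Sum>z\<in>X \<times> Y. \<Sum>q\<in>{q \<in> cls ` P. z \<in> level_set f (fst q) (fst (snd q))}.
      (1/2) ^ fst (snd q) * (1/2) ^ snd (snd q) * \<phi> z)"
    using finP X.finite_X Y.finite_X by (intro arg_cong[where f = "\<lambda>z. C * z"] sum.swap_restrict) auto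
  also have "\<dots> \<le> C * (\<Sum>z\<in>X \<times> Y. 4 * real K * \<phi> z)"
  proof (intro mult_left_mono[OF _ C0] sum_mono)
    fix z assume "z \<in> X \<times> Y"
    define S where "S a = {lev (f z) + 3 - int a * int K - int K<..lev (f z) + 3 - int a * int K}" for a
    define T where "T = (SIGMA a:{..<N}. {..<N} \<times> S a)"
    have finT: "finite T" by (auto simp: T_def S_def)
    have "(\<Sum>q\<in>{q \<in> cls ` P. z \<in> level_set f (fst q) (fst (snd q))}. (1/2::real) ^ fst (snd q) * (1/2) ^ snd (snd q))
        = (\<Sum>(a, b, c)\<in>(\<lambda>(k', i', j'). (i', j', k')) ` {q \<in> cls ` P. z \<in> level_set f (fst q) (fst (snd q))}.
          (1/2) ^ a * (1/2) ^ b)"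
      by (subst sum.reindex) (auto simp: inj_on_def case_prod_unfold)
    also have "\<dots> \<le> (\<Sum>(a, b, c)\<in>T. (1/2) ^ a * (1/2) ^ b)"
    proof (rule sum_mono2[OF finT])
      show "(\<lambda>(k', i', j'). (i', j', k')) ` {q \<in> cls ` P. z \<in> level_set f (fst q) (fst (snd q))} \<subseteq> T"
      proof (rule image_subsetI)
        fix q assume q: "q \<in> {q \<in> cls ` P. z \<in> level_set f (fst q) (fst (snd q))}"
        obtain k' i' j' where q_eq: "q = (k', i', j')" by (metis prod_cases3)
        have "(lev (f z) - k' + 3) div int K = int i'" using q by (auto simp: q_eq level_set_def)
        then have "k' \<in> S i'" unfolding S_def by (rule div_eq_interval(2)[OF _ K0])
        moreover have "i' < N" "j' < N" using q N by (auto simp: q_eq cls_def)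
        ultimately show "(\<lambda>(k', i', j'). (i', j', k')) q \<in> T" by (simp add: q_eq T_def)
      qed
    qed auto
    also have "\<dots> = (\<Sum>a<N. \<Sum>b<N. \<Sum>c\<in>S a. (1/2) ^ a * (1/2) ^ b)"
    proof -
      have "(\<Sum>(a, b, c)\<in>T. (1/2) ^ a * (1/2) ^ b)
          = (\<Sum>a<N. \<Sum>(b, c)\<in>{..<N} \<times> S a. (1/2::real) ^ a * (1/2) ^ b)"
        unfolding T_def by (rule sum.Sigma[symmetric]) (auto simp: S_def)
      then show ?thesis by (simp only: sum_Times prod.case)
    qed
    also have "\<dots> = real K * ((\<Sum>a<N. (1/2) ^ a) * (\<Sum>b<N. (1/2) ^ b))"
    proof -
      have "(\<Sum>c\<in>S a. t) = real K * t" for a and t :: real by (simp add: S_def)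
      then have "(\<Sum>a<N. \<Sum>b<N. \<Sum>c\<in>S a. (1/2) ^ a * (1/2) ^ b)
          = real K * (\<Sum>a<N. \<Sum>b<N. (1/2) ^ a * (1/2) ^ b)"
        by (simp only: sum_distrib_left)
      then show ?thesis by (simp only: sum_product)
    qed
    also have "\<dots> \<le> real K * (2 * 2)"
      by (intro mult_left_mono mult_mono sum_half_powers) (auto intro: sum_nonneg)
    finally have "(\<Sum>q\<in>{q \<in> cls ` P. z \<in> level_set f (fst q) (fst (snd q))}. (1/2::real) ^ fst (snd q) * (1/2) ^ snd (snd q)) * \<phi> z
        \<le> 4 * real K * \<phi> z"
      using \<phi>0 by (intro mult_right_mono) auto
    then show "(\<Sum>q\<in>{q \<in> cls ` P. z \<in> level_set f (fst q) (fst (snd q))}.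
        (1/2) ^ fst (snd q) * (1/2) ^ snd (snd q) * \<phi> z) \<le> 4 * real K * \<phi> z"
      by (simp add: sum_distrib_right)
  qed
  also have "\<dots> = 4 * C * real K * energy f (X \<times> Y)"
    by (simp add: \<phi>_def sum_distrib_left[symmetric])
  finally show ?thesis .
qed

lemma sources_strong:
  fixes I :: "'a \<times> 'b \<Rightarrow> 'a set" and J :: "'a \<times> 'b \<Rightarrow> 'b set" and k :: "'a \<times> 'b \<Rightarrow> int"
  assumes f: "\<And>z. z \<in> X \<times> Y \<Longrightarrow> 0 \<le> f z" and P: "P \<subseteq> X \<times> Y"
    and IJ: "\<And>z. z \<in> P \<Longrightarrow> I z \<in> D1 \<and> J z \<in> D2 \<and> z \<in> I z \<times> J z"
    and upper: "\<And>z. z \<in> P \<Longrightarrow> sum f (I z \<times> J z) \<le> 2 * 2 powr real_of_int (k z) * real (card (I z \<times> J z))"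
    and lower: "\<And>z. z \<in> P \<Longrightarrow> \<exists>i j.
      2 powr (- (real i + real j + 4)) * 2 powr real_of_int (k z) * real (card (I z \<times> J z))
        < sum f (sources f K L (k z) i j (I z) (J z))"
  shows "(\<Sum>z\<in>P. 2 powr (p * real_of_int (k z)) * w z)
    \<le> 4 * (2 powr (14 * p) * A\<^sup>2 * real L) * real K * energy f (X \<times> Y)"
proof -
  obtain i j where ij: "\<And>z. z \<in> P \<Longrightarrow>
      2 powr (- (real (i z) + real (j z) + 4)) * 2 powr real_of_int (k z) * real (card (I z \<times> J z))
        < sum f (sources f K L (k z) (i z) (j z) (I z) (J z))"
    using lower by metis
  show ?thesis
  proof (rule level_sum[OF P])
    fix k' i' j'
    define P' where "P' = {z \<in> P. k z = k' \<and> i z = i' \<and> j z = j'}"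
    define \<R> where "\<R> = (\<lambda>z. (I z, J z)) ` P'"
    have P': "z \<in> P" "k z = k'" "i z = i'" "j z = j'" if "z \<in> P'" for z
      using that by (auto simp: P'_def)
    have "P' \<subseteq> (\<Union>(I, J)\<in>\<R>. I \<times> J)"
      using IJ P'(1) by (fastforce simp: \<R>_def)
    moreover have "(\<Union>(I, J)\<in>\<R>. I \<times> J) \<subseteq> X \<times> Y"
    proof -
      have "I z \<times> J z \<subseteq> X \<times> Y" if "z \<in> P'" for z using rect_subset IJ P'(1)[OF that] by blast
      then show ?thesis by (auto simp: \<R>_def)
    qed
    ultimately have "sum w P' \<le> sum w (\<Union>(I, J)\<in>\<R>. I \<times> J)"
      using finite_subset_XY w_pos by (intro sum_mono2) (auto simp: less_imp_le subset_eq)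
    then have "2 powr (p * real_of_int k') * sum w P' \<le> 2 powr (p * real_of_int k') * sum w (\<Union>(I, J)\<in>\<R>. I \<times> J)"
      by (intro mult_left_mono) auto
    also have "\<dots> \<le> 2 powr (14 * p) * A\<^sup>2 * real L * ((1/2) ^ i' * (1/2) ^ j' * energy f (level_set f k' i'))"
    proof (rule sources_weak[OF f])
      show "\<R> \<subseteq> D1 \<times> D2" using IJ P'(1) by (auto simp: \<R>_def)
      fix I' J' assume "(I', J') \<in> \<R>"
      then obtain z where z: "z \<in> P'" "I' = I z" "J' = J z" by (auto simp: \<R>_def)
      show "sum f (I' \<times> J') \<le> 2 * 2 powr real_of_int k' * real (card (I' \<times> J'))"
        using upper[OF P'(1)[OF z(1)]] P'[OF z(1)] z by simp
      show "2 powr (- (real i' + real j' + 4)) * 2 powr real_of_int k' * real (card (I' \<times> J'))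
          < sum f (sources f K L k' i' j' I' J')"
        using ij[OF P'(1)[OF z(1)]] P'[OF z(1)] z by simp
    qed
    finally show "2 powr (p * real_of_int k') * sum w {z \<in> P. k z = k' \<and> i z = i' \<and> j z = j'}
      \<le> 2 powr (14 * p) * A\<^sup>2 * real L * ((1/2) ^ i' * (1/2) ^ j' * energy f (level_set f k' i'))"
      by (simp add: P'_def)
  qed simp
qed

text \<open>Points where \<open>f\<close>, the column average or the row average is below an eighth
  of \<open>2 powr k\<close> carry at most 3/8 of the required mass. All others are sources in one
  of the two orders of the factors. If every class failed, they would carry at most
  \<open>2 * 4 / 16 = 1/2\<close>, and 7/8 is less than 1.\<close>

lemma ex_sources:
  assumes IJ: "I \<in> D1" "J \<in> D2" and f: "\<And>z. z \<in> X \<times> Y \<Longrightarrow> 0 \<le> f z"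
    and big: "2 powr real_of_int k * real (card (I \<times> J)) \<le> sum f (I \<times> J)"
  shows "\<exists>i j. 2 powr (- (real i + real j + 4)) * 2 powr real_of_int k * real (card (I \<times> J)) < sum f (sources f K L k i j I J)
    \<or> 2 powr (- (real i + real j + 4)) * 2 powr real_of_int k * real (card (I \<times> J))
      < sum f (prod.swap ` sources (f \<circ> prod.swap) K L k i j J I)"
proof (rule ccontr)
  assume "\<not> ?thesis"
  then have le: "sum f (sources f K L k i j I J) \<le> 2 powr (- (real i + real j + 4)) * 2 powr real_of_int k * real (card (I \<times> J))"
      "sum f (prod.swap ` sources (f \<circ> prod.swap) K L k i j J I) \<le> 2 powr (- (real i + real j + 4)) * 2 powr real_of_int k * real (card (I \<times> J))"
    for i j by (auto simp: not_less)
  have K0: "0 < K" "0 < L" by (auto simp: K_def L_def)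
  define l where "l = 2 powr real_of_int k"
  have l0: "0 < l" by (simp add: l_def)
  define R where "R = I \<times> J"
  define n where "n = real (card R)"
  have finR: "finite R" unfolding R_def by (rule fin_rect[OF IJ])
  have fin: "finite I" "finite J" using IJ X.D_finite Y.D_finite by auto
  have pos: "0 < card I" "0 < card J" using IJ X.D_card_pos Y.D_card_pos by auto
  have n0: "0 < n" using rect_pos[OF IJ] by (simp add: n_def R_def)
  have n_eq: "n = real (card I) * real (card J)" by (simp add: n_def R_def card_cartesian_product)
  have fnn: "0 \<le> f z" if "z \<in> R" for z using f that rect_subset[OF IJ] by (auto simp: R_def)
  define col where "col z = col_avg f J (fst z)" for z :: "'a \<times> 'b"
  define row where "row z = col_avg (f \<circ> prod.swap) I (snd z)" for z :: "'a \<times> 'b"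
  define idx where "idx u m = nat ((lev u - k + 3) div int m)" for u m
  have lev3: "(lev u - k + 3) div int m = int (idx u m)" if "l / 8 \<le> u" for u m
    unfolding idx_def using lev_index[OF that[unfolded l_def]] .
  define L1 where "L1 = {z \<in> R. f z < l / 8}"
  define L2 where "L2 = {z \<in> R. col z < l / 8}"
  define L3 where "L3 = {z \<in> R. row z < l / 8}"
  define F where "F = (\<lambda>z. (idx (f z) K, idx (min (col z) (row z)) L)) ` R"
  define S where "S q = sources f K L k (fst q) (snd q) I J \<union> prod.swap ` sources (f \<circ> prod.swap) K L k (fst q) (snd q) J I" for q
  have srcR: "sources f K L k i j I J \<subseteq> R" "prod.swap ` sources (f \<circ> prod.swap) K L k i j J I \<subseteq> R" for i j
    by (auto simp: sources_def R_def)
  have SR: "S q \<subseteq> R" for q using srcR by (simp add: S_def)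
  have cover: "R \<subseteq> L1 \<union> L2 \<union> L3 \<union> (\<Union>q\<in>F. S q)"
  proof
    fix z assume z: "z \<in> R"
    obtain x y where xy: "z = (x, y)" by force
    show "z \<in> L1 \<union> L2 \<union> L3 \<union> (\<Union>q\<in>F. S q)"
    proof (cases "z \<in> L1 \<union> L2 \<union> L3")
      case False
      then have ge: "l / 8 \<le> f z" "l / 8 \<le> col z" "l / 8 \<le> row z" using z by (auto simp: L1_def L2_def L3_def)
      then have gt: "0 < f z" "0 < col z" "0 < row z" using l0 by linarith+
      have "z \<in> S (idx (f z) K, idx (min (col z) (row z)) L)"
      proof (cases "col z \<le> row z")
        case True
        have "z \<in> sources f K L k (idx (f z) K) (idx (col z) L) I J"
          using z gt lev3[OF ge(1), of K] lev3[OF ge(2), of L] True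
          by (simp add: sources_def xy R_def col_def row_def)
        then show ?thesis using True by (simp add: S_def)
      next
        case False
        have "(y, x) \<in> sources (f \<circ> prod.swap) K L k (idx (f z) K) (idx (row z) L) J I"
          using z gt lev3[OF ge(1), of K] lev3[OF ge(3), of L] False
          by (simp add: sources_def xy R_def col_def row_def comp_assoc)
        then have "z \<in> prod.swap ` sources (f \<circ> prod.swap) K L k (idx (f z) K) (idx (row z) L) J I"
          by (auto simp: xy intro!: image_eqI[of _ _ "(y, x)"])
        then show ?thesis using False by (simp add: S_def)
      qed
      then show ?thesis using z by (auto simp: F_def)
    qed auto
  qed
  have finF: "finite F" using finR by (simp add: F_def)
  have finS: "finite (S q)" for q using SR finR finite_subset by blast
  have finL: "finite L1" "finite L2" "finite L3" using finR by (auto simp: L1_def L2_def L3_def)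
  have un: "sum f (P \<union> Q) \<le> sum f P + sum f Q" if "P \<subseteq> R" "Q \<subseteq> R" for P Q
  proof -
    have "finite P" "finite Q" using that finR finite_subset by blast+
    then have "sum f (P \<union> Q) = sum f P + sum f Q - sum f (P \<inter> Q)" by (rule sum_Un)
    moreover have "0 \<le> sum f (P \<inter> Q)" using that fnn by (intro sum_nonneg) blast
    ultimately show ?thesis by linarith
  qed
  have b1: "sum f L1 \<le> l / 8 * n"
  proof -
    have "sum f L1 \<le> (\<Sum>z\<in>L1. l / 8)" by (intro sum_mono) (auto simp: L1_def)
    also have "\<dots> \<le> (\<Sum>z\<in>R. l / 8)" using finR l0 by (intro sum_mono2) (auto simp: L1_def)
    finally show ?thesis by (simp add: n_def mult.commute)
  qed
  have b2: "sum f L2 \<le> l / 8 * n"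
  proof -
    have "L2 = {x \<in> I. col_avg f J x < l / 8} \<times> J" by (auto simp: L2_def R_def col_def)
    then have "sum f L2 = (\<Sum>x\<in>{x \<in> I. col_avg f J x < l / 8}. real (card J) * col_avg f J x)"
      using pos by (simp add: sum_Times col_avg_def)
    also have "\<dots> \<le> (\<Sum>x\<in>{x \<in> I. col_avg f J x < l / 8}. real (card J) * (l / 8))"
      by (intro sum_mono mult_left_mono) auto
    also have "\<dots> \<le> (\<Sum>x\<in>I. real (card J) * (l / 8))" using fin l0 by (intro sum_mono2) auto
    finally show ?thesis by (simp add: n_eq mult_ac)
  qed
  have b3: "sum f L3 \<le> l / 8 * n"
  proof -
    have "L3 = I \<times> {y \<in> J. col_avg (f \<circ> prod.swap) I y < l / 8}" by (auto simp: L3_def R_def row_def)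
    then have "sum f L3 = (\<Sum>y\<in>{y \<in> J. col_avg (f \<circ> prod.swap) I y < l / 8}. real (card I) * col_avg (f \<circ> prod.swap) I y)"
      using pos by (simp add: sum_Times sum.swap[of _ _ I] col_avg_def)
    also have "\<dots> \<le> (\<Sum>y\<in>{y \<in> J. col_avg (f \<circ> prod.swap) I y < l / 8}. real (card I) * (l / 8))"
      by (intro sum_mono mult_left_mono) auto
    also have "\<dots> \<le> (\<Sum>y\<in>J. real (card I) * (l / 8))" using fin l0 by (intro sum_mono2) auto
    finally show ?thesis by (simp add: n_eq mult_ac)
  qed
  have b4: "sum f (\<Union>q\<in>F. S q) \<le> l * n / 2"
  proof -
    have "sum f (\<Union>q\<in>F. S q) \<le> (\<Sum>q\<in>F. sum f (S q))"
      by (rule sum_UN_le[OF finF finS]) (use SR fnn in blast)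
    also have "\<dots> \<le> (\<Sum>q\<in>F. l * n / 8 * ((1/2) ^ fst q * (1/2) ^ snd q))"
    proof (rule sum_mono)
      fix q assume "q \<in> F"
      have "2 powr (- (real (fst q) + real (snd q) + 4)) = 2 powr (- real (fst q)) * 2 powr (- real (snd q)) * 2 powr (- 4)"
        by (simp only: powr_add[symmetric]) simp
      also have "\<dots> = (1/2) ^ fst q * (1/2) ^ snd q / 16"
        by (simp only: powr_minus_divide powr_realpow[of 2, simplified] power_one_over) simp
      finally have e: "2 powr (- (real (fst q) + real (snd q) + 4)) = (1/2) ^ fst q * (1/2) ^ snd q / 16" .
      show "sum f (S q) \<le> l * n / 8 * ((1/2) ^ fst q * (1/2) ^ snd q)"
        using un[OF srcR(1) srcR(2), of "fst q" "snd q" "fst q" "snd q"] le[of "fst q" "snd q"]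
        unfolding e R_def[symmetric] n_def[symmetric] l_def[symmetric] by (simp add: S_def algebra_simps)
    qed
    also have "\<dots> = l * n / 8 * (\<Sum>q\<in>F. (1/2) ^ fst q * (1/2) ^ snd q)" by (simp add: sum_distrib_left)
    also have "\<dots> \<le> l * n / 8 * (2 * 2)"
    proof (rule mult_left_mono)
      have "finite (fst ` F \<union> snd ` F)" using finF by simp
      then obtain N where N: "fst ` F \<union> snd ` F \<subseteq> {..<N}" using finite_nat_bounded by blast
      have "(\<Sum>q\<in>F. (1/2::real) ^ fst q * (1/2) ^ snd q) \<le> (\<Sum>q\<in>{..<N} \<times> {..<N}. (1/2) ^ fst q * (1/2) ^ snd q)"
        using N by (intro sum_mono2) force+
      also have "\<dots> = (\<Sum>a<N. (1/2) ^ a) * (\<Sum>b<N. (1/2) ^ b)" by (simp only: sum_Times sum_product fst_conv snd_conv)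
      also have "\<dots> \<le> 2 * 2" by (intro mult_mono sum_half_powers) (auto intro: sum_nonneg)
      finally show "(\<Sum>q\<in>F. (1/2::real) ^ fst q * (1/2) ^ snd q) \<le> 2 * 2" .
    qed (use l0 n0 in auto)
    finally show ?thesis by simp
  qed
  have subR: "L1 \<subseteq> R" "L2 \<subseteq> R" "L3 \<subseteq> R" "(\<Union>q\<in>F. S q) \<subseteq> R" using SR by (auto simp: L1_def L2_def L3_def)
  have "sum f R \<le> sum f (L1 \<union> L2 \<union> L3 \<union> (\<Union>q\<in>F. S q))"
  proof (rule sum_mono2)
    show "finite (L1 \<union> L2 \<union> L3 \<union> (\<Union>q\<in>F. S q))" using finL finF finS by simp
    show "0 \<le> f z" if "z \<in> L1 \<union> L2 \<union> L3 \<union> (\<Union>q\<in>F. S q) - R" for z using that subR by blast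
  qed (rule cover)
  also have "\<dots> \<le> sum f L1 + sum f L2 + sum f L3 + sum f (\<Union>q\<in>F. S q)"
    using un[of "L1 \<union> L2 \<union> L3" "\<Union>q\<in>F. S q"] un[of "L1 \<union> L2" L3] un[of L1 L2] subR by simp
  also have "\<dots> \<le> l / 8 * n + l / 8 * n + l / 8 * n + l * n / 2" using b1 b2 b3 b4 by linarith
  also have "\<dots> < l * n" using l0 n0 by simp
  finally show False using big by (simp add: R_def n_def l_def)
qed

lemma biparam_swap: "biparam D2 Y D1 X (w \<circ> prod.swap) (s \<circ> prod.swap) p A"
proof unfold_locales
  fix I J assume IJ: "I \<in> D2" "J \<in> D1"
  have sw: "sum (g \<circ> prod.swap) (I \<times> J) = sum g (J \<times> I)" for g :: "'a \<times> 'b \<Rightarrow> real"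
    by (simp add: sum_Times sum.swap[of _ I J])
  show "sum (w \<circ> prod.swap) (I \<times> J) * sum (s \<circ> prod.swap) (I \<times> J) powr (p - 1) \<le> A * real (card (I \<times> J)) powr p"
    unfolding sw using Ap[OF IJ(2,1)] by (simp add: card_cartesian_product mult.commute)
qed (use p A w_pos s_pos ws in auto)

text \<open>The maximal operator in linearised form: \<open>I\<close> and \<open>J\<close> select a
  dyadic rectangle through each point. The points are divided by the order of the factors in which
  their rectangle has enough sources; the second kind is treated in the swapped system.\<close>

theorem strong_bound:
  fixes I :: "'a \<times> 'b \<Rightarrow> 'a set" and J :: "'a \<times> 'b \<Rightarrow> 'b set"
  assumes f: "\<And>z. z \<in> X \<times> Y \<Longrightarrow> 0 \<le> f z"
    and IJ: "\<And>z. z \<in> X \<times> Y \<Longrightarrow> I z \<in> D1 \<and> J z \<in> D2 \<and> z \<in> I z \<times> J z"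
  shows "(\<Sum>z\<in>X \<times> Y. (sum f (I z \<times> J z) / real (card (I z \<times> J z))) powr p * w z)
    \<le> 8 * 2 powr (15 * p) * A\<^sup>2 * real L * real K * energy f (X \<times> Y)"
proof -
  interpret swap: biparam D2 Y D1 X "w \<circ> prod.swap" "s \<circ> prod.swap" p A by (rule biparam_swap)
  define av where "av z = sum f (I z \<times> J z) / real (card (I z \<times> J z))" for z
  define k where "k z = lev (av z)" for z
  define P where "P = {z \<in> X \<times> Y. 0 < av z}"
  define P1 where "P1 = {z \<in> P. \<exists>i j. 2 powr (- (real i + real j + 4)) * 2 powr real_of_int (k z) * real (card (I z \<times> J z))
    < sum f (sources f K L (k z) i j (I z) (J z))}"
  have finP: "finite P" using X.finite_X Y.finite_X by (simp add: P_def)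
  have P_sub: "P \<subseteq> X \<times> Y" "P1 \<subseteq> X \<times> Y" "P1 \<subseteq> P" by (auto simp: P_def P1_def)
  have crd: "0 < real (card (I z \<times> J z))" if "z \<in> X \<times> Y" for z using IJ[OF that] rect_pos(3) by blast
  have bounds: "2 powr real_of_int (k z) * real (card (I z \<times> J z)) \<le> sum f (I z \<times> J z)"
    "sum f (I z \<times> J z) \<le> 2 * 2 powr real_of_int (k z) * real (card (I z \<times> J z))" if z: "z \<in> P" for z
  proof -
    have a: "0 < av z" "z \<in> X \<times> Y" using z by (auto simp: P_def)
    have eq: "sum f (I z \<times> J z) = av z * real (card (I z \<times> J z))" using crd[OF a(2)] by (simp add: av_def)
    show "2 powr real_of_int (k z) * real (card (I z \<times> J z)) \<le> sum f (I z \<times> J z)"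
      unfolding eq k_def using powr_lev_le[OF a(1)] by (intro mult_right_mono) auto
    show "sum f (I z \<times> J z) \<le> 2 * 2 powr real_of_int (k z) * real (card (I z \<times> J z))"
      unfolding eq k_def using less_powr_lev[OF a(1)] by (intro mult_right_mono) auto
  qed
  have S1: "(\<Sum>z\<in>P1. 2 powr (p * real_of_int (k z)) * w z)
      \<le> 4 * (2 powr (14 * p) * A\<^sup>2 * real L) * real K * energy f (X \<times> Y)"
    using P_sub IJ bounds by (intro sources_strong[OF f, where I = I and J = J]) (auto simp: P1_def)
  have sw: "sum (g \<circ> prod.swap) (prod.swap ` Q) = sum g Q" for g :: "'a \<times> 'b \<Rightarrow> real" and Q
    by (subst sum.reindex) (auto simp: inj_on_def)
  have swT: "sum (g \<circ> prod.swap) (Q \<times> Q') = sum g (Q' \<times> Q)" for g :: "'a \<times> 'b \<Rightarrow> real" and Q Q'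
    by (simp add: sum_Times sum.swap[of _ Q Q'])
  have "(\<Sum>z\<in>prod.swap ` (P - P1). 2 powr (p * real_of_int ((k \<circ> prod.swap) z)) * (w \<circ> prod.swap) z)
      \<le> 4 * (2 powr (14 * p) * A\<^sup>2 * real L) * real K * swap.energy (f \<circ> prod.swap) (Y \<times> X)"
  proof (rule swap.sources_strong[where I = "J \<circ> prod.swap" and J = "I \<circ> prod.swap"])
    show "0 \<le> (f \<circ> prod.swap) z" if "z \<in> Y \<times> X" for z using that f by auto
    show "prod.swap ` (P - P1) \<subseteq> Y \<times> X" using P_sub by auto
    fix z' assume "z' \<in> prod.swap ` (P - P1)"
    then obtain z where z: "z' = prod.swap z" "z \<in> P" "z \<notin> P1" by blast
    then have zXY: "z \<in> X \<times> Y" using P_sub by blast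
    note ij = IJ[OF zXY]
    show "(J \<circ> prod.swap) z' \<in> D2 \<and> (I \<circ> prod.swap) z' \<in> D1 \<and> z' \<in> (J \<circ> prod.swap) z' \<times> (I \<circ> prod.swap) z'"
      using ij by (auto simp: z(1))
    show "sum (f \<circ> prod.swap) ((J \<circ> prod.swap) z' \<times> (I \<circ> prod.swap) z')
        \<le> 2 * 2 powr real_of_int ((k \<circ> prod.swap) z') * real (card ((J \<circ> prod.swap) z' \<times> (I \<circ> prod.swap) z'))"
      using bounds(2)[OF z(2)] unfolding swT by (simp add: z(1) card_cartesian_product mult_ac)
    have "\<exists>i j. 2 powr (- (real i + real j + 4)) * 2 powr real_of_int (k z) * real (card (I z \<times> J z))
        < sum f (prod.swap ` sources (f \<circ> prod.swap) K L (k z) i j (J z) (I z))"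
      using ex_sources[OF _ _ f bounds(1)[OF z(2)]] ij z(2,3) by (auto simp: P1_def)
    moreover have "sum f (prod.swap ` Q) = sum (f \<circ> prod.swap) Q" for Q
      by (subst sum.reindex) (auto simp: inj_on_def)
    ultimately show "\<exists>i j. 2 powr (- (real i + real j + 4)) * 2 powr real_of_int ((k \<circ> prod.swap) z')
        * real (card ((J \<circ> prod.swap) z' \<times> (I \<circ> prod.swap) z'))
        < sum (f \<circ> prod.swap) (sources (f \<circ> prod.swap) K L ((k \<circ> prod.swap) z') i j ((J \<circ> prod.swap) z') ((I \<circ> prod.swap) z'))"
      by (simp add: z(1) card_cartesian_product mult.commute[of "real (card (J z))"])
  qed
  moreover have "(\<Sum>z\<in>prod.swap ` (P - P1). 2 powr (p * real_of_int ((k \<circ> prod.swap) z)) * (w \<circ> prod.swap) z)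
      = (\<Sum>z\<in>P - P1. 2 powr (p * real_of_int (k z)) * w z)"
    using sw[of "\<lambda>z. 2 powr (p * real_of_int (k z)) * w z"] by (simp add: o_def)
  moreover have "swap.energy (f \<circ> prod.swap) (Y \<times> X) = energy f (X \<times> Y)"
    using swT[of "\<lambda>z. f z powr p * s z powr (1 - p)"] by (simp add: o_def)
  ultimately have S2: "(\<Sum>z\<in>P - P1. 2 powr (p * real_of_int (k z)) * w z)
      \<le> 4 * (2 powr (14 * p) * A\<^sup>2 * real L) * real K * energy f (X \<times> Y)" by simp
  have "(\<Sum>z\<in>X \<times> Y. av z powr p * w z) = (\<Sum>z\<in>P. av z powr p * w z)"
  proof (rule sum.mono_neutral_right)
    have "0 \<le> av z" if "z \<in> X \<times> Y" for z
    proof -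
      have "I z \<times> J z \<subseteq> X \<times> Y" using IJ[OF that] by (intro rect_subset) auto
      then show ?thesis unfolding av_def by (intro divide_nonneg_nonneg sum_nonneg f) auto
    qed
    then show "\<forall>z\<in>X \<times> Y - P. av z powr p * w z = 0" by (fastforce simp: P_def)
  qed (use P_sub X.finite_X Y.finite_X in auto)
  also have "\<dots> \<le> (\<Sum>z\<in>P. 2 powr p * (2 powr (p * real_of_int (k z)) * w z))"
  proof (rule sum_mono)
    fix z assume z: "z \<in> P"
    then have "0 < av z" "0 \<le> w z" using w_pos[of z] by (auto simp: P_def less_imp_le)
    then show "av z powr p * w z \<le> 2 powr p * (2 powr (p * real_of_int (k z)) * w z)"
      unfolding k_def mult.assoc[symmetric] using p by (intro mult_right_mono powr_le_lev) auto
  qed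
  also have "\<dots> = 2 powr p * ((\<Sum>z\<in>P - P1. 2 powr (p * real_of_int (k z)) * w z) + (\<Sum>z\<in>P1. 2 powr (p * real_of_int (k z)) * w z))"
    using sum.subset_diff[OF P_sub(3) finP, of "\<lambda>z. 2 powr (p * real_of_int (k z)) * w z"]
    by (simp add: sum_distrib_left[symmetric])
  also have "\<dots> \<le> 2 powr p * (4 * (2 powr (14 * p) * A\<^sup>2 * real L) * real K * energy f (X \<times> Y)
      + 4 * (2 powr (14 * p) * A\<^sup>2 * real L) * real K * energy f (X \<times> Y))"
    using S1 S2 by (intro mult_left_mono add_mono) auto
  also have "\<dots> = 8 * (2 powr p * 2 powr (14 * p)) * A\<^sup>2 * real L * real K * energy f (X \<times> Y)" by simp
  also have "2 powr p * 2 powr (14 * p) = 2 powr (15 * p)" by (simp flip: powr_add)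
  finally show ?thesis by (simp add: av_def)
qed

end

section \<open>The one-parameter bound\<close>

context biparam begin

text \<open>In a single row the maximal intervals are disjoint, so they replace the selection and no
  overlap has to be counted. Only the factor \<open>A\<close> of \<open>source_estimate\<close> is
  paid.\<close>

lemma row_level_weak:
  fixes I :: "'a \<times> 'b \<Rightarrow> 'a set"
  assumes f: "\<And>z. z \<in> X \<times> Y \<Longrightarrow> 0 \<le> f z" and P: "P \<subseteq> X \<times> Y"
    and I: "\<And>z. z \<in> P \<Longrightarrow> I z \<in> D1 \<and> fst z \<in> I z"
    and upper: "\<And>z. z \<in> P \<Longrightarrow> sum f (I z \<times> {snd z}) \<le> 2 * 2 powr real_of_int k * real (card (I z \<times> {snd z}))"
    and lower: "\<And>z. z \<in> P \<Longrightarrow> 2 powr (- (real i + 2)) * 2 powr real_of_int k * real (card (I z \<times> {snd z}))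
      < sum f ((I z \<times> {snd z}) \<inter> level_set f k i)"
  shows "2 powr (p * real_of_int k) * sum w P
    \<le> 2 powr (3 * p) * A * ((1/2) ^ i * energy f (level_set f k i))"
proof -
  define B where "B = level_set f k i"
  define F where "F y = {I z | z. z \<in> P \<and> snd z = y}" for y
  have FD: "F y \<subseteq> D1" for y using I by (auto simp: F_def)
  define M where "M = (SIGMA y:Y. X.maximal (F y))"
  have M: "y \<in> Y" "Q \<in> X.maximal (F y)" "Q \<in> D1" "\<exists>z\<in>P. Q = I z \<and> snd z = y" if "(y, Q) \<in> M" for y Q
  proof -
    show "y \<in> Y" "Q \<in> X.maximal (F y)" using that by (auto simp: M_def)
    then have "Q \<in> F y" using X.maximal_subset by blast
    then show "Q \<in> D1" "\<exists>z\<in>P. Q = I z \<and> snd z = y" using FD[of y] unfolding F_def by blast+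
  qed
  have finM: "finite M"
  proof -
    have "finite (X.maximal (F y))" for y
      using X.finite_D FD X.maximal_subset by (meson finite_subset)
    then show ?thesis unfolding M_def using Y.finite_X by (intro finite_SigmaI)
  qed
  define rect where "rect q = snd q \<times> {fst q}" for q :: "'b \<times> 'a set"
  have rect: "rect q \<subseteq> X \<times> Y" "finite (rect q)" if "q \<in> M" for q
    using M[of "fst q" "snd q"] that X.D_subset X.D_finite by (auto simp: rect_def)
  have PM: "P \<subseteq> (\<Union>q\<in>M. rect q)"
  proof (rule subrelI)
    fix x y assume xy: "(x, y) \<in> P"
    then have "I (x, y) \<in> F y" by (auto simp: F_def)
    then obtain Q where "Q \<in> X.maximal (F y)" "I (x, y) \<subseteq> Q" using X.ex_maximal[OF FD] by blast
    moreover have "y \<in> Y" "x \<in> I (x, y)" using P I[OF xy] xy by auto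
    ultimately show "(x, y) \<in> (\<Union>q\<in>M. rect q)" by (auto simp: M_def rect_def intro!: bexI[of _ "(y, Q)"])
  qed
  define \<eta> where "\<eta> = 2 * \<rho> ^ i"
  define l where "l = 2 powr (- (real i + 2)) * 2 powr real_of_int k"
  have eta0: "0 \<le> \<eta>" using \<rho> by (simp add: \<eta>_def)
  have l0: "0 < l" by (simp add: l_def)
  have K0: "0 < K" by (simp add: K_def)
  have piece: "sum w (rect q) \<le> A * \<eta> powr (p - 1) * (1 / l) powr p * energy f (rect q \<inter> B)" if q: "q \<in> M" for q
  proof -
    obtain y Q where yQ: "q = (y, Q)" by force
    note m = M[OF q[unfolded yQ]]
    obtain z where z: "z \<in> P" "Q = I z" "snd z = y" using m(4) by blast
    have yD: "{y} \<in> D2" using m(1) by (rule Y.D_singleton)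
    show ?thesis
      unfolding yQ rect_def fst_conv snd_conv
    proof (rule source_estimate[OF m(3) yD subset_refl _ f l0])
      show "l * real (card (Q \<times> {y})) \<le> sum f (Q \<times> {y} \<inter> B)"
        using lower[OF z(1)] unfolding z(2,3) B_def l_def by simp
      show "sum s (Q \<times> {y} \<inter> B) \<le> \<eta> * sum s (Q \<times> {y})"
        unfolding \<eta>_def
      proof (rule high_small[OF m(3) yD f])
        show "sum f (Q \<times> {y}) \<le> 2 * 2 powr real_of_int k * real (card (Q \<times> {y}))"
          using upper[OF z(1)] unfolding z(2,3) by simp
        fix z assume "z \<in> Q \<times> {y} \<inter> B"
        then show "2 powr (real_of_int k - 3 + real i * real K) \<le> f z"
          using K0 by (intro powr_lev_ge) (auto simp: B_def level_set_def)
      qed auto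
    qed (use eta0 in auto)
  qed
  have wnn: "0 \<le> w z" if "z \<in> X \<times> Y" for z using w_pos[OF that] by simp
  have "sum w P \<le> sum w (\<Union>q\<in>M. rect q)"
    using PM finM rect wnn by (intro sum_mono2) blast+
  also have "\<dots> \<le> (\<Sum>q\<in>M. sum w (rect q))"
    by (rule sum_UN_le[OF finM]) (use rect wnn in blast)+
  also have "\<dots> \<le> (\<Sum>q\<in>M. A * \<eta> powr (p - 1) * (1 / l) powr p * energy f (rect q \<inter> B))"
    by (rule sum_mono[OF piece])
  also have "\<dots> = A * \<eta> powr (p - 1) * (1 / l) powr p * (\<Sum>q\<in>M. energy f (rect q \<inter> B))"
    by (simp only: sum_distrib_left)
  also have "(\<Sum>q\<in>M. energy f (rect q \<inter> B)) = energy f (\<Union>q\<in>M. rect q \<inter> B)"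
  proof (rule sum.UNION_disjoint[symmetric, OF finM])
    show "\<forall>q\<in>M. finite (rect q \<inter> B)" using rect by blast
    show "\<forall>q\<in>M. \<forall>q'\<in>M. q \<noteq> q' \<longrightarrow> rect q \<inter> B \<inter> (rect q' \<inter> B) = {}"
    proof (intro ballI impI)
      fix q q' assume q: "q \<in> M" "q' \<in> M" "q \<noteq> q'"
      obtain y Q y' Q' where eq: "q = (y, Q)" "q' = (y', Q')" by (metis prod.exhaust)
      have m: "Q \<in> X.maximal (F y)" "Q' \<in> X.maximal (F y')" using M(2) q(1,2) unfolding eq by blast+
      show "rect q \<inter> B \<inter> (rect q' \<inter> B) = {}"
      proof (cases "y = y'")
        case True
        then have "Q \<inter> Q' = {}"
          using disjointD[OF X.disjoint_maximal[OF FD[of y]], of Q Q'] m q(3) eq by auto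
        then show ?thesis by (auto simp: rect_def eq)
      qed (auto simp: rect_def eq)
    qed
  qed
  finally have "sum w P \<le> A * \<eta> powr (p - 1) * (1 / l) powr p * energy f (\<Union>q\<in>M. rect q \<inter> B)" .
  also have "\<dots> \<le> A * \<eta> powr (p - 1) * (1 / l) powr p * energy f B"
  proof (intro mult_left_mono sum_mono2)
    show "finite B" by (rule finite_subset_XY) (auto simp: B_def level_set_def)
  qed (use A in auto)
  also have "\<dots> = A * (\<eta> powr (p - 1) * (1 / l) powr p) * energy f B" by simp
  also have "\<eta> powr (p - 1) * (1 / l) powr p = 2 powr (3 * p - 1 - (3 * p + 2) * real i - p * real_of_int k)"
  proof -
    have "\<rho> ^ i = 2 powr (- (4 * p + 2) / (p - 1) * real i)"
      using \<rho> by (simp only: powr_realpow[symmetric]) (simp only: \<rho>_def powr_powr)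
    then have "\<eta> = 2 powr 1 * 2 powr (- (4 * p + 2) / (p - 1) * real i)"
      by (simp only: \<eta>_def powr_one)
    also have "\<dots> = 2 powr (1 - (4 * p + 2) / (p - 1) * real i)"
      by (simp only: powr_add[symmetric] minus_divide_left[symmetric] mult_minus_left diff_conv_add_uminus)
    finally have "\<eta> powr (p - 1) = 2 powr ((1 - (4 * p + 2) / (p - 1) * real i) * (p - 1))"
      by (simp only: powr_powr)
    also have "(1 - (4 * p + 2) / (p - 1) * real i) * (p - 1) = (p - 1) - (4 * p + 2) * real i"
      using p by (simp add: field_simps)
    finally have 1: "\<eta> powr (p - 1) = 2 powr ((p - 1) - (4 * p + 2) * real i)" .
    have "1 / l = 2 powr (real i + 2) * 2 powr (- real_of_int k)"
      unfolding l_def powr_minus_divide by simp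
    also have "\<dots> = 2 powr (real i + 2 - real_of_int k)" by (simp only: powr_add[symmetric]) simp
    finally have 2: "(1 / l) powr p = 2 powr ((real i + 2 - real_of_int k) * p)" by (simp only: powr_powr)
    show ?thesis unfolding 1 2 powr_add[symmetric] by (simp add: algebra_simps)
  qed
  also have "\<dots> \<le> 2 powr (3 * p - real i - p * real_of_int k)"
  proof (rule powr_mono)
    have "real i \<le> (3 * p + 2) * real i" using p by (simp add: mult_le_cancel_right1)
    then show "3 * p - 1 - (3 * p + 2) * real i - p * real_of_int k \<le> 3 * p - real i - p * real_of_int k"
      by linarith
  qed simp
  finally have "sum w P \<le> A * 2 powr (3 * p - real i - p * real_of_int k) * energy f B"
    using A by (simp add: mult_left_mono mult_right_mono sum_nonneg)
  then have "2 powr (p * real_of_int k) * sum w P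
      \<le> 2 powr (p * real_of_int k) * (A * 2 powr (3 * p - real i - p * real_of_int k) * energy f B)"
    by (intro mult_left_mono) auto
  also have "\<dots> = (2 powr (p * real_of_int k) * 2 powr (3 * p - real i - p * real_of_int k)) * A * energy f B"
    by (simp only: mult_ac)
  also have "2 powr (p * real_of_int k) * 2 powr (3 * p - real i - p * real_of_int k) = 2 powr (3 * p) * 2 powr (- real i)"
    by (simp only: powr_add[symmetric]) (simp add: algebra_simps)
  also have "2 powr (- real i) = (1/2) ^ i"
    by (simp only: powr_minus_divide powr_realpow[of 2, simplified] power_one_over)
  finally show ?thesis by (simp only: mult_ac B_def)
qed

text \<open>As in \<open>ex_sources\<close>: values below an eighth carry at most 1/8 of the
  required mass, and classes that all fail carry at most \<open>2 / 4\<close>.\<close>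

lemma ex_row_level:
  assumes I: "I \<in> D1" and y: "y \<in> Y" and f: "\<And>z. z \<in> X \<times> Y \<Longrightarrow> 0 \<le> f z"
    and big: "2 powr real_of_int k * real (card (I \<times> {y})) \<le> sum f (I \<times> {y})"
  shows "\<exists>i. 2 powr (- (real i + 2)) * 2 powr real_of_int k * real (card (I \<times> {y}))
      < sum f ((I \<times> {y}) \<inter> level_set f k i)"
proof (rule ccontr)
  assume "\<not> ?thesis"
  then have le: "sum f ((I \<times> {y}) \<inter> level_set f k i) \<le> 2 powr (- (real i + 2)) * 2 powr real_of_int k * real (card (I \<times> {y}))"
    for i by (auto simp: not_less)
  have K0: "0 < K" by (simp add: K_def)
  define l where "l = 2 powr real_of_int k"
  have l0: "0 < l" by (simp add: l_def)
  define R where "R = I \<times> {y}"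
  define n where "n = real (card R)"
  have yD: "{y} \<in> D2" using y by (rule Y.D_singleton)
  have finR: "finite R" unfolding R_def by (rule fin_rect[OF I yD])
  have RXY: "R \<subseteq> X \<times> Y" unfolding R_def by (rule rect_subset[OF I yD])
  have n0: "0 < n" using rect_pos[OF I yD] by (simp add: n_def R_def)
  have fnn: "0 \<le> f z" if "z \<in> R" for z using f that RXY by blast
  define idx where "idx z = nat ((lev (f z) - k + 3) div int K)" for z
  define L1 where "L1 = {z \<in> R. f z < l / 8}"
  have cover: "R \<subseteq> L1 \<union> (\<Union>i\<in>idx ` R. R \<inter> level_set f k i)"
  proof
    fix z assume z: "z \<in> R"
    show "z \<in> L1 \<union> (\<Union>i\<in>idx ` R. R \<inter> level_set f k i)"
    proof (cases "z \<in> L1")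
      case False
      then have ge: "l / 8 \<le> f z" using z by (simp add: L1_def)
      then have "0 < f z" using l0 by linarith
      moreover have "(lev (f z) - k + 3) div int K = int (idx z)"
        unfolding idx_def using lev_index[OF ge[unfolded l_def]] .
      ultimately show ?thesis using z RXY by (auto simp: level_set_def)
    qed simp
  qed
  have finI: "finite (idx ` R)" using finR by simp
  have finL: "finite L1" using finR by (simp add: L1_def)
  have b1: "sum f L1 \<le> l / 8 * n"
  proof -
    have "sum f L1 \<le> (\<Sum>z\<in>L1. l / 8)" by (intro sum_mono) (auto simp: L1_def)
    also have "\<dots> \<le> (\<Sum>z\<in>R. l / 8)" using finR l0 by (intro sum_mono2) (auto simp: L1_def)
    finally show ?thesis by (simp add: n_def mult.commute)
  qed
  have b2: "sum f (\<Union>i\<in>idx ` R. R \<inter> level_set f k i) \<le> l * n / 2"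
  proof -
    have "sum f (\<Union>i\<in>idx ` R. R \<inter> level_set f k i) \<le> (\<Sum>i\<in>idx ` R. sum f (R \<inter> level_set f k i))"
      by (rule sum_UN_le[OF finI]) (use finR fnn in auto)
    also have "\<dots> \<le> (\<Sum>i\<in>idx ` R. l * n / 4 * (1/2) ^ i)"
    proof (rule sum_mono)
      fix i assume "i \<in> idx ` R"
      have "2 powr (- (real i + 2)) = 2 powr (- real i) * 2 powr (- 2)"
        by (simp only: powr_add[symmetric]) simp
      also have "\<dots> = (1/2) ^ i / 4"
        by (simp only: powr_minus_divide powr_realpow[of 2, simplified] power_one_over) simp
      finally have e: "2 powr (- (real i + 2)) = (1/2) ^ i / 4" .
      show "sum f (R \<inter> level_set f k i) \<le> l * n / 4 * (1/2) ^ i"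
        using le[of i] unfolding e R_def[symmetric] n_def[symmetric] l_def[symmetric] by (simp add: algebra_simps)
    qed
    also have "\<dots> = l * n / 4 * (\<Sum>i\<in>idx ` R. (1/2) ^ i)" by (simp only: sum_distrib_left)
    also have "\<dots> \<le> l * n / 4 * 2"
    proof (rule mult_left_mono)
      obtain N where N: "idx ` R \<subseteq> {..<N}" using finite_nat_bounded[OF finI] by blast
      have "(\<Sum>i\<in>idx ` R. (1/2::real) ^ i) \<le> (\<Sum>i<N. (1/2) ^ i)"
        using N by (intro sum_mono2) auto
      also have "\<dots> \<le> 2" by (rule sum_half_powers)
      finally show "(\<Sum>i\<in>idx ` R. (1/2::real) ^ i) \<le> 2" .
    qed (use l0 n0 in auto)
    finally show ?thesis by simp
  qed
  have "sum f R \<le> sum f (L1 \<union> (\<Union>i\<in>idx ` R. R \<inter> level_set f k i))"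
    using cover finL finI finR fnn by (intro sum_mono2) (auto simp: L1_def)
  also have "\<dots> \<le> sum f L1 + sum f (\<Union>i\<in>idx ` R. R \<inter> level_set f k i)"
  proof -
    have "sum f (L1 \<union> U) = sum f L1 + sum f U - sum f (L1 \<inter> U)" if "finite U" for U
      using finL that by (rule sum_Un)
    moreover have "0 \<le> sum f (L1 \<inter> U)" for U using fnn by (intro sum_nonneg) (auto simp: L1_def)
    ultimately show ?thesis using finI finR by (smt (verit) finite_Int finite_UN_I)
  qed
  also have "\<dots> < l * n" using b1 b2 mult_pos_pos[OF l0 n0] by linarith
  finally show False using big by (simp add: R_def n_def l_def)
qed

theorem row_bound:
  fixes I :: "'a \<times> 'b \<Rightarrow> 'a set"
  assumes f: "\<And>z. z \<in> X \<times> Y \<Longrightarrow> 0 \<le> f z"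
    and I: "\<And>z. z \<in> X \<times> Y \<Longrightarrow> I z \<in> D1 \<and> fst z \<in> I z"
  shows "(\<Sum>z\<in>X \<times> Y. (sum f (I z \<times> {snd z}) / real (card (I z \<times> {snd z}))) powr p * w z)
    \<le> 4 * 2 powr (4 * p) * A * real K * energy f (X \<times> Y)"
proof -
  define av where "av z = sum f (I z \<times> {snd z}) / real (card (I z \<times> {snd z}))" for z
  define k where "k z = lev (av z)" for z
  define P where "P = {z \<in> X \<times> Y. 0 < av z}"
  have P_sub: "P \<subseteq> X \<times> Y" by (auto simp: P_def)
  have D: "I z \<in> D1" "{snd z} \<in> D2" if "z \<in> X \<times> Y" for z
    using I[OF that] Y.D_singleton that by auto
  have bounds: "2 powr real_of_int (k z) * real (card (I z \<times> {snd z})) \<le> sum f (I z \<times> {snd z})"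
    "sum f (I z \<times> {snd z}) \<le> 2 * 2 powr real_of_int (k z) * real (card (I z \<times> {snd z}))" if z: "z \<in> P" for z
  proof -
    have a: "0 < av z" "z \<in> X \<times> Y" using z by (auto simp: P_def)
    have eq: "sum f (I z \<times> {snd z}) = av z * real (card (I z \<times> {snd z}))"
      using rect_pos(3)[OF D[OF a(2)]] by (simp add: av_def)
    show "2 powr real_of_int (k z) * real (card (I z \<times> {snd z})) \<le> sum f (I z \<times> {snd z})"
      unfolding eq k_def using powr_lev_le[OF a(1)] by (intro mult_right_mono) auto
    show "sum f (I z \<times> {snd z}) \<le> 2 * 2 powr real_of_int (k z) * real (card (I z \<times> {snd z}))"
      unfolding eq k_def using less_powr_lev[OF a(1)] by (intro mult_right_mono) auto
  qed
  have "\<exists>i. 2 powr (- (real i + 2)) * 2 powr real_of_int (k z) * real (card (I z \<times> {snd z}))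
      < sum f ((I z \<times> {snd z}) \<inter> level_set f (k z) i)" if "z \<in> P" for z
    using that P_sub D[of z] by (intro ex_row_level[OF _ _ f bounds(1)]) auto
  then obtain i where i: "\<And>z. z \<in> P \<Longrightarrow> 2 powr (- (real (i z) + 2)) * 2 powr real_of_int (k z) * real (card (I z \<times> {snd z}))
      < sum f ((I z \<times> {snd z}) \<inter> level_set f (k z) (i z))" by metis
  have S: "(\<Sum>z\<in>P. 2 powr (p * real_of_int (k z)) * w z) \<le> 4 * (2 powr (3 * p) * A) * real K * energy f (X \<times> Y)"
  \<comment> \<open>With a single sorting the second index is frozen at 0.\<close>
  proof (rule level_sum[OF P_sub, where j = "\<lambda>_. 0"])
    fix k' i' and j' :: nat
    define P' where "P' = {z \<in> P. k z = k' \<and> i z = i' \<and> 0 = j'}"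
    have P': "z \<in> P" "k z = k'" "i z = i'" if "z \<in> P'" for z using that by (auto simp: P'_def)
    show "2 powr (p * real_of_int k') * sum w {z \<in> P. k z = k' \<and> i z = i' \<and> 0 = j'}
      \<le> 2 powr (3 * p) * A * ((1/2) ^ i' * (1/2) ^ j' * energy f (level_set f k' i'))"
    proof (cases "j' = 0")
      case True
      have "2 powr (p * real_of_int k') * sum w P' \<le> 2 powr (3 * p) * A * ((1/2) ^ i' * energy f (level_set f k' i'))"
      proof (rule row_level_weak[OF f, where I = I])
        show "P' \<subseteq> X \<times> Y" using P_sub P'(1) by blast
        fix z assume z: "z \<in> P'"
        note z' = P'[OF z]
        show "I z \<in> D1 \<and> fst z \<in> I z" using I P_sub z'(1) by blast
        show "sum f (I z \<times> {snd z}) \<le> 2 * 2 powr real_of_int k' * real (card (I z \<times> {snd z}))"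
          using bounds(2)[OF z'(1)] z'(2) by simp
        show "2 powr (- (real i' + 2)) * 2 powr real_of_int k' * real (card (I z \<times> {snd z}))
            < sum f ((I z \<times> {snd z}) \<inter> level_set f k' i')"
          using i[OF z'(1)] z'(2,3) by simp
      qed
      then show ?thesis using True by (simp add: P'_def)
    next
      case False
      have "0 \<le> 2 powr (3 * p) * A * ((1/2) ^ i' * (1/2) ^ j' * energy f (level_set f k' i'))"
        using A by (intro mult_nonneg_nonneg sum_nonneg) auto
      then show ?thesis using False by simp
    qed
  qed (use A in auto)
  have "(\<Sum>z\<in>X \<times> Y. av z powr p * w z) = (\<Sum>z\<in>P. av z powr p * w z)"
  proof (rule sum.mono_neutral_right)
    have "0 \<le> av z" if "z \<in> X \<times> Y" for z
    proof -
      have "I z \<times> {snd z} \<subseteq> X \<times> Y" by (rule rect_subset[OF D[OF that]])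
      then show ?thesis unfolding av_def by (intro divide_nonneg_nonneg sum_nonneg f) auto
    qed
    then show "\<forall>z\<in>X \<times> Y - P. av z powr p * w z = 0" by (fastforce simp: P_def)
  qed (use P_sub X.finite_X Y.finite_X in auto)
  also have "\<dots> \<le> (\<Sum>z\<in>P. 2 powr p * (2 powr (p * real_of_int (k z)) * w z))"
  proof (rule sum_mono)
    fix z assume z: "z \<in> P"
    then have "0 < av z" "0 \<le> w z" using w_pos[of z] by (auto simp: P_def less_imp_le)
    then show "av z powr p * w z \<le> 2 powr p * (2 powr (p * real_of_int (k z)) * w z)"
      unfolding k_def mult.assoc[symmetric] using p by (intro mult_right_mono powr_le_lev) auto
  qed
  also have "\<dots> = 2 powr p * (\<Sum>z\<in>P. 2 powr (p * real_of_int (k z)) * w z)" by (simp only: sum_distrib_left)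
  also have "\<dots> \<le> 2 powr p * (4 * (2 powr (3 * p) * A) * real K * energy f (X \<times> Y))"
    using S by (intro mult_left_mono) auto
  also have "\<dots> = 4 * (2 powr p * 2 powr (3 * p)) * A * real K * energy f (X \<times> Y)" by simp
  also have "2 powr p * 2 powr (3 * p) = 2 powr (4 * p)" by (simp flip: powr_add)
  finally show ?thesis by (simp add: av_def)
qed

end

text \<open>\<open>936 = 8 * 9 * 13\<close> collects the factor of \<open>strong_bound\<close> and
  those in the bounds for \<open>L\<close> and \<open>K\<close>. The base of the last power is
  \<open>\<kappa> / \<rho>\<close> without its power of \<open>A\<close>; the exponent 3/2 is 1/2
  from \<open>L\<close> plus 1 from \<open>K\<close>. In \<open>row_const\<close> the corresponding
  number is \<open>52 = 4 * 13\<close>.\<close>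

definition pair_const :: "real \<Rightarrow> real" where
  "pair_const p = 936 * 2 powr (15 * p) * (4 powr (p / (p - 1)) * 2 powr ((4 * p + 2) / (p - 1))) powr (3 / 2)"

definition row_const :: "real \<Rightarrow> real" where
  "row_const p = 52 * 2 powr (4 * p) * (4 powr (p / (p - 1)) * 2 powr ((4 * p + 2) / (p - 1)))"

context biparam begin

lemma \<kappa>\<rho>_eq: "\<kappa> / \<rho> = A powr (1 / (p - 1)) * (4 powr (p / (p - 1)) * 2 powr ((4 * p + 2) / (p - 1)))"
proof -
  have "\<kappa> = A powr (1 / (p - 1)) * 4 powr (p / (p - 1))"
    using A p by (simp add: \<kappa>_def powr_mult powr_powr)
  moreover have "1 / \<rho> = 2 powr ((4 * p + 2) / (p - 1))"
    unfolding \<rho>_def minus_divide_left[symmetric] powr_minus_divide by simp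
  moreover have "\<kappa> / \<rho> = \<kappa> * (1 / \<rho>)" by simp
  ultimately show ?thesis by (simp only: mult.assoc)
qed

lemma pair_constant:
  "8 * 2 powr (15 * p) * A\<^sup>2 * real L * real K \<le> pair_const p * A powr (2 + 3 / (2 * (p - 1)))"
proof -
  define B where "B = 4 powr (p / (p - 1)) * 2 powr ((4 * p + 2) / (p - 1))"
  have "real L * real K \<le> (9 * sqrt (\<kappa> / \<rho>)) * (13 * (\<kappa> / \<rho>))"
    using \<kappa>\<rho> by (intro mult_mono L_le K_le) auto
  also have "\<dots> = 117 * ((\<kappa> / \<rho>) powr (1/2) * (\<kappa> / \<rho>) powr 1)"
    using \<kappa>\<rho> \<rho> \<kappa>_ge_1 by (simp add: powr_half_sqrt)
  also have "\<dots> = 117 * (\<kappa> / \<rho>) powr (3/2)" by (simp only: powr_add[symmetric]) simp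
  also have "(\<kappa> / \<rho>) powr (3/2) = A powr (3 / (2 * (p - 1))) * B powr (3/2)"
    unfolding \<kappa>\<rho>_eq B_def[symmetric] by (simp add: powr_mult powr_powr B_def mult.commute)
  finally have *: "real L * real K \<le> 117 * (A powr (3 / (2 * (p - 1))) * B powr (3/2))" .
  have "8 * 2 powr (15 * p) * A\<^sup>2 * (real L * real K)
      \<le> 8 * 2 powr (15 * p) * A\<^sup>2 * (117 * (A powr (3 / (2 * (p - 1))) * B powr (3/2)))"
    by (rule mult_left_mono[OF *]) simp
  also have "\<dots> = 936 * 2 powr (15 * p) * B powr (3/2) * (A powr 2 * A powr (3 / (2 * (p - 1))))"
    using A by (simp add: powr_realpow[of A 2, simplified])
  also have "A powr 2 * A powr (3 / (2 * (p - 1))) = A powr (2 + 3 / (2 * (p - 1)))"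
    by (simp only: powr_add)
  finally show ?thesis unfolding pair_const_def B_def[symmetric] by (simp only: mult.assoc)
qed

lemma row_constant:
  "4 * 2 powr (4 * p) * A * real K \<le> row_const p * A powr (p / (p - 1))"
proof -
  define B where "B = 4 powr (p / (p - 1)) * 2 powr ((4 * p + 2) / (p - 1))"
  have "4 * 2 powr (4 * p) * A * real K \<le> 4 * 2 powr (4 * p) * A * (13 * (\<kappa> / \<rho>))"
    using A by (intro mult_left_mono K_le) auto
  also have "\<dots> = 52 * 2 powr (4 * p) * B * (A powr 1 * A powr (1 / (p - 1)))"
    using A unfolding \<kappa>\<rho>_eq B_def[symmetric] by simp
  also have "A powr 1 * A powr (1 / (p - 1)) = A powr (p / (p - 1))"
    using p by (simp only: powr_add[symmetric]) (simp add: field_simps)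
  finally show ?thesis unfolding row_const_def B_def[symmetric] .
qed

end

section \<open>Several coordinates\<close>

definition box_of :: "('n \<Rightarrow> 'a set) \<Rightarrow> ('n \<Rightarrow> 'a) set" where
  "box_of Q = {u. \<forall>i. u i \<in> Q i}"

lemma box_of_eq_PiE: "box_of Q = PiE UNIV Q"
  by (auto simp: box_of_def)

lemma finite_box_of: "(\<And>i. finite (Q i)) \<Longrightarrow> finite (box_of (Q :: 'n::finite \<Rightarrow> 'a set))"
  unfolding box_of_eq_PiE by (rule finite_PiE) auto

lemma card_box_of: "card (box_of (Q :: 'n::finite \<Rightarrow> 'a set)) = (\<Prod>i\<in>UNIV. card (Q i))"
  unfolding box_of_eq_PiE by (rule card_PiE) simp

lemma sum_box_of_split:
  fixes f :: "('n::finite \<Rightarrow> 'a) \<Rightarrow> real"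
  assumes "\<And>i. finite (Q i)"
  shows "sum f (box_of Q) = (\<Sum>x\<in>Q i. sum f (box_of (Q(i := {x}))))"
proof -
  have "box_of Q = (\<Union>x\<in>Q i. box_of (Q(i := {x})))"
    by (auto simp: box_of_def split: if_splits)
  moreover have "sum f (\<Union>x\<in>Q i. box_of (Q(i := {x}))) = (\<Sum>x\<in>Q i. sum f (box_of (Q(i := {x}))))"
  proof (rule sum.UNION_disjoint)
    show "\<forall>x\<in>Q i. finite (box_of (Q(i := {x})))" using assms by (intro ballI finite_box_of) simp
    show "\<forall>x\<in>Q i. \<forall>y\<in>Q i. x \<noteq> y \<longrightarrow> box_of (Q(i := {x})) \<inter> box_of (Q(i := {y})) = {}"
    proof (intro ballI impI)
      fix x y :: 'a assume "x \<noteq> y"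
      have "u i = x" if "u \<in> box_of (Q(i := {x}))" for u x using that by (auto simp: box_of_def split: if_splits)
      then show "box_of (Q(i := {x})) \<inter> box_of (Q(i := {y})) = {}" using \<open>x \<noteq> y\<close> by blast
    qed
  qed (rule assms)
  ultimately show ?thesis by simp
qed

lemma box_of_singletons: "box_of (\<lambda>k. {u k}) = {u}"
  by (auto simp: box_of_def)

lemma sum_box_of_pair:
  fixes f :: "('n::finite \<Rightarrow> 'a) \<Rightarrow> real"
  assumes "finite I" "finite J" "i \<noteq> j"
  shows "sum f (box_of ((\<lambda>k. {u k})(i := I, j := J))) = (\<Sum>(x, y)\<in>I \<times> J. f (u(i := x, j := y)))"
proof -
  have "sum f (box_of ((\<lambda>k. {u k})(i := I, j := J)))
      = (\<Sum>x\<in>I. sum f (box_of ((\<lambda>k. {u k})(i := {x}, j := J))))"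
    using assms by (subst sum_box_of_split[where i = i]) (auto simp: fun_upd_twist)
  also have "\<dots> = (\<Sum>x\<in>I. \<Sum>y\<in>J. sum f (box_of ((\<lambda>k. {u k})(i := {x}, j := {y}))))"
    using assms by (subst sum_box_of_split[where i = j]) auto
  also have "\<dots> = (\<Sum>x\<in>I. \<Sum>y\<in>J. f (u(i := x, j := y)))"
  proof (intro sum.cong refl)
    fix x y
    have "(\<lambda>k. {u k})(i := {x}, j := {y}) = (\<lambda>k. {(u(i := x, j := y)) k})" by (auto simp: fun_eq_iff)
    then have "box_of ((\<lambda>k. {u k})(i := {x}, j := {y})) = {u(i := x, j := y)}"
      by (simp only: box_of_singletons)
    then show "sum f (box_of ((\<lambda>k. {u k})(i := {x}, j := {y}))) = f (u(i := x, j := y))"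
      by (simp only: sum.insert sum.empty finite.emptyI empty_iff add_0_right not_False_eq_True)
  qed
  finally show ?thesis by (simp add: sum.cartesian_product)
qed

lemma card_box_of_pair:
  assumes "i \<noteq> j"
  shows "card (box_of (((\<lambda>k. {u k}) :: 'n::finite \<Rightarrow> 'a set)(i := I, j := J))) = card (I \<times> J)"
proof -
  have "card (box_of ((\<lambda>k. {u k})(i := I, j := J))) = (\<Prod>k\<in>UNIV. if k = i then card I else if k = j then card J else 1)"
    unfolding card_box_of using assms by (intro prod.cong) auto
  also have "\<dots> = (\<Prod>k\<in>{i, j}. if k = i then card I else if k = j then card J else 1)"
    by (rule prod.mono_neutral_right) auto
  also have "\<dots> = card (I \<times> J)" using assms by (simp add: card_cartesian_product)
  finally show ?thesis .
qed

locale polydyadic = dyadic_system D X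
  for D :: "'a set set" and X :: "'a set" +
  fixes w s :: "('n::finite \<Rightarrow> 'a) \<Rightarrow> real" and p A :: real
  assumes p: "1 < p" and A: "1 \<le> A"
    and w_pos: "u \<in> box_of (\<lambda>_. X) \<Longrightarrow> 0 < w u"
    and s_pos: "u \<in> box_of (\<lambda>_. X) \<Longrightarrow> 0 < s u"
    and ws: "u \<in> box_of (\<lambda>_. X) \<Longrightarrow> 1 \<le> w u * s u powr (p - 1)"
    and Ap: "(\<And>i. Q i \<in> D) \<Longrightarrow>
      sum w (box_of Q) * sum s (box_of Q) powr (p - 1) \<le> A * real (card (box_of Q)) powr p"
begin

abbreviation P :: "('n \<Rightarrow> 'a) set" where "P \<equiv> box_of (\<lambda>_. X)"

lemma finite_P: "finite P" using finite_X by (intro finite_box_of)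

lemma upd_P: "u \<in> P \<Longrightarrow> x \<in> X \<Longrightarrow> u(i := x) \<in> P" by (auto simp: box_of_def)

lemma P_mem: "u \<in> P \<Longrightarrow> u i \<in> X" by (auto simp: box_of_def)

text \<open>A box with one-point sides in all coordinates but \<open>i\<close> and \<open>j\<close>
  is admissible in \<open>Ap\<close>, so every two-dimensional slice satisfies the two-parameter
  hypotheses with the same \<open>A\<close>.\<close>

lemma slice:
  assumes ij: "i \<noteq> j" and u: "u \<in> P"
  shows "biparam D X D X (\<lambda>z. w (u(i := fst z, j := snd z))) (\<lambda>z. s (u(i := fst z, j := snd z))) p A"
proof unfold_locales
  fix I J assume IJ: "I \<in> D" "J \<in> D"
  define Q where "Q = (\<lambda>k. {u k})(i := I, j := J)"
  have "Q k \<in> D" for k using IJ D_singleton[OF P_mem[OF u]] by (auto simp: Q_def)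
  then have "sum w (box_of Q) * sum s (box_of Q) powr (p - 1) \<le> A * real (card (box_of Q)) powr p" by (rule Ap)
  then show "(\<Sum>z\<in>I \<times> J. w (u(i := fst z, j := snd z))) * (\<Sum>z\<in>I \<times> J. s (u(i := fst z, j := snd z))) powr (p - 1)
      \<le> A * real (card (I \<times> J)) powr p"
    using IJ D_finite ij by (simp add: Q_def sum_box_of_pair card_box_of_pair case_prod_unfold)
qed (use p A w_pos s_pos ws upd_P u in auto)

text \<open>Only the sides in \<open>S\<close> may be extended. The resulting \<open>maxf S\<close>
  interpolates between \<open>f\<close> at the empty set and the dyadic strong maximal function at
  \<open>UNIV\<close>, which permits induction over coordinates.\<close>

definition boxes :: "'n set \<Rightarrow> ('n \<Rightarrow> 'a) \<Rightarrow> ('n \<Rightarrow> 'a set) set" where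
  "boxes S u = {Q. \<forall>i. if i \<in> S then Q i \<in> D \<and> u i \<in> Q i else Q i = {u i}}"

definition mean :: "(('n \<Rightarrow> 'a) \<Rightarrow> real) \<Rightarrow> ('n \<Rightarrow> 'a set) \<Rightarrow> real" where
  "mean f Q = sum f (box_of Q) / real (card (box_of Q))"

definition maxf :: "'n set \<Rightarrow> (('n \<Rightarrow> 'a) \<Rightarrow> real) \<Rightarrow> ('n \<Rightarrow> 'a) \<Rightarrow> real" where
  "maxf S f u = Max (mean f ` boxes S u)"

lemma boxes_D: "u \<in> P \<Longrightarrow> Q \<in> boxes S u \<Longrightarrow> Q i \<in> D"
  using D_singleton P_mem by (auto simp: boxes_def split: if_splits)

lemma finite_boxes: assumes "u \<in> P" shows "finite (boxes S u)"
proof (rule finite_subset)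
  show "boxes S u \<subseteq> PiE UNIV (\<lambda>_. D)" using boxes_D[OF assms] by auto
  show "finite (PiE UNIV (\<lambda>_ :: 'n. D))" using finite_D by (intro finite_PiE) auto
qed

lemma boxes_nonempty: "u \<in> P \<Longrightarrow> (\<lambda>i. {u i}) \<in> boxes S u"
  using D_singleton P_mem by (auto simp: boxes_def)

lemma mean_le_maxf: "u \<in> P \<Longrightarrow> Q \<in> boxes S u \<Longrightarrow> mean f Q \<le> maxf S f u"
  unfolding maxf_def using finite_boxes by (intro Max_ge) auto

lemma maxf_attained:
  assumes "u \<in> P" obtains Q where "Q \<in> boxes S u" "maxf S f u = mean f Q"
proof -
  have "maxf S f u \<in> mean f ` boxes S u"
    unfolding maxf_def using finite_boxes[OF assms] boxes_nonempty[OF assms] by (intro Max_in) auto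
  then show thesis using that by blast
qed

lemma maxf_nonneg:
  assumes u: "u \<in> P" and f: "\<And>u. u \<in> P \<Longrightarrow> 0 \<le> f u"
  shows "0 \<le> maxf S f u"
proof -
  have "mean f (\<lambda>i. {u i}) = f u" by (simp add: mean_def box_of_singletons)
  then show ?thesis using mean_le_maxf[OF u boxes_nonempty[OF u], of f S] f[OF u] by simp
qed

lemma maxf_empty: assumes "u \<in> P" shows "maxf {} f u = f u"
proof -
  have "boxes {} u = {\<lambda>i. {u i}}" by (auto simp: boxes_def)
  then show ?thesis by (simp add: maxf_def mean_def box_of_singletons)
qed

lemma maxf_row:
  assumes u: "u \<in> P" and i: "i \<notin> S"
  obtains I where "I \<in> D" "u i \<in> I"
    "maxf (insert i S) f u \<le> (\<Sum>x\<in>I. maxf S f (u(i := x))) / real (card I)"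
proof -
  obtain Q where Q: "Q \<in> boxes (insert i S) u" "maxf (insert i S) f u = mean f Q"
    using maxf_attained[OF u] .
  have QD: "Q k \<in> D" for k using boxes_D[OF u Q(1)] .
  have Qi: "u i \<in> Q i" using Q(1) by (auto simp: boxes_def split: if_splits)
  have finQ: "finite (Q k)" for k using QD by (rule D_finite)
  define c where "c = (\<Prod>k\<in>UNIV - {i}. card (Q k))"
  have c: "0 < c" unfolding c_def using QD D_card_pos by (intro prod_pos) blast
  have cQ: "card (box_of Q) = card (Q i) * c"
    unfolding card_box_of c_def by (rule prod.remove) auto
  have cx: "card (box_of (Q(i := {x}))) = c" for x :: 'a
  proof -
    have "card (box_of (Q(i := {x}))) = card ((Q(i := {x})) i) * (\<Prod>k\<in>UNIV - {i}. card ((Q(i := {x})) k))"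
      unfolding card_box_of by (rule prod.remove) auto
    also have "(\<Prod>k\<in>UNIV - {i}. card ((Q(i := {x})) k)) = c" unfolding c_def by (intro prod.cong) auto
    finally show ?thesis by (simp only: fun_upd_same card.insert card.empty) simp
  qed
  have "mean f Q = (\<Sum>x\<in>Q i. mean f (Q(i := {x}))) / real (card (Q i))"
    unfolding mean_def cx cQ using c
    by (subst sum_box_of_split[where i = i, OF finQ]) (simp add: sum_divide_distrib[symmetric] mult.commute)
  also have "\<dots> \<le> (\<Sum>x\<in>Q i. maxf S f (u(i := x))) / real (card (Q i))"
  proof (intro divide_right_mono sum_mono mean_le_maxf)
    fix x assume x: "x \<in> Q i"
    show "u(i := x) \<in> P" using u x QD[of i] D_subset by (intro upd_P) blast+
    show "Q(i := {x}) \<in> boxes S (u(i := x))" using Q(1) i by (auto simp: boxes_def split: if_splits)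
  qed simp
  finally show thesis using that[OF QD Qi] Q(2) by simp
qed

text \<open>The mean over the best box is the mean, over its sides \<open>I\<close> and
  \<open>J\<close>, of means over boxes with one-point sides at \<open>i\<close> and
  \<open>j\<close>. Each of those competes in \<open>maxf S\<close> at the shifted point.\<close>

lemma maxf_pair:
  assumes u: "u \<in> P" and i: "i \<notin> S" "j \<notin> S" "i \<noteq> j"
  obtains I J where "I \<in> D" "J \<in> D" "u i \<in> I" "u j \<in> J"
    "maxf (insert i (insert j S)) f u \<le> (\<Sum>(x, y)\<in>I \<times> J. maxf S f (u(i := x, j := y))) / real (card (I \<times> J))"
proof -
  obtain Q where Q: "Q \<in> boxes (insert i (insert j S)) u" "maxf (insert i (insert j S)) f u = mean f Q"
    using maxf_attained[OF u] .
  have QD: "Q k \<in> D" for k using boxes_D[OF u Q(1)] .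
  have Qi: "u i \<in> Q i" "u j \<in> Q j" using Q(1) by (auto simp: boxes_def split: if_splits)
  have finQ: "finite (Q k)" for k using QD by (rule D_finite)
  define c where "c = (\<Prod>k\<in>UNIV - {i, j}. card (Q k))"
  have c: "0 < c" unfolding c_def using QD D_card_pos by (intro prod_pos) blast
  have card2: "card (box_of R) = card (R i) * card (R j) * (\<Prod>k\<in>UNIV - {i, j}. card (R k))" for R :: "'n \<Rightarrow> 'a set"
  proof -
    have "card (box_of R) = card (R i) * (\<Prod>k\<in>UNIV - {i}. card (R k))"
      unfolding card_box_of by (rule prod.remove) auto
    also have "(\<Prod>k\<in>UNIV - {i}. card (R k)) = card (R j) * (\<Prod>k\<in>UNIV - {i} - {j}. card (R k))"
      using i by (intro prod.remove) auto
    also have "UNIV - {i} - {j} = UNIV - {i, j}" by auto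
    finally show ?thesis by simp
  qed
  have cQ: "card (box_of Q) = card (Q i \<times> Q j) * c"
    using card2[of Q] by (simp add: c_def card_cartesian_product)
  have cx: "card (box_of (Q(i := {x}, j := {y}))) = c" for x y :: 'a
  proof -
    have "(\<Prod>k\<in>UNIV - {i, j}. card ((Q(i := {x}, j := {y})) k)) = c" unfolding c_def by (intro prod.cong) auto
    then show ?thesis using i by (subst card2) simp
  qed
  have "sum f (box_of Q) = (\<Sum>x\<in>Q i. \<Sum>y\<in>Q j. sum f (box_of (Q(i := {x}, j := {y}))))"
  proof -
    have "sum f (box_of (Q(i := {x}))) = (\<Sum>y\<in>Q j. sum f (box_of (Q(i := {x}, j := {y}))))" for x
      using i finQ by (subst sum_box_of_split[where i = j]) auto
    then show ?thesis by (subst sum_box_of_split[where i = i, OF finQ]) simp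
  qed
  then have "mean f Q = (\<Sum>(x, y)\<in>Q i \<times> Q j. mean f (Q(i := {x}, j := {y}))) / real (card (Q i \<times> Q j))"
    unfolding mean_def cx cQ using c
    by (simp add: sum.cartesian_product sum_divide_distrib[symmetric] mult.commute case_prod_unfold)
  also have "\<dots> \<le> (\<Sum>(x, y)\<in>Q i \<times> Q j. maxf S f (u(i := x, j := y))) / real (card (Q i \<times> Q j))"
  proof (intro divide_right_mono sum_mono)
    fix z assume z: "z \<in> Q i \<times> Q j"
    obtain x y where xy: "z = (x, y)" "x \<in> Q i" "y \<in> Q j" using z by auto
    have "mean f (Q(i := {x}, j := {y})) \<le> maxf S f (u(i := x, j := y))"
    proof (rule mean_le_maxf)
      show "u(i := x, j := y) \<in> P" using u xy QD[of i] QD[of j] D_subset by (intro upd_P) blast+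
      show "Q(i := {x}, j := {y}) \<in> boxes S (u(i := x, j := y))"
        using Q(1) i by (auto simp: boxes_def split: if_splits)
    qed
    then show "(case z of (x, y) \<Rightarrow> mean f (Q(i := {x}, j := {y}))) \<le> (case z of (x, y) \<Rightarrow> maxf S f (u(i := x, j := y)))"
      by (simp add: xy)
  qed simp
  finally show thesis using that[OF QD QD Qi] Q(2) by simp
qed

text \<open>Exchanging \<open>x\<close> with \<open>u i\<close> is an involution of
  \<open>P \<times> X\<close>.\<close>

lemma sum_upd:
  fixes g :: "('n \<Rightarrow> 'a) \<Rightarrow> real"
  shows "(\<Sum>u\<in>P. \<Sum>x\<in>X. g (u(i := x))) = real (card X) * sum g P"
proof -
  have "(\<Sum>u\<in>P. \<Sum>x\<in>X. g (u(i := x))) = (\<Sum>(u, x)\<in>P \<times> X. g (u(i := x)))"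
    by (simp add: sum.cartesian_product)
  also have "\<dots> = (\<Sum>(u, x)\<in>P \<times> X. g u)"
    by (rule sum.reindex_bij_witness[of _ "\<lambda>(u, x). (u(i := x), u i)" "\<lambda>(u, x). (u(i := x), u i)"])
       (auto simp: upd_P P_mem)
  also have "\<dots> = (\<Sum>u\<in>P. \<Sum>x\<in>X. g u)" by (rule sum.cartesian_product[symmetric])
  finally show ?thesis by (simp add: sum_distrib_left)
qed

lemma sum_upd_pair:
  fixes g :: "('n \<Rightarrow> 'a) \<Rightarrow> real"
  assumes "i \<noteq> j"
  shows "(\<Sum>u\<in>P. \<Sum>z\<in>X \<times> X. g (u(i := fst z, j := snd z))) = (real (card X))\<^sup>2 * sum g P"
proof -
  have "(\<Sum>u\<in>P. \<Sum>z\<in>X \<times> X. g (u(i := fst z, j := snd z))) = (\<Sum>u\<in>P. \<Sum>x\<in>X. \<Sum>y\<in>X. g (u(i := x, j := y)))"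
    by (simp add: sum_Times)
  also have "\<dots> = real (card X) * (\<Sum>u\<in>P. \<Sum>y\<in>X. g (u(j := y)))"
    by (rule sum_upd[where g = "\<lambda>u. \<Sum>y\<in>X. g (u(j := y))"])
  also have "\<dots> = (real (card X))\<^sup>2 * sum g P" by (simp add: sum_upd power2_eq_square)
  finally show ?thesis .
qed

abbreviation energy :: "(('n \<Rightarrow> 'a) \<Rightarrow> real) \<Rightarrow> real" where
  "energy f \<equiv> (\<Sum>u\<in>P. f u powr p * s u powr (1 - p))"

text \<open>Summing the slice inequality over all base points counts every point
  \<open>(card X)\<^sup>2\<close> times on both sides, which avoids choosing one representative per
  slice.\<close>

lemma slices_bound:
  fixes g h :: "('n \<Rightarrow> 'a) \<Rightarrow> real"
  assumes ij: "i \<noteq> j" and X: "X \<noteq> {}"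
    and slice: "\<And>u. u \<in> P \<Longrightarrow> (\<Sum>z\<in>X \<times> X. g (u(i := fst z, j := snd z)))
      \<le> C * (\<Sum>z\<in>X \<times> X. h (u(i := fst z, j := snd z)))"
  shows "sum g P \<le> C * sum h P"
proof -
  have "(real (card X))\<^sup>2 * sum g P \<le> (\<Sum>u\<in>P. C * (\<Sum>z\<in>X \<times> X. h (u(i := fst z, j := snd z))))"
    unfolding sum_upd_pair[OF ij, symmetric] by (intro sum_mono slice)
  also have "\<dots> = (real (card X))\<^sup>2 * (C * sum h P)"
    by (simp only: sum_distrib_left[symmetric] sum_upd_pair[OF ij]) simp
  finally show ?thesis using X finite_X by (simp add: card_gt_0_iff)
qed

lemma pair_step:
  assumes f: "\<And>u. u \<in> P \<Longrightarrow> 0 \<le> f u" and i: "i \<notin> S" "j \<notin> S" "i \<noteq> j" and X: "X \<noteq> {}"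
  shows "(\<Sum>u\<in>P. maxf (insert i (insert j S)) f u powr p * w u)
    \<le> pair_const p * A powr (2 + 3 / (2 * (p - 1))) * energy (maxf S f)"
proof (rule slices_bound[OF i(3) X])
  fix u assume u: "u \<in> P"
  interpret sl: biparam D X D X "\<lambda>z. w (u(i := fst z, j := snd z))" "\<lambda>z. s (u(i := fst z, j := snd z))" p A
    by (rule slice[OF i(3) u])
  define U where "U z = u(i := fst z, j := snd z)" for z
  have UP: "U z \<in> P" if "z \<in> X \<times> X" for z using that u upd_P by (auto simp: U_def)
  have Uupd: "(U z)(i := x, j := y) = U (x, y)" for z x y using i by (auto simp: U_def fun_upd_twist)
  have Uij: "U z i = fst z" "U z j = snd z" for z using i by (auto simp: U_def)
  define h where "h z = maxf S f (U z)" for z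
  have "\<forall>z\<in>X \<times> X. \<exists>I J. I \<in> D \<and> J \<in> D \<and> fst z \<in> I \<and> snd z \<in> J
    \<and> maxf (insert i (insert j S)) f (U z) \<le> sum h (I \<times> J) / real (card (I \<times> J))"
  proof
    fix z assume z: "z \<in> X \<times> X"
    obtain I J where IJ: "I \<in> D" "J \<in> D" "U z i \<in> I" "U z j \<in> J"
      "maxf (insert i (insert j S)) f (U z) \<le> (\<Sum>(x, y)\<in>I \<times> J. maxf S f ((U z)(i := x, j := y))) / real (card (I \<times> J))"
      using maxf_pair[OF UP[OF z] i] .
    moreover have "(\<Sum>(x, y)\<in>I \<times> J. maxf S f ((U z)(i := x, j := y))) = sum h (I \<times> J)"
      unfolding Uupd h_def by (intro sum.cong) auto
    ultimately show "\<exists>I J. I \<in> D \<and> J \<in> D \<and> fst z \<in> I \<and> snd z \<in> J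
      \<and> maxf (insert i (insert j S)) f (U z) \<le> sum h (I \<times> J) / real (card (I \<times> J))"
      unfolding Uij by metis
  qed
  then obtain I J where IJ: "\<And>z. z \<in> X \<times> X \<Longrightarrow> I z \<in> D \<and> J z \<in> D \<and> fst z \<in> I z \<and> snd z \<in> J z
    \<and> maxf (insert i (insert j S)) f (U z) \<le> sum h (I z \<times> J z) / real (card (I z \<times> J z))"
    by metis
  have "(\<Sum>z\<in>X \<times> X. maxf (insert i (insert j S)) f (U z) powr p * w (U z))
      \<le> (\<Sum>z\<in>X \<times> X. (sum h (I z \<times> J z) / real (card (I z \<times> J z))) powr p * w (U z))"
    using IJ maxf_nonneg[OF UP f] w_pos[OF UP] p
    by (intro sum_mono mult_right_mono powr_mono2) (auto simp: less_imp_le)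
  also have "\<dots> \<le> 8 * 2 powr (15 * p) * A\<^sup>2 * real sl.L * real sl.K * (\<Sum>z\<in>X \<times> X. h z powr p * s (U z) powr (1 - p))"
    unfolding U_def
  proof (rule sl.strong_bound)
    show "0 \<le> h z" if "z \<in> X \<times> X" for z unfolding h_def by (rule maxf_nonneg[OF UP[OF that] f])
    show "I z \<in> D \<and> J z \<in> D \<and> z \<in> I z \<times> J z" if "z \<in> X \<times> X" for z
      using IJ[OF that] by (auto simp: mem_Times_iff)
  qed
  also have "\<dots> \<le> pair_const p * A powr (2 + 3 / (2 * (p - 1))) * (\<Sum>z\<in>X \<times> X. h z powr p * s (U z) powr (1 - p))"
    by (intro mult_right_mono sl.pair_constant sum_nonneg) auto
  finally show "(\<Sum>z\<in>X \<times> X. maxf (insert i (insert j S)) f (u(i := fst z, j := snd z)) powr p * w (u(i := fst z, j := snd z)))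
    \<le> pair_const p * A powr (2 + 3 / (2 * (p - 1)))
      * (\<Sum>z\<in>X \<times> X. maxf S f (u(i := fst z, j := snd z)) powr p * s (u(i := fst z, j := snd z)) powr (1 - p))"
    by (simp only: U_def h_def)
qed

text \<open>The coordinate \<open>j\<close> completes \<open>i\<close> to a two-dimensional slice,
  in which \<open>row_bound\<close> averages over rows.\<close>

lemma row_step:
  assumes f: "\<And>u. u \<in> P \<Longrightarrow> 0 \<le> f u" and i: "i \<notin> S" "i \<noteq> j" and X: "X \<noteq> {}"
  shows "(\<Sum>u\<in>P. maxf (insert i S) f u powr p * w u)
    \<le> row_const p * A powr (p / (p - 1)) * energy (maxf S f)"
proof (rule slices_bound[OF i(2) X])
  fix u assume u: "u \<in> P"
  interpret sl: biparam D X D X "\<lambda>z. w (u(i := fst z, j := snd z))" "\<lambda>z. s (u(i := fst z, j := snd z))" p A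
    by (rule slice[OF i(2) u])
  define U where "U z = u(i := fst z, j := snd z)" for z
  have UP: "U z \<in> P" if "z \<in> X \<times> X" for z using that u upd_P by (auto simp: U_def)
  have Uupd: "(U z)(i := x) = U (x, snd z)" for z x using i by (auto simp: U_def fun_upd_twist)
  have Uij: "U z i = fst z" for z using i by (auto simp: U_def)
  define h where "h z = maxf S f (U z)" for z
  have "\<forall>z\<in>X \<times> X. \<exists>I. I \<in> D \<and> fst z \<in> I
    \<and> maxf (insert i S) f (U z) \<le> sum h (I \<times> {snd z}) / real (card (I \<times> {snd z}))"
  proof
    fix z assume z: "z \<in> X \<times> X"
    obtain I where I: "I \<in> D" "U z i \<in> I"
      "maxf (insert i S) f (U z) \<le> (\<Sum>x\<in>I. maxf S f ((U z)(i := x))) / real (card I)"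
      using maxf_row[OF UP[OF z] i(1)] .
    moreover have "(\<Sum>x\<in>I. maxf S f ((U z)(i := x))) = sum h (I \<times> {snd z})"
      unfolding Uupd h_def by (simp add: sum_Times)
    ultimately show "\<exists>I. I \<in> D \<and> fst z \<in> I
      \<and> maxf (insert i S) f (U z) \<le> sum h (I \<times> {snd z}) / real (card (I \<times> {snd z}))"
      unfolding Uij by (auto simp: card_cartesian_product)
  qed
  then obtain I where I: "\<And>z. z \<in> X \<times> X \<Longrightarrow> I z \<in> D \<and> fst z \<in> I z
    \<and> maxf (insert i S) f (U z) \<le> sum h (I z \<times> {snd z}) / real (card (I z \<times> {snd z}))"
    by metis
  have "(\<Sum>z\<in>X \<times> X. maxf (insert i S) f (U z) powr p * w (U z))
      \<le> (\<Sum>z\<in>X \<times> X. (sum h (I z \<times> {snd z}) / real (card (I z \<times> {snd z}))) powr p * w (U z))"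
    using I maxf_nonneg[OF UP f] w_pos[OF UP] p
    by (intro sum_mono mult_right_mono powr_mono2) (auto simp: less_imp_le)
  also have "\<dots> \<le> 4 * 2 powr (4 * p) * A * real sl.K * (\<Sum>z\<in>X \<times> X. h z powr p * s (U z) powr (1 - p))"
    unfolding U_def
  proof (rule sl.row_bound)
    show "0 \<le> h z" if "z \<in> X \<times> X" for z unfolding h_def by (rule maxf_nonneg[OF UP[OF that] f])
    show "I z \<in> D \<and> fst z \<in> I z" if "z \<in> X \<times> X" for z using I[OF that] by auto
  qed
  also have "\<dots> \<le> row_const p * A powr (p / (p - 1)) * (\<Sum>z\<in>X \<times> X. h z powr p * s (U z) powr (1 - p))"
    by (intro mult_right_mono sl.row_constant sum_nonneg) auto
  finally show "(\<Sum>z\<in>X \<times> X. maxf (insert i S) f (u(i := fst z, j := snd z)) powr p * w (u(i := fst z, j := snd z)))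
    \<le> row_const p * A powr (p / (p - 1))
      * (\<Sum>z\<in>X \<times> X. maxf S f (u(i := fst z, j := snd z)) powr p * s (u(i := fst z, j := snd z)) powr (1 - p))"
    by (simp only: U_def h_def)
qed

lemma dual_le_w: "u \<in> P \<Longrightarrow> s u powr (1 - p) \<le> w u"
  using ws[of u] s_pos[of u] by (simp add: powr_diff field_simps)

text \<open>Before each step \<open>dual_le_w\<close> replaces \<open>s powr (1 - p)\<close> by
  \<open>w\<close> on the left-hand side, so only the constants of the steps accumulate.\<close>

lemma even_steps:
  assumes f: "\<And>u. u \<in> P \<Longrightarrow> 0 \<le> f u" and X: "X \<noteq> {}"
  shows "card S = 2 * k \<Longrightarrow> energy (maxf S f) \<le> (pair_const p * A powr (2 + 3 / (2 * (p - 1)))) ^ k * energy f"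
proof (induction k arbitrary: S)
  case 0
  then have "S = {}" by simp
  then show ?case by (simp add: maxf_empty)
next
  case (Suc k)
  define C where "C = pair_const p * A powr (2 + 3 / (2 * (p - 1)))"
  have C0: "0 \<le> C" by (simp add: C_def pair_const_def)
  obtain i j S' where S: "S = insert i (insert j S')" "i \<notin> S'" "j \<notin> S'" "i \<noteq> j" "card S' = 2 * k"
    using Suc.prems by (auto simp: card_Suc_eq)
  have "energy (maxf S f) \<le> (\<Sum>u\<in>P. maxf S f u powr p * w u)"
    by (intro sum_mono mult_left_mono dual_le_w) auto
  also have "\<dots> \<le> C * energy (maxf S' f)"
    unfolding S(1) C_def by (rule pair_step[OF f S(2-4) X])
  also have "\<dots> \<le> C * (C ^ k * energy f)"
    using Suc.IH[OF S(5)] C0 by (intro mult_left_mono) (auto simp: C_def)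
  finally show ?case by (simp add: C_def mult.assoc)
qed

theorem discrete_bound:
  assumes f: "\<And>u. u \<in> P \<Longrightarrow> 0 \<le> f u" and X: "X \<noteq> {}" and d: "2 \<le> CARD('n)"
  shows "(\<Sum>u\<in>P. maxf UNIV f u powr p * w u)
    \<le> (pair_const p * A powr (2 + 3 / (2 * (p - 1)))) ^ (CARD('n) div 2)
      * (row_const p * A powr (p / (p - 1))) ^ (CARD('n) mod 2) * energy f"
proof -
  define C where "C = pair_const p * A powr (2 + 3 / (2 * (p - 1)))"
  have C0: "0 \<le> C" by (simp add: C_def pair_const_def)
  define B where "B = row_const p * A powr (p / (p - 1))"
  have B0: "0 \<le> B" by (simp add: B_def row_const_def)
  define k where "k = CARD('n) div 2"
  show ?thesis
  proof (cases "even (CARD('n))")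
    case True
    then have "CARD('n) = Suc (Suc (2 * (k - 1)))" using d by (auto simp: k_def)
    then obtain i j and S :: "'n set" where S: "UNIV = insert i (insert j S)" "i \<notin> S" "j \<notin> S" "i \<noteq> j" "card S = 2 * (k - 1)"
      by (auto simp: card_Suc_eq)
    have "(\<Sum>u\<in>P. maxf UNIV f u powr p * w u) \<le> C * energy (maxf S f)"
      unfolding S(1) C_def by (rule pair_step[OF f S(2-4) X])
    also have "\<dots> \<le> C * (C ^ (k - 1) * energy f)"
      using even_steps[OF f X S(5)] C0 by (intro mult_left_mono) (auto simp: C_def)
    also have "C * (C ^ (k - 1) * energy f) = C ^ k * energy f"
      using True d by (cases k) (auto simp: k_def)
    finally show ?thesis using True by (simp add: C_def k_def)
  next
    case False
    then have "CARD('n) = Suc (2 * k)" by (simp add: k_def)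
    then obtain i and S :: "'n set" where S: "UNIV = insert i S" "i \<notin> S" "card S = 2 * k"
      by (auto simp: card_Suc_eq)
    \<comment> \<open>An odd number of coordinates that is at least 2 is at least 3, so a partner
      for \<open>i\<close> exists.\<close>
    have "S \<noteq> {}" using S(3) False d by (auto simp: k_def)
    then obtain j where "j \<in> S" by blast
    then have ij: "i \<noteq> j" using S(2) by blast
    have "(\<Sum>u\<in>P. maxf UNIV f u powr p * w u) \<le> B * energy (maxf S f)"
      unfolding S(1) B_def by (rule row_step[OF f S(2) ij X])
    also have "\<dots> \<le> B * (C ^ k * energy f)"
      using even_steps[OF f X S(3)] B0 by (intro mult_left_mono) (auto simp: C_def)
    finally show ?thesis using False by (simp add: C_def B_def k_def odd_iff_mod_2_eq_one mult_ac)
  qed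
qed

end

section \<open>Dyadic intervals of natural numbers\<close>

text \<open>As fibres of integer division, intervals of different scales are compared by iterated
  division instead of by end points.\<close>

definition dyad :: "nat \<Rightarrow> nat \<Rightarrow> nat set" where "dyad k j = {u. u div 2 ^ k = j}"

definition dyadics :: "nat \<Rightarrow> nat set set" where
  "dyadics m = {dyad k j | k j. k \<le> m \<and> j < 2 ^ (m - k)}"

lemma dyad_eq: "dyad k j = {j * 2 ^ k..<(j + 1) * 2 ^ k}"
proof -
  have iff: "u div 2 ^ k = j \<longleftrightarrow> j * 2 ^ k \<le> u \<and> u < (j + 1) * 2 ^ k" for u :: nat
  proof
    assume "u div 2 ^ k = j"
    then have eq: "j * 2 ^ k + u mod 2 ^ k = u" using div_mult_mod_eq[of u "2 ^ k"] by simp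
    have "u mod 2 ^ k < 2 ^ k" by simp
    then have "u < j * 2 ^ k + 2 ^ k" using eq by linarith
    moreover have "j * 2 ^ k \<le> u" using eq by linarith
    ultimately show "j * 2 ^ k \<le> u \<and> u < (j + 1) * 2 ^ k" by simp
  next
    assume *: "j * 2 ^ k \<le> u \<and> u < (j + 1) * 2 ^ k"
    show "u div 2 ^ k = j"
    proof (rule div_nat_eqI)
      show "2 ^ k * j \<le> u" using * by (simp only: mult.commute)
      show "u < 2 ^ k * Suc j" using * by (simp only: mult.commute Suc_eq_plus1)
    qed
  qed
  show ?thesis
    unfolding dyad_def by (rule set_eqI) (simp only: mem_Collect_eq atLeastLessThan_iff iff)
qed

lemma card_dyad: "card (dyad k j) = 2 ^ k"
  by (simp add: dyad_eq)

lemma finite_dyad: "finite (dyad k j)"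
  by (simp add: dyad_eq)

lemma dyad_nested:
  assumes "k \<le> k'" "dyad k j \<inter> dyad k' j' \<noteq> {}"
  shows "dyad k j \<subseteq> dyad k' j'"
proof -
  have *: "u div 2 ^ k' = (u div 2 ^ k) div 2 ^ (k' - k)" for u :: nat
    using assms(1) by (simp add: div_mult2_eq[symmetric] power_add[symmetric])
  show ?thesis using assms(2) by (auto simp: dyad_def *)
qed

lemma dyadic_system_dyadics: "dyadic_system (dyadics m) {..<2 ^ m}"
proof
  show "finite {..<(2::nat) ^ m}" by simp
  show "Q \<subseteq> {..<2 ^ m}" if QD: "Q \<in> dyadics m" for Q
  proof -
    obtain k j where Q: "Q = dyad k j" "k \<le> m" "j < 2 ^ (m - k)" using QD by (auto simp: dyadics_def)
    have "(j + 1) * 2 ^ k \<le> 2 ^ (m - k) * 2 ^ k" using Q by (intro mult_le_mono) auto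
    also have "\<dots> = 2 ^ m" using Q by (simp flip: power_add)
    finally show ?thesis by (auto simp: Q dyad_eq)
  qed
  show "Q \<noteq> {}" if "Q \<in> dyadics m" for Q
    using that by (auto simp: dyadics_def dyad_eq)
  show "{x} \<in> dyadics m" if "x \<in> {..<2 ^ m}" for x
  proof -
    have "{x} = dyad 0 x" by (auto simp: dyad_def)
    then show ?thesis using that unfolding dyadics_def by force
  qed
  show "Q \<subseteq> Q' \<or> Q' \<subseteq> Q" if QD: "Q \<in> dyadics m" "Q' \<in> dyadics m" "Q \<inter> Q' \<noteq> {}" for Q Q'
  proof -
    obtain k j k' j' where Q: "Q = dyad k j" "Q' = dyad k' j'" using QD by (auto simp: dyadics_def)
    show ?thesis using dyad_nested[of k k' j j'] dyad_nested[of k' k j' j] QD(3) unfolding Q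
      by (cases "k \<le> k'") (auto simp: Int_commute)
  qed
  show "\<exists>P\<in>dyadics m. Q \<subset> P \<and> P \<subseteq> Q' \<and> card P \<le> 2 * card Q"
    if QD: "Q \<in> dyadics m" "Q' \<in> dyadics m" "Q \<subset> Q'" for Q Q'
  proof -
    obtain k j k' j' where Q: "Q = dyad k j" "Q' = dyad k' j'" "k \<le> m" "j < 2 ^ (m - k)" "k' \<le> m"
      using QD by (auto simp: dyadics_def)
    have "card Q < card Q'" using QD(3) finite_dyad unfolding Q by (intro psubset_card_mono)
    then have kk': "k < k'" unfolding Q card_dyad by simp
    define P where "P = dyad (Suc k) (j div 2)"
    have ne: "Q \<noteq> {}" unfolding Q by (auto simp: dyad_eq)
    have "Q \<subseteq> P" unfolding Q P_def dyad_def by (auto simp: div_mult2_eq mult.commute[of 2])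
    moreover have "card Q < card P" by (simp add: Q P_def card_dyad)
    ultimately have "Q \<subset> P" by auto
    moreover have "P \<inter> Q' \<noteq> {}" using \<open>Q \<subseteq> P\<close> QD(3) ne by blast
    then have "P \<subseteq> Q'" unfolding P_def Q using kk' by (intro dyad_nested) auto
    moreover have "P \<in> dyadics m"
    proof -
      have "2 ^ (m - k) = 2 * (2::nat) ^ (m - Suc k)" using kk' Q(5) by (simp flip: power_Suc add: Suc_diff_Suc)
      then have "j div 2 < 2 ^ (m - Suc k)" using Q(4) by linarith
      then show ?thesis unfolding dyadics_def P_def using kk' Q(5)
        by (intro CollectI exI[of _ "Suc k"] exI[of _ "j div 2"]) auto
    qed
    moreover have "card P \<le> 2 * card Q" by (simp add: Q P_def card_dyad)
    ultimately show ?thesis by blast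
  qed
qed

section \<open>Half-open rectangles\<close>

text \<open>Half-open sides make the cells of a grid an exact partition of each block.\<close>

definition hrect :: "('n \<Rightarrow> real) \<Rightarrow> ('n \<Rightarrow> real) \<Rightarrow> (real ^ 'n::finite) set" where
  "hrect l r = {x. \<forall>i. l i \<le> x $ i \<and> x $ i < r i}"

lemma hrect_borel: "(hrect l r :: (real ^ 'n::finite) set) \<in> sets borel"
proof -
  have "hrect l r = (\<Inter>i. {x. l i \<le> x $ i} \<inter> {x. x $ i < r i})" by (auto simp: hrect_def)
  moreover have "{x :: real ^ 'n. l i \<le> x $ i} \<inter> {x. x $ i < r i} \<in> sets borel" for i
    by (intro sets.Int borel_closed borel_open)
       (auto simp: closed_halfspace_component_ge_cart open_halfspace_component_lt_cart)
  ultimately show ?thesis by (simp add: sets.countable_INT'')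
qed

lemma hrect_lebesgue [measurable]: "hrect l r \<in> sets lebesgue"
  using hrect_borel[of l r] by (simp add: sets_completionI_sets)

lemma emeasure_lebesgue_box_cart:
  assumes "\<And>i. l i \<le> r i"
  shows "emeasure lebesgue (box (\<chi> i. l i) (\<chi> i. r i) :: (real ^ 'n::finite) set) = ennreal (\<Prod>i\<in>UNIV. r i - l i)"
    "emeasure lebesgue (cbox (\<chi> i. l i) (\<chi> i. r i) :: (real ^ 'n::finite) set) = ennreal (\<Prod>i\<in>UNIV. r i - l i)"
proof -
  let ?a = "(\<chi> i. l i) :: real ^ 'n" and ?b = "(\<chi> i. r i) :: real ^ 'n"
  have ne: "cbox ?a ?b \<noteq> {}" using assms by (auto simp: interval_ne_empty_cart)
  have c: "measure lborel (cbox ?a ?b) = (\<Prod>i\<in>UNIV. r i - l i)"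
    using content_cbox_cart[OF ne] by simp
  show 2: "emeasure lebesgue (cbox ?a ?b) = ennreal (\<Prod>i\<in>UNIV. r i - l i)"
    using emeasure_lborel_cbox_finite[of ?a ?b]
    unfolding c[symmetric] by (simp add: emeasure_eq_ennreal_measure less_top)
  have "emeasure lborel (box ?a ?b) = emeasure lborel (cbox ?a ?b)"
    by (simp add: emeasure_lborel_box_eq emeasure_lborel_cbox_eq)
  then show "emeasure lebesgue (box ?a ?b) = ennreal (\<Prod>i\<in>UNIV. r i - l i)" using 2 by simp
qed

lemma emeasure_hrect:
  assumes "\<And>i. l i \<le> r i"
  shows "emeasure lebesgue (hrect l r :: (real ^ 'n::finite) set) = ennreal (\<Prod>i\<in>UNIV. r i - l i)"
proof (rule antisym)
  have "hrect l r \<subseteq> cbox (\<chi> i. l i) (\<chi> i. r i)" by (auto simp: hrect_def mem_box_cart less_imp_le)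
  then have "emeasure lebesgue (hrect l r) \<le> emeasure lebesgue (cbox (\<chi> i. l i) (\<chi> i. r i))"
    by (intro emeasure_mono) auto
  then show "emeasure lebesgue (hrect l r) \<le> ennreal (\<Prod>i\<in>UNIV. r i - l i)"
    using assms by (simp only: emeasure_lebesgue_box_cart)
  have "box (\<chi> i. l i) (\<chi> i. r i) \<subseteq> hrect l r" by (auto simp: hrect_def mem_box_cart less_imp_le)
  then have "emeasure lebesgue (box (\<chi> i. l i) (\<chi> i. r i)) \<le> emeasure lebesgue (hrect l r)"
    by (intro emeasure_mono hrect_lebesgue)
  then show "ennreal (\<Prod>i\<in>UNIV. r i - l i) \<le> emeasure lebesgue (hrect l r)"
    using assms by (simp only: emeasure_lebesgue_box_cart)
qed

lemma hrect_rectangle: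
  assumes "\<And>i. l i < r i"
  shows "hrect l r \<in> rectangles"
  unfolding rectangles_def
proof (intro CollectI exI conjI allI)
  show "hrect l r = {x. \<forall>i. x $ i \<in> {l i..<r i}}" by (auto simp: hrect_def)
  fix i
  show "is_interval {l i..<r i}" "bounded {l i..<r i}" by (auto simp: is_interval_1)
  show "0 < measure lebesgue {l i..<r i}" using assms[of i] by (simp add: measure_def)
qed

text \<open>A bounded interval of positive length lies between the open and the closed interval with
  ends \<open>Inf\<close> and \<open>Sup\<close>. This treats all kinds of end points at
  once.\<close>

lemma rectangle_sandwich:
  assumes "R \<in> rectangles"
  obtains l r where "\<And>i. l i < r i" "box (\<chi> i. l i) (\<chi> i. r i) \<subseteq> R" "R \<subseteq> cbox (\<chi> i. l i) (\<chi> i. r i)"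
proof -
  obtain I where R: "R = {x. \<forall>i. x $ i \<in> I i}"
    and I: "\<And>i. is_interval (I i)" "\<And>i. bounded (I i)" "\<And>i. 0 < measure lebesgue (I i)"
    using assms by (auto simp: rectangles_def)
  define l where "l i = Inf (I i)" for i
  define r where "r i = Sup (I i)" for i
  have ne: "I i \<noteq> {}" for i using I(3)[of i] by auto
  have bdd: "bdd_below (I i)" "bdd_above (I i)" for i
    using I(2) bounded_imp_bdd_below bounded_imp_bdd_above by auto
  have sub: "I i \<subseteq> {l i..r i}" for i
    using cInf_lower[OF _ bdd(1)] cSup_upper[OF _ bdd(2)] by (auto simp: l_def r_def)
  have sup: "{l i<..<r i} \<subseteq> I i" for i
  proof
    fix x assume x: "x \<in> {l i<..<r i}"
    obtain u where u: "u \<in> I i" "u < x" using x ne[of i] bdd[of i] by (auto simp: l_def cInf_less_iff)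
    obtain v where v: "v \<in> I i" "x < v" using x ne[of i] bdd[of i] by (auto simp: r_def less_cSup_iff)
    show "x \<in> I i" using I(1)[of i] u v unfolding is_interval_1 by (meson less_imp_le)
  qed
  have lr: "l i < r i" for i
  proof (rule ccontr)
    assume "\<not> l i < r i"
    then have "I i \<subseteq> {l i}" using sub[of i] by auto
    then have "I i = {l i}" using ne by auto
    then show False using I(3)[of i] by simp
  qed
  show thesis
  proof (rule that[OF lr])
    show "box (\<chi> i. l i) (\<chi> i. r i) \<subseteq> R"
      by (auto simp: R mem_box_cart intro!: subsetD[OF sup])
    show "R \<subseteq> cbox (\<chi> i. l i) (\<chi> i. r i)" using sub by (force simp: R mem_box_cart)
  qed
qed

text \<open>Young's inequality enters as a hypothesis on abstract integrands, so that the same lemma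
  serves the constant 1 against \<open>w\<close> and \<open>\<bar>f\<bar>\<close> against
  \<open>\<bar>f\<bar> powr p * w\<close>.\<close>

lemma nn_holder:
  fixes f g s :: "'c \<Rightarrow> real"
  assumes p: "1 < p" and R: "R \<in> sets M"
    and meas: "f \<in> borel_measurable M" "g \<in> borel_measurable M" "s \<in> borel_measurable M"
    and nn: "\<And>x. 0 \<le> g x" "\<And>x. 0 \<le> s x"
    and young: "\<And>c. 0 \<le> c \<Longrightarrow> AE x in M. p * c powr (p - 1) * f x \<le> g x + (p - 1) * c powr p * s x"
    and G: "(\<integral>\<^sup>+ x\<in>R. ennreal (g x) \<partial>M) = ennreal G" "0 \<le> G"
    and S: "(\<integral>\<^sup>+ x\<in>R. ennreal (s x) \<partial>M) = ennreal S" "0 < S"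
  shows "enn2real (\<integral>\<^sup>+ x\<in>R. ennreal (f x) \<partial>M) powr p \<le> G * S powr (p - 1)"
    and "(\<integral>\<^sup>+ x\<in>R. ennreal (f x) \<partial>M) < \<infinity>"
proof -
  define F where "F = (\<integral>\<^sup>+ x\<in>R. ennreal (f x) \<partial>M)"
  have young': "ennreal (p * c powr (p - 1)) * F \<le> ennreal (G + (p - 1) * c powr p * S)" if c: "0 \<le> c" for c
  proof -
    have "ennreal (p * c powr (p - 1)) * F = (\<integral>\<^sup>+ x\<in>R. ennreal (p * c powr (p - 1)) * ennreal (f x) \<partial>M)"
      unfolding F_def using meas R by (subst nn_integral_cmult[symmetric]) (auto simp: mult.assoc)
    also have "\<dots> \<le> (\<integral>\<^sup>+ x\<in>R. (ennreal (g x) + ennreal ((p - 1) * c powr p) * ennreal (s x)) \<partial>M)"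
    proof (rule nn_integral_mono_AE)
      show "AE x in M. ennreal (p * c powr (p - 1)) * ennreal (f x) * indicator R x
        \<le> (ennreal (g x) + ennreal ((p - 1) * c powr p) * ennreal (s x)) * indicator R x"
        using young[OF c]
      proof eventually_elim
        case (elim x)
        have "ennreal (p * c powr (p - 1)) * ennreal (f x) = ennreal (p * c powr (p - 1) * f x)"
          using p by (subst ennreal_mult') auto
        also have "\<dots> \<le> ennreal (g x + (p - 1) * c powr p * s x)" using elim by (rule ennreal_leI)
        also have "\<dots> = ennreal (g x) + ennreal ((p - 1) * c powr p) * ennreal (s x)"
          using p nn by (simp add: ennreal_plus ennreal_mult)
        finally show ?case by (rule mult_right_mono) simp
      qed
    qed
    also have "\<dots> = ennreal G + ennreal ((p - 1) * c powr p) * ennreal S"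
      unfolding G(1)[symmetric] S(1)[symmetric] using meas R
      by (subst nn_integral_cmult[symmetric], simp, subst nn_integral_add[symmetric]) (auto simp: distrib_right mult.assoc)
    also have "\<dots> = ennreal (G + (p - 1) * c powr p * S)"
      using p G S by (simp add: ennreal_plus ennreal_mult)
    finally show ?thesis .
  qed
  \<comment> \<open>Already the parameter \<open>c = 1\<close> bounds \<open>F\<close>; finiteness
    is needed before passing to real numbers.\<close>
  have fin: "F < \<infinity>"
  proof -
    have "ennreal p * F \<le> ennreal (G + (p - 1) * S)" using young'[of 1] by simp
    then have "ennreal p * F < \<infinity>" by (metis ennreal_less_top infinity_ennreal_def order_le_less_trans)
    then show ?thesis using p by (auto simp: ennreal_mult_less_top)
  qed
  then show "(\<integral>\<^sup>+ x\<in>R. ennreal (f x) \<partial>M) < \<infinity>" by (simp add: F_def)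
  have eq: "F = ennreal (enn2real F)" using fin by simp
  have "enn2real F powr p \<le> G * S powr (p - 1)"
  proof (rule holder_of_young[OF p enn2real_nonneg S(2)])
    fix c :: real assume c: "0 \<le> c"
    have "ennreal (p * c powr (p - 1) * enn2real F) \<le> ennreal (G + (p - 1) * c powr p * S)"
      using young'[OF c] p by (subst ennreal_mult) (auto simp: eq[symmetric])
    then show "p * c powr (p - 1) * enn2real F \<le> G + (p - 1) * c powr p * S"
      using G S p by (subst (asm) ennreal_le_iff) auto
  qed
  then show "enn2real (\<integral>\<^sup>+ x\<in>R. ennreal (f x) \<partial>M) powr p \<le> G * S powr (p - 1)" by (simp add: F_def)
qed

lemma epowr_ennreal: "0 \<le> x \<Longrightarrow> ennreal x epowr a = ennreal (x powr a)"
  by (simp add: epowr_def)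

definition vol :: "('n::finite \<Rightarrow> real) \<Rightarrow> ('n \<Rightarrow> real) \<Rightarrow> real" where
  "vol l r = (\<Prod>i\<in>UNIV. r i - l i)"

lemma vol_pos: "(\<And>i. l i < r i) \<Longrightarrow> 0 < vol l r"
  unfolding vol_def by (intro prod_pos) auto

lemma average_hrect:
  assumes lr: "\<And>i. l i < r i" and I: "(\<integral>\<^sup>+ y\<in>hrect l r. g y \<partial>lebesgue) = ennreal v" "0 \<le> v"
  shows "average (hrect l r) g = ennreal (v / vol l r)"
  unfolding average_def I(1) using emeasure_hrect[of l r] lr vol_pos[of l r] I(2)
  by (simp add: less_imp_le vol_def divide_ennreal)

section \<open>Averages over the cells of a grid\<close>

locale Ap_weight =
  fixes w :: "real ^ 'n::finite \<Rightarrow> real" and p :: real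
  assumes p: "1 < p" and wAp: "w \<in> Ap p"
begin

abbreviation sg :: "real ^ 'n \<Rightarrow> real" where "sg \<equiv> dual_weight p w"

definition A :: real where "A = enn2real (Ap_const p w)"

lemma Ap_const_eq: "Ap_const p w = ennreal A"
  using wAp by (simp add: A_def Ap_def)

lemma w_pos_AE: "AE x in lebesgue. 0 < w x"
  using wAp by (simp add: Ap_def weight_def)

lemma w_int: "compact K \<Longrightarrow> set_integrable lebesgue K w"
  using wAp by (simp add: Ap_def weight_def locally_integrable_def)

text \<open>Local integrability gives measurability on every ball, and \<open>w\<close> is the
  pointwise limit of its restrictions to growing balls.\<close>

lemma w_meas [measurable]: "w \<in> borel_measurable lebesgue"
proof (rule borel_measurable_LIMSEQ_real)
  show "(\<lambda>i. indicator (cball 0 (real i)) x *\<^sub>R w x) \<longlonglongrightarrow> w x" for x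
  proof (rule tendsto_eventually)
    obtain N :: nat where "norm x \<le> real N" using real_arch_simple by blast
    then show "\<forall>\<^sub>F i in sequentially. indicator (cball 0 (real i)) x *\<^sub>R w x = w x"
      by (intro eventually_sequentiallyI[of N]) (auto simp: indicator_def)
  qed
  show "(\<lambda>x. indicator (cball 0 (real i)) x *\<^sub>R w x) \<in> borel_measurable lebesgue" for i
    using w_int[of "cball 0 (real i)"] unfolding set_integrable_def
    by (intro borel_measurable_integrable) auto
qed

lemma sg_meas [measurable]: "sg \<in> borel_measurable lebesgue"
  unfolding dual_weight_def by measurable

lemma sg_pos: "0 < w x \<Longrightarrow> 0 < sg x"
  by (simp add: dual_weight_def)

lemma sg_nonneg: "0 \<le> sg x"
  by (simp add: dual_weight_def)

lemma sg_powr: "0 < w x \<Longrightarrow> sg x powr (1 - p) = w x"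
proof -
  assume "0 < w x"
  have "(1 - conj_exponent p) * (1 - p) = 1" using p by (simp add: conj_exponent_def field_simps)
  then show ?thesis using \<open>0 < w x\<close> by (simp add: dual_weight_def powr_powr)
qed

definition wR :: "(real ^ 'n) set \<Rightarrow> real" where "wR R = enn2real (\<integral>\<^sup>+ y\<in>R. ennreal (w y) \<partial>lebesgue)"
definition sR :: "(real ^ 'n) set \<Rightarrow> real" where "sR R = enn2real (\<integral>\<^sup>+ y\<in>R. ennreal (sg y) \<partial>lebesgue)"

lemma integral_pos:
  assumes lr: "\<And>i. l i < r i" and g: "g \<in> borel_measurable lebesgue" "AE x in lebesgue. 0 < g x"
  shows "0 < (\<integral>\<^sup>+ y\<in>hrect l r. ennreal (g y) \<partial>lebesgue)"
proof (rule ccontr)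
  assume "\<not> ?thesis"
  then have "(\<integral>\<^sup>+ y\<in>hrect l r. ennreal (g y) \<partial>lebesgue) = 0" by simp
  then have "AE y in lebesgue. ennreal (g y) * indicator (hrect l r) y = 0"
    using g by (subst (asm) nn_integral_0_iff_AE) auto
  then have "AE y in lebesgue. y \<notin> hrect l r"
    using g(2) by eventually_elim (auto simp: indicator_def split: if_splits)
  then have "emeasure lebesgue (hrect l r) = 0"
    by (subst (asm) AE_iff_measurable[OF hrect_lebesgue]) auto
  then show False using emeasure_hrect[of l r] lr vol_pos[of l r, OF lr] by (simp add: less_imp_le vol_def ennreal_eq_0_iff)
qed

lemma w_finite: "(\<integral>\<^sup>+ y\<in>hrect l r. ennreal (w y) \<partial>lebesgue) < \<infinity>"
proof -
  let ?K = "cbox (\<chi> i. l i) (\<chi> i. r i) :: (real ^ 'n) set"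
  have "(\<integral>\<^sup>+ y\<in>hrect l r. ennreal (w y) \<partial>lebesgue) \<le> (\<integral>\<^sup>+ y. ennreal (norm (indicator ?K y *\<^sub>R w y)) \<partial>lebesgue)"
  proof (rule nn_integral_mono)
    fix y
    have "y \<in> ?K" if "y \<in> hrect l r" using that by (auto simp: hrect_def mem_box_cart less_imp_le)
    then show "ennreal (w y) * indicator (hrect l r) y \<le> ennreal (norm (indicator ?K y *\<^sub>R w y))"
      by (auto simp: indicator_def intro!: ennreal_leI)
  qed
  also have "\<dots> < \<infinity>"
    using w_int[of ?K] unfolding set_integrable_def integrable_iff_bounded by auto
  finally show ?thesis .
qed

lemma Ap_rect:
  assumes lr: "\<And>i. l i < r i"
  shows "average (hrect l r) (\<lambda>y. ennreal (w y)) * average (hrect l r) (\<lambda>y. ennreal (sg y)) epowr (p - 1) \<le> ennreal A"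
  unfolding Ap_const_eq[symmetric] Ap_const_def by (intro SUP_upper hrect_rectangle lr)

text \<open>Local integrability of the dual weight is forced by the A_p condition: the average of
  \<open>w\<close> is positive, so an infinite average of \<open>sg\<close> would make the constant
  infinite.\<close>

lemma s_finite:
  assumes lr: "\<And>i. l i < r i"
  shows "(\<integral>\<^sup>+ y\<in>hrect l r. ennreal (sg y) \<partial>lebesgue) < \<infinity>"
proof (rule ccontr)
  assume "\<not> ?thesis"
  then have inf: "(\<integral>\<^sup>+ y\<in>hrect l r. ennreal (sg y) \<partial>lebesgue) = \<infinity>" by (simp add: not_less top_unique)
  have em: "emeasure lebesgue (hrect l r) = ennreal (vol l r)" using emeasure_hrect[of l r] lr by (simp add: less_imp_le vol_def)
  have "average (hrect l r) (\<lambda>y. ennreal (sg y)) = \<infinity>"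
    unfolding average_def inf em by (simp add: ennreal_top_divide)
  then have "average (hrect l r) (\<lambda>y. ennreal (sg y)) epowr (p - 1) = \<infinity>" by (simp add: epowr_def)
  moreover have "average (hrect l r) (\<lambda>y. ennreal (w y)) \<noteq> 0"
    unfolding average_def em using integral_pos[of l r, OF lr w_meas w_pos_AE] by (simp add: ennreal_divide_eq_0_iff)
  ultimately show False using Ap_rect[of l r, OF lr] by (simp add: ennreal_mult_top top_unique)
qed

lemma wR: 
  assumes lr: "\<And>i. l i < r i"
  shows "(\<integral>\<^sup>+ y\<in>hrect l r. ennreal (w y) \<partial>lebesgue) = ennreal (wR (hrect l r))" "0 < wR (hrect l r)"
  using w_finite[of l r] integral_pos[of l r, OF lr w_meas w_pos_AE] by (auto simp: wR_def enn2real_positive_iff)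

lemma sR:
  assumes lr: "\<And>i. l i < r i"
  shows "(\<integral>\<^sup>+ y\<in>hrect l r. ennreal (sg y) \<partial>lebesgue) = ennreal (sR (hrect l r))" "0 < sR (hrect l r)"
proof -
  have "AE x in lebesgue. 0 < sg x" using w_pos_AE by eventually_elim (rule sg_pos)
  then have "0 < (\<integral>\<^sup>+ y\<in>hrect l r. ennreal (sg y) \<partial>lebesgue)" by (rule integral_pos[of l r, OF lr sg_meas])
  then show "(\<integral>\<^sup>+ y\<in>hrect l r. ennreal (sg y) \<partial>lebesgue) = ennreal (sR (hrect l r))" "0 < sR (hrect l r)"
    using s_finite[of l r, OF lr] by (auto simp: sR_def enn2real_positive_iff)
qed

lemma A_nonneg: "0 \<le> A" by (simp add: A_def)

lemma Ap_real:
  assumes lr: "\<And>i. l i < r i"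
  shows "wR (hrect l r) * sR (hrect l r) powr (p - 1) \<le> A * vol l r powr p"
proof -
  define V where "V = vol l r"
  have V: "0 < V" unfolding V_def by (rule vol_pos[of l r, OF lr])
  note w' = wR[of l r, OF lr] and s' = sR[of l r, OF lr]
  have "ennreal (wR (hrect l r) / V) * ennreal ((sR (hrect l r) / V) powr (p - 1)) \<le> ennreal A"
    using Ap_rect[of l r, OF lr] w' s' V
    by (simp add: average_hrect[of l r, OF lr w'(1)] average_hrect[of l r, OF lr s'(1)] epowr_ennreal V_def less_imp_le)
  then have "ennreal (wR (hrect l r) / V * (sR (hrect l r) / V) powr (p - 1)) \<le> ennreal A"
    using V w' by (subst ennreal_mult) auto
  then have "wR (hrect l r) / V * (sR (hrect l r) / V) powr (p - 1) \<le> A"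
    using A_nonneg by (simp add: ennreal_le_iff)
  then have "wR (hrect l r) / V * (sR (hrect l r) / V) powr (p - 1) * V powr p \<le> A * V powr p"
    by (rule mult_right_mono) simp
  also have "wR (hrect l r) / V * (sR (hrect l r) / V) powr (p - 1) * V powr p = wR (hrect l r) * sR (hrect l r) powr (p - 1)"
    using V s' by (simp add: powr_divide powr_diff field_simps)
  finally show ?thesis by (simp add: V_def)
qed

lemma holder_w:
  assumes lr: "\<And>i. l i < r i"
  shows "vol l r powr p \<le> wR (hrect l r) * sR (hrect l r) powr (p - 1)"
proof -
  \<comment> \<open>\<open>nn_holder\<close> asks for a function that is nonnegative everywhere,
    whereas \<open>w\<close> is positive only almost everywhere.\<close>
  have W: "(\<integral>\<^sup>+ y\<in>hrect l r. ennreal (max 0 (w y)) \<partial>lebesgue) = ennreal (wR (hrect l r))"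
    unfolding wR(1)[of l r, OF lr, symmetric] by (intro nn_integral_cong) (auto simp: max_def ennreal_neg)
  have "enn2real (\<integral>\<^sup>+ x\<in>hrect l r. ennreal 1 \<partial>lebesgue) powr p \<le> wR (hrect l r) * sR (hrect l r) powr (p - 1)"
  proof (rule nn_holder(1)[OF p hrect_lebesgue, where g = "\<lambda>x. max 0 (w x)" and s = sg])
    show "AE x in lebesgue. p * c powr (p - 1) * 1 \<le> max 0 (w x) + (p - 1) * c powr p * sg x" if c: "0 \<le> c" for c
      using w_pos_AE
    proof eventually_elim
      case (elim x)
      then show ?case using powr_young_weighted[OF p, of 1 c "sg x"] c sg_pos[OF elim] sg_powr[OF elim] by simp
    qed
  qed (use W sR[of l r, OF lr] wR[of l r, OF lr] sg_nonneg in auto)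
  moreover have "(\<integral>\<^sup>+ x\<in>hrect l r. ennreal 1 \<partial>lebesgue) = ennreal (vol l r)"
    using emeasure_hrect[of l r] lr by (simp add: less_imp_le vol_def)
  ultimately show ?thesis using vol_pos[of l r, OF lr] by simp
qed

text \<open>On the unit cube Hoelder's lower bound meets the upper bound of the A_p
  condition.\<close>

lemma A_ge_1: "1 \<le> A"
proof -
  have lr: "(0::real) < 1" by simp
  have v: "vol (\<lambda>_ :: 'n. 0) (\<lambda>_. 1) = 1" by (simp add: vol_def)
  show ?thesis using holder_w[of "\<lambda>_. 0" "\<lambda>_. 1"] Ap_real[of "\<lambda>_. 0" "\<lambda>_. 1"] by (simp add: v)
qed

end

locale Ap_weight_fun = Ap_weight w p for w :: "real ^ 'n::finite \<Rightarrow> real" and p +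
  fixes f :: "real ^ 'n \<Rightarrow> real"
  assumes fLp: "f \<in> Lp p w"
begin

lemma f_meas [measurable]: "f \<in> borel_measurable lebesgue" using fLp by (simp add: Lp_def)

definition fR :: "(real ^ 'n) set \<Rightarrow> real" where "fR R = enn2real (\<integral>\<^sup>+ y\<in>R. ennreal \<bar>f y\<bar> \<partial>lebesgue)"
definition gR :: "(real ^ 'n) set \<Rightarrow> real" where
  "gR R = enn2real (\<integral>\<^sup>+ y\<in>R. ennreal (\<bar>f y\<bar> powr p) * ennreal (w y) \<partial>lebesgue)"

definition total :: ennreal where "total = (\<integral>\<^sup>+ y. ennreal (\<bar>f y\<bar> powr p) * ennreal (w y) \<partial>lebesgue)"

lemma Lp_norm_f: "Lp_norm p w (\<lambda>x. ennreal \<bar>f x\<bar>) = total epowr (1 / p)"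
  by (simp add: Lp_norm_def total_def epowr_ennreal)

lemma total_finite: "total < \<infinity>"
  using fLp unfolding Lp_def mem_Collect_eq Lp_norm_f by (auto simp: epowr_def less_top split: if_splits)

lemma gR: "(\<integral>\<^sup>+ y\<in>R. ennreal (\<bar>f y\<bar> powr p) * ennreal (w y) \<partial>lebesgue) = ennreal (gR R)"
proof -
  have "(\<integral>\<^sup>+ y\<in>R. ennreal (\<bar>f y\<bar> powr p) * ennreal (w y) \<partial>lebesgue) \<le> total"
    unfolding total_def by (intro nn_integral_mono) (auto simp: indicator_def)
  then have "(\<integral>\<^sup>+ y\<in>R. ennreal (\<bar>f y\<bar> powr p) * ennreal (w y) \<partial>lebesgue) < \<infinity>"
    using total_finite by (rule order_le_less_trans)
  then show ?thesis by (simp add: gR_def)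
qed

lemma holder_f:
  assumes lr: "\<And>i. l i < r i"
  shows "fR (hrect l r) powr p \<le> gR (hrect l r) * sR (hrect l r) powr (p - 1)"
    and "(\<integral>\<^sup>+ y\<in>hrect l r. ennreal \<bar>f y\<bar> \<partial>lebesgue) = ennreal (fR (hrect l r))"
proof -
  have G: "(\<integral>\<^sup>+ x\<in>hrect l r. ennreal (\<bar>f x\<bar> powr p * max 0 (w x)) \<partial>lebesgue) = ennreal (gR (hrect l r))"
    unfolding gR[symmetric] by (intro nn_integral_cong) (auto simp: ennreal_mult max_def ennreal_neg)
  have young: "AE x in lebesgue. p * c powr (p - 1) * \<bar>f x\<bar> \<le> \<bar>f x\<bar> powr p * max 0 (w x) + (p - 1) * c powr p * sg x"
    if c: "0 \<le> c" for c
    using w_pos_AE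
  proof eventually_elim
    case (elim x)
    then show ?case using powr_young_weighted[OF p, of "\<bar>f x\<bar>" c "sg x"] c sg_pos[OF elim] sg_powr[OF elim] by simp
  qed
  have meas: "(\<lambda>x. \<bar>f x\<bar> powr p * max 0 (w x)) \<in> borel_measurable lebesgue" by measurable
  have gnn: "0 \<le> gR (hrect l r)" by (simp add: gR_def)
  have *: "enn2real (\<integral>\<^sup>+ x\<in>hrect l r. ennreal \<bar>f x\<bar> \<partial>lebesgue) powr p \<le> gR (hrect l r) * sR (hrect l r) powr (p - 1)"
    "(\<integral>\<^sup>+ x\<in>hrect l r. ennreal \<bar>f x\<bar> \<partial>lebesgue) < \<infinity>"
    by (rule nn_holder[OF p hrect_lebesgue _ meas sg_meas _ sg_nonneg young G gnn sR[of l r, OF lr]]; simp)+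
  show "fR (hrect l r) powr p \<le> gR (hrect l r) * sR (hrect l r) powr (p - 1)" using *(1) by (simp add: fR_def)
  show "(\<integral>\<^sup>+ y\<in>hrect l r. ennreal \<bar>f y\<bar> \<partial>lebesgue) = ennreal (fR (hrect l r))" using *(2) by (simp add: fR_def)
qed

end

context Ap_weight begin

definition grid_const :: real where
  "grid_const = (pair_const p * A powr (2 + 3 / (2 * (p - 1)))) ^ (CARD('n) div 2)
      * (row_const p * A powr (p / (p - 1))) ^ (CARD('n) mod 2)"

lemma grid_const_nonneg: "0 \<le> grid_const" by (simp add: grid_const_def pair_const_def row_const_def)

end

locale Ap_weight_grid = Ap_weight_fun w p f for w :: "real ^ 'n::finite \<Rightarrow> real" and p f +
  fixes a :: "'n \<Rightarrow> real" and h :: real and m :: nat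
  assumes h: "0 < h"
begin

definition block :: "('n \<Rightarrow> nat) \<Rightarrow> ('n \<Rightarrow> nat) \<Rightarrow> (real ^ 'n) set" where
  "block k j = hrect (\<lambda>i. a i + h * (real (j i) * 2 ^ k i)) (\<lambda>i. a i + h * ((real (j i) + 1) * 2 ^ k i))"

definition cell :: "('n \<Rightarrow> nat) \<Rightarrow> (real ^ 'n) set" where
  "cell u = hrect (\<lambda>i. a i + h * real (u i)) (\<lambda>i. a i + h * (real (u i) + 1))"

definition H :: real where "H = h ^ CARD('n)"

lemma H_pos: "0 < H" using h by (simp add: H_def)

lemma vol_cell: "vol (\<lambda>i. a i + h * real (u i)) (\<lambda>i. a i + h * (real (u i) + 1)) = H"
  by (simp add: vol_def H_def algebra_simps)

lemma vol_block:
  "vol (\<lambda>i. a i + h * (real (j i) * 2 ^ k i)) (\<lambda>i. a i + h * ((real (j i) + 1) * 2 ^ k i)) = H * card (box_of (\<lambda>i. dyad (k i) (j i)))"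
proof -
  have "vol (\<lambda>i. a i + h * (real (j i) * 2 ^ k i)) (\<lambda>i. a i + h * ((real (j i) + 1) * 2 ^ k i)) = (\<Prod>i\<in>UNIV. h * 2 ^ k i)"
    unfolding vol_def by (intro prod.cong) (auto simp: algebra_simps)
  also have "\<dots> = H * card (box_of (\<lambda>i. dyad (k i) (j i)))" by (simp add: prod.distrib card_box_of card_dyad H_def)
  finally show ?thesis .
qed

lemma disjoint_cells: "disjoint_family_on cell U"
proof -
  have "u = v" if "x \<in> cell u" "x \<in> cell v" for x u v
  proof
    fix i
    have "a i + h * real (u i) \<le> x $ i" "x $ i < a i + h * (real (u i) + 1)"
      "a i + h * real (v i) \<le> x $ i" "x $ i < a i + h * (real (v i) + 1)"
      using that by (simp_all add: cell_def hrect_def)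
    then have "h * real (u i) < h * (real (v i) + 1)" "h * real (v i) < h * (real (u i) + 1)" by linarith+
    then have "real (u i) < real (v i) + 1" "real (v i) < real (u i) + 1"
      using h by (simp_all only: mult_less_cancel_left_pos)
    then show "u i = v i" by linarith
  qed
  then show ?thesis by (auto simp: disjoint_family_on_def)
qed

lemma block_eq: "block k j = (\<Union>u\<in>box_of (\<lambda>i. dyad (k i) (j i)). cell u)"
proof (intro equalityI subsetI)
  fix x assume x: "x \<in> block k j"
  define u where "u i = nat \<lfloor>(x $ i - a i) / h\<rfloor>" for i
  have b: "h * (real (j i) * 2 ^ k i) \<le> x $ i - a i" "x $ i - a i < h * ((real (j i) + 1) * 2 ^ k i)" for i
  proof -
    have "a i + h * (real (j i) * 2 ^ k i) \<le> x $ i" "x $ i < a i + h * ((real (j i) + 1) * 2 ^ k i)"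
      using x by (simp_all add: block_def hrect_def)
    then show "h * (real (j i) * 2 ^ k i) \<le> x $ i - a i" "x $ i - a i < h * ((real (j i) + 1) * 2 ^ k i)" by linarith+
  qed
  have b': "real (j i * 2 ^ k i) \<le> (x $ i - a i) / h" "(x $ i - a i) / h < real ((j i + 1) * 2 ^ k i)" for i
    using b[of i] h by (simp_all only: of_nat_mult of_nat_add of_nat_1 of_nat_power of_nat_numeral pos_le_divide_eq pos_divide_less_eq mult.commute[of h])
  have u: "real (u i) \<le> (x $ i - a i) / h" "(x $ i - a i) / h < real (u i) + 1" for i
  proof -
    have "0 \<le> (x $ i - a i) / h" using b'(1)[of i] by (meson of_nat_0_le_iff order_trans)
    then show "real (u i) \<le> (x $ i - a i) / h" "(x $ i - a i) / h < real (u i) + 1"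
      unfolding u_def by (simp_all add: of_nat_nat)
  qed
  have "u i \<in> dyad (k i) (j i)" for i
  proof -
    have "real (j i * 2 ^ k i) < real (u i + 1)" "real (u i) < real ((j i + 1) * 2 ^ k i)"
      using b'[of i] u[of i] by linarith+
    then have "j i * 2 ^ k i < u i + 1" "u i < (j i + 1) * 2 ^ k i" by (simp_all only: of_nat_less_iff)
    then show ?thesis unfolding dyad_eq by simp
  qed
  moreover have "x \<in> cell u"
    unfolding cell_def hrect_def using u h by (simp add: field_simps)
  ultimately show "x \<in> (\<Union>u\<in>box_of (\<lambda>i. dyad (k i) (j i)). cell u)" by (auto simp: box_of_def)
next
  fix x assume "x \<in> (\<Union>u\<in>box_of (\<lambda>i. dyad (k i) (j i)). cell u)"
  then obtain u where u: "\<And>i. u i \<in> dyad (k i) (j i)" "x \<in> cell u" by (auto simp: box_of_def)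
  show "x \<in> block k j"
    unfolding block_def hrect_def
  proof (intro CollectI allI conjI)
    fix i
    have "j i * 2 ^ k i \<le> u i" "u i + 1 \<le> (j i + 1) * 2 ^ k i" using u(1)[of i] by (simp_all add: dyad_eq)
    then have "real (j i * 2 ^ k i) \<le> real (u i)" "real (u i + 1) \<le> real ((j i + 1) * 2 ^ k i)"
      by (simp_all only: of_nat_le_iff)
    then have "real (j i) * 2 ^ k i \<le> real (u i)" "real (u i) + 1 \<le> (real (j i) + 1) * 2 ^ k i"
      by (simp_all add: algebra_simps)
    then have "h * (real (j i) * 2 ^ k i) \<le> h * real (u i)" "h * (real (u i) + 1) \<le> h * ((real (j i) + 1) * 2 ^ k i)"
      using h by (intro mult_left_mono; simp)+
    moreover have "a i + h * real (u i) \<le> x $ i" "x $ i < a i + h * (real (u i) + 1)"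
      using u(2) by (simp_all add: cell_def hrect_def)
    ultimately show "a i + h * (real (j i) * 2 ^ k i) \<le> x $ i" "x $ i < a i + h * ((real (j i) + 1) * 2 ^ k i)"
      by linarith+
  qed
qed

lemma cell_lebesgue [measurable]: "cell u \<in> sets lebesgue"
  by (simp add: cell_def)

lemma nn_integral_cells:
  assumes "g \<in> borel_measurable lebesgue" "finite U"
  shows "(\<integral>\<^sup>+ y\<in>(\<Union>u\<in>U. cell u). g y \<partial>lebesgue) = (\<Sum>u\<in>U. \<integral>\<^sup>+ y\<in>cell u. g y \<partial>lebesgue)"
proof -
  have "(\<integral>\<^sup>+ y\<in>(\<Union>u\<in>U. cell u). g y \<partial>lebesgue) = (\<integral>\<^sup>+ y. (\<Sum>u\<in>U. g y * indicator (cell u) y) \<partial>lebesgue)"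
    using assms disjoint_cells by (simp add: indicator_UN_disjoint sum_distrib_left)
  also have "\<dots> = (\<Sum>u\<in>U. \<integral>\<^sup>+ y\<in>cell u. g y \<partial>lebesgue)"
    using assms by (intro nn_integral_sum) auto
  finally show ?thesis .
qed

lemma finite_dyad_box: "finite (box_of (\<lambda>i :: 'n. dyad (k i) (j i)))"
  by (intro finite_box_of finite_dyad)

lemma block_sum:
  assumes g: "g \<in> borel_measurable lebesgue"
    and c: "\<And>u. (\<integral>\<^sup>+ y\<in>cell u. g y \<partial>lebesgue) = ennreal (c u)" "\<And>u. 0 \<le> c u"
    and b: "(\<integral>\<^sup>+ y\<in>block k j. g y \<partial>lebesgue) = ennreal b" "0 \<le> b"
  shows "b = (\<Sum>u\<in>box_of (\<lambda>i. dyad (k i) (j i)). c u)"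
proof -
  have "ennreal b = (\<Sum>u\<in>box_of (\<lambda>i. dyad (k i) (j i)). ennreal (c u))"
    unfolding b(1)[symmetric] c(1)[symmetric] block_eq by (rule nn_integral_cells[OF g finite_dyad_box])
  also have "\<dots> = ennreal (\<Sum>u\<in>box_of (\<lambda>i. dyad (k i) (j i)). c u)"
    using c(2) by (intro sum_ennreal) auto
  finally show ?thesis using b(2) c(2) by (subst (asm) ennreal_inj) (auto intro: sum_nonneg)
qed

lemma wR_cell: "(\<integral>\<^sup>+ y\<in>cell u. ennreal (w y) \<partial>lebesgue) = ennreal (wR (cell u))"
  unfolding cell_def by (rule wR) (use h in simp)

lemma wR_block: "wR (block k j) = (\<Sum>u\<in>box_of (\<lambda>i. dyad (k i) (j i)). wR (cell u))"
proof (rule block_sum[where g = "\<lambda>y. ennreal (w y)"])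
  show "(\<integral>\<^sup>+ y\<in>block k j. ennreal (w y) \<partial>lebesgue) = ennreal (wR (block k j))"
    unfolding block_def by (rule wR) (use h in simp)
qed (simp, rule wR_cell, simp_all add: wR_def)

lemma sR_block: "sR (block k j) = (\<Sum>u\<in>box_of (\<lambda>i. dyad (k i) (j i)). sR (cell u))"
proof (rule block_sum[where g = "\<lambda>y. ennreal (sg y)"])
  show "(\<integral>\<^sup>+ y\<in>cell u. ennreal (sg y) \<partial>lebesgue) = ennreal (sR (cell u))" for u
    unfolding cell_def by (rule sR) (use h in simp)
  show "(\<integral>\<^sup>+ y\<in>block k j. ennreal (sg y) \<partial>lebesgue) = ennreal (sR (block k j))"
    unfolding block_def by (rule sR) (use h in simp)
qed (simp_all add: sR_def)

lemma fR_block: "fR (block k j) = (\<Sum>u\<in>box_of (\<lambda>i. dyad (k i) (j i)). fR (cell u))"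
proof (rule block_sum[where g = "\<lambda>y. ennreal \<bar>f y\<bar>"])
  show "(\<integral>\<^sup>+ y\<in>cell u. ennreal \<bar>f y\<bar> \<partial>lebesgue) = ennreal (fR (cell u))" for u
    unfolding cell_def by (rule holder_f) (use h in simp)
  show "(\<integral>\<^sup>+ y\<in>block k j. ennreal \<bar>f y\<bar> \<partial>lebesgue) = ennreal (fR (block k j))"
    unfolding block_def by (rule holder_f) (use h in simp)
qed (simp_all add: fR_def)

lemma wR_cell_pos: "0 < wR (cell u)" unfolding cell_def by (rule wR) (use h in simp)
lemma sR_cell_pos: "0 < sR (cell u)" unfolding cell_def by (rule sR) (use h in simp)

text \<open>The powers of the cell volume cancel because
  \<open>H * H powr (p - 1) = H powr p\<close>. Cell averages thus satisfy the discrete hypotheses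
  with the A_p constant of \<open>w\<close> itself: \<open>ws\<close> is \<open>holder_w\<close> on
  a cell and \<open>Ap\<close> is \<open>Ap_real\<close> on a block.\<close>

sublocale grid: polydyadic "dyadics m" "{..<2 ^ m}" "\<lambda>u :: 'n \<Rightarrow> nat. wR (cell u) / H" "\<lambda>u. sR (cell u) / H" p A
proof (intro polydyadic.intro dyadic_system_dyadics polydyadic_axioms.intro p A_ge_1)
  fix u :: "'n \<Rightarrow> nat"
  show "0 < wR (cell u) / H" "0 < sR (cell u) / H" using wR_cell_pos sR_cell_pos H_pos by simp_all
  have "H powr p \<le> wR (cell u) * sR (cell u) powr (p - 1)"
    unfolding vol_cell[of u, symmetric] cell_def by (rule holder_w) (use h in simp)
  then have "H powr p / (H * H powr (p - 1)) \<le> wR (cell u) * sR (cell u) powr (p - 1) / (H * H powr (p - 1))"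
    using H_pos by (intro divide_right_mono) auto
  moreover have "H * H powr (p - 1) = H powr p" using H_pos by (simp add: powr_diff)
  ultimately show "1 \<le> wR (cell u) / H * (sR (cell u) / H) powr (p - 1)"
    using H_pos sR_cell_pos[of u] by (simp add: powr_divide)
next
  fix Q :: "'n \<Rightarrow> nat set" assume "\<And>i. Q i \<in> dyadics m"
  then have "\<forall>i. \<exists>k j. Q i = dyad k j" by (fastforce simp: dyadics_def)
  then obtain k j where Q: "Q = (\<lambda>i. dyad (k i) (j i))" by metis
  define N where "N = real (card (box_of Q))"
  have "wR (block k j) * sR (block k j) powr (p - 1) \<le> A * (H * N) powr p"
    unfolding N_def Q vol_block[symmetric] block_def by (rule Ap_real) (use h in simp)
  then have "wR (block k j) * sR (block k j) powr (p - 1) / (H * H powr (p - 1)) \<le> A * (H * N) powr p / (H * H powr (p - 1))"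
    using H_pos by (intro divide_right_mono) auto
  moreover have "H * H powr (p - 1) = H powr p" using H_pos by (simp add: powr_diff)
  moreover have "sum (\<lambda>u. wR (cell u) / H) (box_of Q) = wR (block k j) / H"
    "sum (\<lambda>u. sR (cell u) / H) (box_of Q) = sR (block k j) / H"
    by (simp_all add: wR_block sR_block Q sum_divide_distrib)
  moreover have "0 \<le> sR (block k j)" by (simp add: sR_def)
  ultimately show "sum (\<lambda>u. wR (cell u) / H) (box_of Q) * sum (\<lambda>u. sR (cell u) / H) (box_of Q) powr (p - 1)
      \<le> A * real (card (box_of Q)) powr p"
    using H_pos by (simp add: powr_divide powr_mult N_def)
qed

definition F :: "('n \<Rightarrow> nat) \<Rightarrow> real" where "F u = fR (cell u) / H"

text \<open>The discrete maximal function carried back to a step function. The power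
  \<open>p\<close> is taken here so that several grids can be added and Fatou's lemma applied
  directly.\<close>

definition G :: "real ^ 'n \<Rightarrow> ennreal" where
  "G x = (\<Sum>u\<in>grid.P. indicator (cell u) x * ennreal (grid.maxf UNIV F u powr p))"

lemma G_meas [measurable]: "G \<in> borel_measurable lebesgue"
  unfolding G_def by measurable

lemma F_nonneg: "0 \<le> F u" using H_pos by (simp add: F_def fR_def)

lemma gR_nonneg: "0 \<le> gR R" by (simp add: gR_def)

lemma G_bound:
  assumes "2 \<le> CARD('n)"
  shows "(\<integral>\<^sup>+ x. G x * ennreal (w x) \<partial>lebesgue) \<le> ennreal grid_const * total"
proof -
  let ?M = "\<lambda>u. grid.maxf UNIV F u powr p"
  have "(\<integral>\<^sup>+ x. G x * ennreal (w x) \<partial>lebesgue)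
      = (\<integral>\<^sup>+ x. (\<Sum>u\<in>grid.P. ennreal (?M u) * (ennreal (w x) * indicator (cell u) x)) \<partial>lebesgue)"
    unfolding G_def sum_distrib_right by (intro nn_integral_cong sum.cong) (simp_all only: ac_simps)
  also have "\<dots> = (\<Sum>u\<in>grid.P. ennreal (?M u) * ennreal (wR (cell u)))"
    by (subst nn_integral_sum) (simp_all add: nn_integral_cmult wR_cell)
  also have "\<dots> = ennreal (\<Sum>u\<in>grid.P. ?M u * wR (cell u))"
    using wR_cell_pos by (simp add: ennreal_mult'[symmetric] sum_ennreal less_imp_le)
  also have "\<dots> \<le> ennreal (grid_const * (\<Sum>u\<in>grid.P. gR (cell u)))"
  proof (rule ennreal_leI)
    have "(\<Sum>u\<in>grid.P. ?M u * (wR (cell u) / H)) \<le> grid_const * (\<Sum>u\<in>grid.P. F u powr p * (sR (cell u) / H) powr (1 - p))"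
      unfolding grid_const_def by (rule grid.discrete_bound[OF F_nonneg _ assms]) (simp add: lessThan_empty_iff)
    also have "\<dots> \<le> grid_const * (\<Sum>u\<in>grid.P. gR (cell u) / H)"
    proof (intro mult_left_mono grid_const_nonneg sum_mono)
      fix u
      \<comment> \<open>Here the weight \<open>s powr (1 - p)\<close> disappears: Hoelder on the
        cell bounds the discrete energy by the integral of
        \<open>\<bar>f\<bar> powr p * w\<close>.\<close>
      have "fR (cell u) powr p \<le> gR (cell u) * sR (cell u) powr (p - 1)"
        unfolding cell_def by (rule holder_f) (use h in simp)
      then have "F u powr p \<le> gR (cell u) * sR (cell u) powr (p - 1) / H powr p"
        using H_pos by (simp add: F_def powr_divide fR_def divide_right_mono)
      then have "F u powr p * (sR (cell u) / H) powr (1 - p)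
          \<le> gR (cell u) * sR (cell u) powr (p - 1) / H powr p * (sR (cell u) / H) powr (1 - p)"
        by (rule mult_right_mono) simp
      also have "\<dots> = gR (cell u) / H"
        using H_pos sR_cell_pos[of u] by (simp add: powr_divide powr_diff field_simps)
      finally show "F u powr p * (sR (cell u) / H) powr (1 - p) \<le> gR (cell u) / H" .
    qed
    finally show "(\<Sum>u\<in>grid.P. ?M u * wR (cell u)) \<le> grid_const * (\<Sum>u\<in>grid.P. gR (cell u))"
      using H_pos by (simp add: sum_divide_distrib[symmetric] divide_le_cancel)
  qed
  also have "\<dots> = ennreal grid_const * (\<Sum>u\<in>grid.P. \<integral>\<^sup>+ y\<in>cell u. (ennreal (\<bar>f y\<bar> powr p) * ennreal (w y)) \<partial>lebesgue)"
    unfolding gR using grid_const_nonneg gR_nonneg by (simp add: ennreal_mult' sum_ennreal)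
  also have "\<dots> = ennreal grid_const * (\<integral>\<^sup>+ y\<in>(\<Union>u\<in>grid.P. cell u). (ennreal (\<bar>f y\<bar> powr p) * ennreal (w y)) \<partial>lebesgue)"
    using grid.finite_P by (subst nn_integral_cells) auto
  also have "\<dots> \<le> ennreal grid_const * total"
    unfolding total_def by (intro mult_left_mono nn_integral_mono) (auto simp: indicator_def)
  finally show ?thesis .
qed

lemma G_ge:
  assumes x: "x \<in> block k j" and kj: "\<And>i. k i \<le> m" "\<And>i. j i < 2 ^ (m - k i)"
  shows "ennreal ((fR (block k j) / vol (\<lambda>i. a i + h * (real (j i) * 2 ^ k i)) (\<lambda>i. a i + h * ((real (j i) + 1) * 2 ^ k i))) powr p) \<le> G x"
proof -
  define Q where "Q = (\<lambda>i. dyad (k i) (j i))"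
  have QD: "Q i \<in> dyadics m" for i using kj[of i] unfolding Q_def dyadics_def by auto
  obtain u where u: "u \<in> box_of Q" "x \<in> cell u" using x unfolding block_eq Q_def by auto
  have uP: "u \<in> grid.P" using u(1) grid.D_subset[OF QD] unfolding box_of_def by blast
  have "Q \<in> grid.boxes UNIV u" using QD u(1) by (simp add: grid.boxes_def box_of_def)
  then have "grid.mean F Q \<le> grid.maxf UNIV F u" by (rule grid.mean_le_maxf[OF uP])
  moreover have "grid.mean F Q = fR (block k j) / (H * card (box_of Q))"
    unfolding grid.mean_def F_def fR_block Q_def by (simp add: sum_divide_distrib[symmetric])
  moreover have "0 \<le> fR (block k j) / (H * card (box_of Q))" using H_pos by (simp add: fR_def)
  ultimately have "ennreal ((fR (block k j) / (H * card (box_of Q))) powr p) \<le> ennreal (grid.maxf UNIV F u powr p)"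
    using p by (intro ennreal_leI powr_mono2) auto
  also have "\<dots> = indicator (cell u) x * ennreal (grid.maxf UNIV F u powr p)" using u by simp
  also have "\<dots> \<le> G x"
    unfolding G_def by (rule member_le_sum[OF uP]) (auto intro: grid.finite_P)
  finally show ?thesis unfolding vol_block Q_def .
qed

text \<open>Phrased without the constants of the locale, because corner and mesh vary with the grid
  in the limit argument.\<close>

lemma ex_majorant:
  assumes "2 \<le> CARD('n)"
  shows "\<exists>G. G \<in> borel_measurable lebesgue
    \<and> (\<integral>\<^sup>+ x. G x * ennreal (w x) \<partial>lebesgue) \<le> ennreal grid_const * total
    \<and> (\<forall>k j x. (\<forall>i. k i \<le> m \<and> j i < 2 ^ (m - k i)) \<longrightarrow>
      x \<in> hrect (\<lambda>i. a i + h * (real (j i) * 2 ^ k i)) (\<lambda>i. a i + h * ((real (j i) + 1) * 2 ^ k i)) \<longrightarrow>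
      ennreal ((fR (hrect (\<lambda>i. a i + h * (real (j i) * 2 ^ k i)) (\<lambda>i. a i + h * ((real (j i) + 1) * 2 ^ k i)))
        / vol (\<lambda>i. a i + h * (real (j i) * 2 ^ k i)) (\<lambda>i. a i + h * ((real (j i) + 1) * 2 ^ k i))) powr p) \<le> G x)"
proof (intro exI[of _ G] conjI allI impI)
  show "(\<integral>\<^sup>+ x. G x * ennreal (w x) \<partial>lebesgue) \<le> ennreal grid_const * total" by (rule G_bound[OF assms])
qed (use G_ge[unfolded block_def] in simp_all)

end

section \<open>The one-third trick and the limit of vanishing mesh\<close>

text \<open>The two corners differ by \<open>2 ^ N / 3\<close>. In units of the block length this is
  a third of a power of 2, hence at distance at least 1/3 from every integer. Break points of the
  two grids at that scale are thus at least a third of a block apart, and an interval shorter than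
  that cannot be cut by both. The bounds on \<open>l\<close> and \<open>r\<close> keep it inside
  both grids.\<close>

lemma one_third_trick:
  fixes l r :: real and N :: nat
  assumes lr: "l < r" and N: "\<bar>l\<bar> \<le> 2 ^ N / 8" "\<bar>r\<bar> \<le> 2 ^ N / 8" "1 / 2 ^ N \<le> 3 * (r - l)"
  shows "\<exists>t k j. k \<le> 2 * N \<and> j < 2 ^ (2 * N - k) \<and> 2 ^ k / 2 ^ N \<le> 6 * (r - l)
    \<and> - (2 ^ N / (if t then 2 else 6)) + 1 / 2 ^ N * (real j * 2 ^ k) \<le> l
    \<and> r < - (2 ^ N / (if t then 2 else 6)) + 1 / 2 ^ N * ((real j + 1) * 2 ^ k)"
proof -
  have ex: "3 * (r - l) < 2 ^ (2 * N) / 2 ^ N"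
  proof -
    have "0 < (2::real) ^ N" by simp
    moreover have "- l \<le> 2 ^ N / 8" "r \<le> 2 ^ N / 8" using N(1,2) by (simp_all add: abs_le_iff)
    ultimately have "3 * (r - l) < 2 ^ N" by argo
    then show ?thesis by (simp add: mult_2 power_add)
  qed
  \<comment> \<open>The smallest block of which the interval is less than a third; minimality gives
    the factor 6.\<close>
  define k where "k = (LEAST k. 3 * (r - l) < 2 ^ k / (2::real) ^ N)"
  have k: "3 * (r - l) < 2 ^ k / 2 ^ N" "k \<le> 2 * N"
    unfolding k_def by (rule LeastI[of _ "2 * N"], rule ex) (rule Least_le, rule ex)
  \<comment> \<open>Since the interval has at least a third of the mesh, scale 0 is excluded and
    there is a smaller scale that fails.\<close>
  have "k \<noteq> 0" using k(1) N(3) by (intro notI) simp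
  then obtain k' where k': "k = Suc k'" using not0_implies_Suc by blast
  have "\<not> 3 * (r - l) < 2 ^ k' / (2::real) ^ N"
    using not_less_Least[of k' "\<lambda>k. 3 * (r - l) < 2 ^ k / (2::real) ^ N"] k' by (simp add: k_def)
  then have k6: "2 ^ k / 2 ^ N \<le> 6 * (r - l)" by (simp add: k')
  define c :: real where "c = 2 ^ k / 2 ^ N"
  have c: "0 < c" by (simp add: c_def)
  define e where "e = 2 * N - k"
  have "(2::real) ^ e * 2 ^ k = 2 ^ N * 2 ^ N" using k(2) by (simp add: e_def mult_2 flip: power_add)
  then have e: "2 ^ N = 2 ^ e * c" by (simp add: c_def field_simps)
  define a :: "bool \<Rightarrow> real" where "a t = - (2 ^ N / (if t then 2 else 6))" for t
  define j where "j t = \<lfloor>(l - a t) / c\<rfloor>" for t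
  have j: "a t + c * j t \<le> l" "l < a t + c * (j t + 1)" for t
  proof -
    have "real_of_int (j t) \<le> (l - a t) / c" "(l - a t) / c < real_of_int (j t) + 1"
      unfolding j_def by linarith+
    then show "a t + c * j t \<le> l" "l < a t + c * (j t + 1)" using c by (simp_all add: field_simps)
  qed
  have "\<exists>t. r < a t + c * (j t + 1)"
  proof (rule ccontr)
    assume "\<not> ?thesis"
    then have nr: "a t + c * (j t + 1) \<le> r" for t by (simp add: not_less)
    define q where "q = j True - j False"
    have "\<bar>(a True + c * (j True + 1)) - (a False + c * (j False + 1))\<bar> < r - l"
      using j(2)[of True] j(2)[of False] nr[of True] nr[of False] by linarith
    also have "(a True + c * (j True + 1)) - (a False + c * (j False + 1)) = c * (q - 2 ^ e / 3)"
      unfolding a_def e q_def by (simp add: field_simps)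
    also have "r - l < c / 3" using k(1) by (simp add: c_def)
    finally have "c * \<bar>q - 2 ^ e / 3\<bar> < c * (1 / 3)" using c by (simp add: abs_mult)
    then have "\<bar>real_of_int q - 2 ^ e / 3\<bar> < 1 / 3" using c by (simp only: mult_less_cancel_left_pos)
    then have "- 1 < real_of_int (3 * q - 2 ^ e)" "real_of_int (3 * q - 2 ^ e) < 1"
      unfolding abs_less_iff by (simp_all add: field_simps)
    then have "3 * q = 2 ^ e" by linarith
    moreover have "3 * q \<noteq> 2 ^ i" for q :: int and i
    proof (induction i arbitrary: q)
      case 0
      show ?case by simp presburger
    next
      case (Suc i)
      show ?case
      proof
        assume "3 * q = 2 ^ Suc i"
        then have "3 * (2 ^ i - q) = 2 ^ i" by simp
        then show False using Suc by blast
      qed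
    qed
    ultimately show False by blast
  qed
  then obtain t where t: "r < a t + c * (j t + 1)" ..
  have pos: "0 < (2::real) ^ N" by simp
  have l: "- l \<le> 2 ^ N / 8" "l \<le> 2 ^ N / 8" using N(1) by (simp_all add: abs_le_iff)
  have at: "- a t \<le> 2 ^ N / 2" "2 ^ N / 6 \<le> - a t" by (simp_all add: a_def)
  have "a t \<le> l" using l at pos by argo
  then have "0 \<le> (l - a t) / c" using c by simp
  then have j0: "0 \<le> j t" unfolding j_def by simp
  have "c * j t < 2 ^ N" using j(1)[of t] l at pos by argo
  then have "c * j t < c * 2 ^ e" by (simp add: e mult.commute)
  then have "real_of_int (j t) < 2 ^ e" using c by (simp only: mult_less_cancel_left_pos)
  then have "real_of_int (j t) < real_of_int (2 ^ e)" by simp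
  then have "j t < 2 ^ e" by (simp only: of_int_less_iff)
  then have j1: "nat (j t) < 2 ^ (2 * N - k)" using j0 by (simp add: e_def nat_less_iff)
  have "real (nat (j t)) = j t" using j0 by simp
  then show ?thesis
    using k(2) j1 k6 j(1)[of t] t
    by (intro exI[of _ t] exI[of _ k] exI[of _ "nat (j t)"]) (simp add: a_def c_def mult.commute)
qed

lemma rectangle_lebesgue:
  assumes "box (\<chi> i. l i) (\<chi> i. r i) \<subseteq> R" "R \<subseteq> cbox (\<chi> i. l i) (\<chi> i. r i)"
  shows "(R :: (real ^ 'n::finite) set) \<in> sets lebesgue"
proof -
  let ?B = "box (\<chi> i. l i) (\<chi> i. r i) :: (real ^ 'n) set"
  have "negligible (R - ?B)"
    by (rule negligible_subset[OF negligible_frontier_interval[of "\<chi> i. l i" "\<chi> i. r i"]]) (use assms in auto)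
  then have "R - ?B \<in> sets lebesgue" by (rule negligible_imp_sets)
  moreover have "R = ?B \<union> (R - ?B)" using assms by auto
  moreover have "?B \<in> sets lebesgue" by simp
  ultimately show ?thesis by (metis sets.Un)
qed

lemma epowr_mono: "0 \<le> a \<Longrightarrow> x \<le> y \<Longrightarrow> x epowr a \<le> y epowr a"
  by (cases x; cases y) (auto simp: epowr_def top_unique ennreal_le_iff intro!: ennreal_leI powr_mono2)

lemma epowr_epowr_inverse: "0 < a \<Longrightarrow> (x epowr a) epowr (1 / a) = x" "0 < a \<Longrightarrow> (x epowr (1 / a)) epowr a = x"
  by (cases x; simp add: epowr_def powr_powr)+

context Ap_weight_fun begin

lemma average_le_hrect:
  assumes lr: "\<And>i. l i < r i" and R: "box (\<chi> i. l i) (\<chi> i. r i) \<subseteq> R" "R \<subseteq> cbox (\<chi> i. l i) (\<chi> i. r i)"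
    and big: "\<And>i. l' i \<le> l i" "\<And>i. r i < r' i" "\<And>i. r' i - l' i \<le> 6 * (r i - l i)"
  shows "average R (\<lambda>y. ennreal \<bar>f y\<bar>) \<le> ennreal (6 ^ CARD('n) * (fR (hrect l' r') / vol l' r'))"
proof -
  have lr': "l' i < r' i" for i using lr[of i] big(1,2)[of i] by linarith
  have v: "0 < vol l r" "0 < vol l' r'" by (rule vol_pos, rule lr, rule vol_pos, rule lr')
  have f0: "0 \<le> fR (hrect l' r')" by (simp add: fR_def)
  have "vol l' r' \<le> (\<Prod>i\<in>UNIV. 6 * (r i - l i))"
    unfolding vol_def using big(3) lr' by (intro prod_mono) (auto simp: less_imp_le)
  also have "\<dots> = 6 ^ CARD('n) * vol l r" by (simp only: vol_def prod.distrib prod_constant)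
  finally have v6: "vol l' r' \<le> 6 ^ CARD('n) * vol l r" .
  have "R \<subseteq> hrect l' r'"
  proof
    fix x assume "x \<in> R"
    then have "x \<in> cbox (\<chi> i. l i) (\<chi> i. r i)" using R by auto
    then have "l i \<le> x $ i" "x $ i \<le> r i" for i by (auto simp: mem_box_cart)
    then show "x \<in> hrect l' r'" using big(1,2) unfolding hrect_def
      by (intro CollectI allI conjI) (meson order_trans, meson order_le_less_trans)
  qed
  then have "(\<integral>\<^sup>+ y\<in>R. ennreal \<bar>f y\<bar> \<partial>lebesgue) \<le> (\<integral>\<^sup>+ y\<in>hrect l' r'. ennreal \<bar>f y\<bar> \<partial>lebesgue)"
    by (intro nn_integral_mono) (auto simp: indicator_def)
  also have "\<dots> = ennreal (fR (hrect l' r'))" by (rule holder_f) (rule lr')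
  also have "fR (hrect l' r') \<le> vol l r * (6 ^ CARD('n) * (fR (hrect l' r') / vol l' r'))"
  proof -
    have "fR (hrect l' r') * vol l' r' \<le> fR (hrect l' r') * (6 ^ CARD('n) * vol l r)"
      by (rule mult_left_mono[OF v6 f0])
    then show ?thesis using v by (simp add: field_simps)
  qed
  also have "ennreal (vol l r * (6 ^ CARD('n) * (fR (hrect l' r') / vol l' r')))
      = ennreal (vol l r) * ennreal (6 ^ CARD('n) * (fR (hrect l' r') / vol l' r'))"
    using v f0 by (intro ennreal_mult) auto
  finally have I: "(\<integral>\<^sup>+ y\<in>R. ennreal \<bar>f y\<bar> \<partial>lebesgue)
      \<le> ennreal (vol l r) * ennreal (6 ^ CARD('n) * (fR (hrect l' r') / vol l' r'))" by (simp add: ennreal_leI)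
  have "ennreal (vol l r) = emeasure lebesgue (box (\<chi> i. l i) (\<chi> i. r i) :: (real ^ 'n) set)"
    unfolding vol_def by (rule emeasure_lebesgue_box_cart(1)[symmetric]) (simp add: lr less_imp_le)
  also have "\<dots> \<le> emeasure lebesgue R" by (rule emeasure_mono[OF R(1) rectangle_lebesgue[OF R]])
  finally have V: "ennreal (vol l r) \<le> emeasure lebesgue R" .
  show ?thesis
    unfolding average_def
  proof (rule divide_le_posI_ennreal)
    have "0 < ennreal (vol l r)" using v by simp
    then show "0 < emeasure lebesgue R" using V by (rule order_less_le_trans)
    show "(\<integral>\<^sup>+ y\<in>R. ennreal \<bar>f y\<bar> \<partial>lebesgue)
      \<le> emeasure lebesgue R * ennreal (6 ^ CARD('n) * (fR (hrect l' r') / vol l' r'))"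
      using I mult_right_mono[OF V] by (rule order_trans) simp
  qed
qed

text \<open>The grid that captures a given rectangle may change with the mesh, hence the sum over
  all \<open>2 ^ CARD('n)\<close> choices of corners. The mesh from which capture succeeds depends
  on the rectangle, hence the \<open>liminf\<close>. Enlarging a rectangle costs 6 per
  coordinate.\<close>

theorem strong_maximal_bound:
  assumes d: "2 \<le> CARD('n)"
  shows "(\<integral>\<^sup>+ x. strong_maximal f x epowr p * ennreal (w x) \<partial>lebesgue)
    \<le> ennreal ((6 ^ CARD('n)) powr p * 2 ^ CARD('n) * grid_const) * total"
proof -
  define a :: "nat \<Rightarrow> ('n \<Rightarrow> bool) \<Rightarrow> 'n \<Rightarrow> real" where "a N t i = - (2 ^ N / (if t i then 2 else 6))" for N :: nat and t :: "'n \<Rightarrow> bool" and i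
  define h where "h N = 1 / (2::real) ^ N" for N :: nat
  define L where "L N t k j = (\<lambda>i. a N t i + h N * (real (j i) * 2 ^ k i))" for N t and k j :: "'n \<Rightarrow> nat"
  define U where "U N t k j = (\<lambda>i. a N t i + h N * ((real (j i) + 1) * 2 ^ k i))" for N t and k j :: "'n \<Rightarrow> nat"
  define majorant where "majorant N t G \<longleftrightarrow> G \<in> borel_measurable lebesgue
    \<and> (\<integral>\<^sup>+ x. G x * ennreal (w x) \<partial>lebesgue) \<le> ennreal grid_const * total
    \<and> (\<forall>k j x. (\<forall>i. k i \<le> 2 * N \<and> j i < 2 ^ (2 * N - k i)) \<longrightarrow> x \<in> hrect (L N t k j) (U N t k j) \<longrightarrow>
      ennreal ((fR (hrect (L N t k j) (U N t k j)) / vol (L N t k j) (U N t k j)) powr p) \<le> G x)"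
    for N t and G :: "real ^ 'n \<Rightarrow> ennreal"
  have "\<exists>G. majorant N t G" for N t
  proof -
    interpret Ap_weight_grid w p f "a N t" "h N" "2 * N" by unfold_locales (simp add: h_def)
    show ?thesis unfolding majorant_def L_def U_def by (rule ex_majorant[OF d])
  qed
  then obtain G where "majorant N t (G N t)" for N t by metis
  then have G: "\<And>N t. G N t \<in> borel_measurable lebesgue"
    "\<And>N t. (\<integral>\<^sup>+ x. G N t x * ennreal (w x) \<partial>lebesgue) \<le> ennreal grid_const * total"
    "\<And>N t k j x. (\<And>i. k i \<le> 2 * N \<and> j i < 2 ^ (2 * N - k i)) \<Longrightarrow> x \<in> hrect (L N t k j) (U N t k j) \<Longrightarrow>
      ennreal ((fR (hrect (L N t k j) (U N t k j)) / vol (L N t k j) (U N t k j)) powr p) \<le> G N t x"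
    unfolding majorant_def by simp_all
  define S where "S N x = (\<Sum>t\<in>UNIV. G N t x)" for N x
  define c where "c = ((6::real) ^ CARD('n)) powr p"
  have p0: "0 < p" using p by simp
  have large: "\<forall>\<^sub>F N in sequentially. b \<le> (2::real) ^ N" for b
  proof -
    obtain n :: nat where n: "b \<le> real n" using real_arch_simple by blast
    have "b \<le> 2 ^ N" if "n \<le> N" for N
    proof -
      have "real n \<le> real N" using that by simp
      also have "\<dots> < 2 ^ N" by (rule of_nat_less_two_power)
      finally show ?thesis using n by linarith
    qed
    then show ?thesis by (intro eventually_sequentiallyI[of n])
  qed
  have rect: "average R (\<lambda>y. ennreal \<bar>f y\<bar>) epowr p \<le> ennreal c * liminf (\<lambda>N. S N x)"
    if Rr: "R \<in> rectangles" and xR: "x \<in> R" for R x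
  proof -
    let ?av = "average R (\<lambda>y. ennreal \<bar>f y\<bar>) epowr p"
    obtain l r where lr: "\<And>i. l i < r i" and R: "box (\<chi> i. l i) (\<chi> i. r i) \<subseteq> R" "R \<subseteq> cbox (\<chi> i. l i) (\<chi> i. r i)"
      using rectangle_sandwich[OF Rr] by blast
    have "\<forall>\<^sub>F N in sequentially. \<forall>i. \<bar>l i\<bar> \<le> 2 ^ N / 8 \<and> \<bar>r i\<bar> \<le> 2 ^ N / 8 \<and> 1 / 2 ^ N \<le> 3 * (r i - l i)"
    proof (rule eventually_all_finite)
      fix i
      have "0 < 3 * (r i - l i)" using lr[of i] by simp
      show "\<forall>\<^sub>F N in sequentially. \<bar>l i\<bar> \<le> 2 ^ N / 8 \<and> \<bar>r i\<bar> \<le> 2 ^ N / 8 \<and> 1 / 2 ^ N \<le> 3 * (r i - l i)"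
        using large[of "8 * \<bar>l i\<bar>"] large[of "8 * \<bar>r i\<bar>"] large[of "1 / (3 * (r i - l i))"]
      proof eventually_elim
        case (elim N)
        have "1 \<le> 2 ^ N * (3 * (r i - l i))"
          using elim(3) \<open>0 < 3 * (r i - l i)\<close> by (simp only: pos_divide_le_eq)
        then have "1 / 2 ^ N \<le> 3 * (r i - l i)" by (simp add: divide_le_eq mult.commute)
        then show ?case using elim(1,2) by simp
      qed
    qed
    then have ev: "\<forall>\<^sub>F N in sequentially. ?av \<le> ennreal c * S N x"
    proof eventually_elim
      case (elim N)
      then have "\<forall>i. \<exists>t k j. k \<le> 2 * N \<and> j < 2 ^ (2 * N - k) \<and> 2 ^ k / 2 ^ N \<le> 6 * (r i - l i)
        \<and> - (2 ^ N / (if t then 2 else 6)) + 1 / 2 ^ N * (real j * 2 ^ k) \<le> l i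
        \<and> r i < - (2 ^ N / (if t then 2 else 6)) + 1 / 2 ^ N * ((real j + 1) * 2 ^ k)"
        using one_third_trick lr by blast
      then obtain t k j where tkj: "\<And>i. k i \<le> 2 * N \<and> j i < 2 ^ (2 * N - k i)" "\<And>i. 2 ^ k i / 2 ^ N \<le> 6 * (r i - l i)"
        "\<And>i. - (2 ^ N / (if t i then 2 else 6)) + 1 / 2 ^ N * (real (j i) * 2 ^ k i) \<le> l i"
        "\<And>i. r i < - (2 ^ N / (if t i then 2 else 6)) + 1 / 2 ^ N * ((real (j i) + 1) * 2 ^ k i)"
        by metis
      let ?L = "L N t k j" and ?U = "U N t k j"
      have LU: "?L i \<le> l i" "r i < ?U i" for i using tkj(3,4)[of i] by (simp_all add: L_def U_def a_def h_def)
      have LU6: "?U i - ?L i \<le> 6 * (r i - l i)" for i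
        using tkj(2)[of i] by (simp add: L_def U_def h_def algebra_simps add_divide_distrib)
      define y where "y = fR (hrect ?L ?U) / vol ?L ?U"
      have "l i \<le> x $ i" "x $ i \<le> r i" for i using R(2) xR by (auto simp: mem_box_cart)
      then have x: "x \<in> hrect ?L ?U" using LU unfolding hrect_def
        by (intro CollectI allI conjI) (meson order_trans, meson order_le_less_trans)
      have "0 < vol ?L ?U" by (rule vol_pos) (meson LU lr order_le_less_trans order_less_trans)
      then have y0: "0 \<le> y" by (simp add: y_def fR_def)
      have "average R (\<lambda>y. ennreal \<bar>f y\<bar>) \<le> ennreal (6 ^ CARD('n) * y)"
        unfolding y_def by (rule average_le_hrect[OF lr R LU LU6])
      then have "?av \<le> ennreal (6 ^ CARD('n) * y) epowr p" using p0 by (intro epowr_mono) auto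
      also have "\<dots> = ennreal c * ennreal (y powr p)"
        using y0 by (subst epowr_ennreal) (simp_all add: powr_mult c_def ennreal_mult)
      also have "ennreal (y powr p) \<le> G N t x" unfolding y_def by (rule G(3)[OF tkj(1) x])
      also have "G N t x \<le> S N x" unfolding S_def by (rule member_le_sum) auto
      finally show ?case by (simp add: mult_left_mono)
    qed
    show ?thesis
    proof -
      have c0: "0 < c" by (simp add: c_def)
      have "\<forall>\<^sub>F N in sequentially. ?av / ennreal c \<le> S N x"
        using ev by eventually_elim (use c0 in \<open>intro divide_le_posI_ennreal; simp\<close>)
      then have "?av / ennreal c \<le> liminf (\<lambda>N. S N x)" by (rule Liminf_bounded)
      then have "ennreal c * (?av / ennreal c) \<le> ennreal c * liminf (\<lambda>N. S N x)" by (rule mult_left_mono) simp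
      moreover have "ennreal c * (?av / ennreal c) = ?av * ennreal c / ennreal c"
        by (simp only: ennreal_times_divide mult.commute)
      moreover have "?av * ennreal c / ennreal c = ?av"
        by (rule ennreal_mult_divide_eq) (use c0 in simp_all)
      ultimately show ?thesis by simp
    qed
  qed
  have point: "strong_maximal f x epowr p \<le> ennreal c * liminf (\<lambda>N. S N x)" (is "_ \<le> ?B") for x
  proof -
    \<comment> \<open>The supremum stands inside the power, so each average is compared with the
      root of the bound first.\<close>
    have "strong_maximal f x \<le> ?B epowr (1 / p)"
      unfolding strong_maximal_def
    proof (rule SUP_least)
      fix R :: "(real ^ 'n) set" assume R: "R \<in> rectangles"
      show "indicator R x * average R (\<lambda>y. ennreal \<bar>f y\<bar>) \<le> ?B epowr (1 / p)"
      proof (cases "x \<in> R")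
        case True
        have "average R (\<lambda>y. ennreal \<bar>f y\<bar>) = (average R (\<lambda>y. ennreal \<bar>f y\<bar>) epowr p) epowr (1 / p)"
          using p0 by (simp add: epowr_epowr_inverse)
        also have "\<dots> \<le> ?B epowr (1 / p)" using rect[OF R True] p0 by (intro epowr_mono) auto
        finally show ?thesis using True by simp
      qed simp
    qed
    then have "strong_maximal f x epowr p \<le> (?B epowr (1 / p)) epowr p" using p0 by (intro epowr_mono) auto
    then show ?thesis using p0 by (simp add: epowr_epowr_inverse)
  qed
  have S_meas: "S N \<in> borel_measurable lebesgue" for N unfolding S_def using G(1) by measurable
  have w_ennreal: "(\<lambda>x. ennreal (w x)) \<in> borel_measurable lebesgue"
    by (rule measurable_compose[OF w_meas measurable_ennreal])
  have Sw_meas: "(\<lambda>x. S N x * ennreal (w x)) \<in> borel_measurable lebesgue" for N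
    using S_meas w_ennreal by (rule borel_measurable_times_ennreal)
  have lim: "liminf (\<lambda>N. S N x) * ennreal (w x) \<le> liminf (\<lambda>N. S N x * ennreal (w x))" for x
    unfolding liminf_SUP_INF SUP_mult_right_ennreal
    by (intro SUP_mono bexI INF_greatest mult_right_mono INF_lower) auto
  have "(\<integral>\<^sup>+ x. strong_maximal f x epowr p * ennreal (w x) \<partial>lebesgue)
      \<le> (\<integral>\<^sup>+ x. ennreal c * liminf (\<lambda>N. S N x * ennreal (w x)) \<partial>lebesgue)"
  proof (rule nn_integral_mono)
    fix x
    have "strong_maximal f x epowr p * ennreal (w x) \<le> ennreal c * (liminf (\<lambda>N. S N x) * ennreal (w x))"
      using mult_right_mono[OF point[of x], of "ennreal (w x)"] by (simp add: mult.assoc)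
    also have "\<dots> \<le> ennreal c * liminf (\<lambda>N. S N x * ennreal (w x))" by (intro mult_left_mono lim) simp
    finally show "strong_maximal f x epowr p * ennreal (w x) \<le> ennreal c * liminf (\<lambda>N. S N x * ennreal (w x))" .
  qed
  also have "\<dots> = ennreal c * (\<integral>\<^sup>+ x. liminf (\<lambda>N. S N x * ennreal (w x)) \<partial>lebesgue)"
    using Sw_meas by (intro nn_integral_cmult borel_measurable_liminf)
  also have "\<dots> \<le> ennreal c * liminf (\<lambda>N. \<integral>\<^sup>+ x. S N x * ennreal (w x) \<partial>lebesgue)"
    using Sw_meas by (intro mult_left_mono nn_integral_liminf) auto
  also have "\<dots> \<le> ennreal c * (ennreal (2 ^ CARD('n)) * (ennreal grid_const * total))"
  proof (intro mult_left_mono Liminf_le always_eventually allI)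
    fix N
    have "(\<integral>\<^sup>+ x. S N x * ennreal (w x) \<partial>lebesgue) = (\<Sum>t\<in>UNIV. \<integral>\<^sup>+ x. G N t x * ennreal (w x) \<partial>lebesgue)"
      unfolding S_def sum_distrib_right using G(1) w_ennreal by (intro nn_integral_sum borel_measurable_times_ennreal)
    also have "\<dots> \<le> (\<Sum>t\<in>(UNIV :: ('n \<Rightarrow> bool) set). ennreal grid_const * total)" by (intro sum_mono G(2))
    also have "\<dots> = ennreal (2 ^ CARD('n)) * (ennreal grid_const * total)" by (simp add: card_fun ennreal_power[symmetric])
    finally show "(\<integral>\<^sup>+ x. S N x * ennreal (w x) \<partial>lebesgue) \<le> ennreal (2 ^ CARD('n)) * (ennreal grid_const * total)" .
  qed simp_all
  also have "\<dots> = ennreal (c * 2 ^ CARD('n) * grid_const) * total"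
    using grid_const_nonneg by (simp add: ennreal_mult c_def mult.assoc)
  finally show ?thesis unfolding c_def .
qed

end

section \<open>The exponent and the final estimate\<close>

text \<open>Since \<open>2 + 3 / (2 * (p - 1)) = 2 * p / (p - 1) - 1 / (2 * (p - 1))\<close>, a pair
  saves \<open>1 / (2 * (p - 1))\<close> against two single coordinates. Division by
  \<open>p\<close> comes from the root in the norm, and \<open>d div 2\<close> pairs give the
  subtracted term.\<close>

lemma strong_exponent_eq:
  assumes "1 < p"
  shows "(real (d div 2) * (2 + 3 / (2 * (p - 1))) + real (d mod 2) * (p / (p - 1))) / p = strong_exponent p d"
proof -
  have fl: "\<lfloor>real d / 2\<rfloor> = int (d div 2)" using floor_divide_of_nat_eq[of d 2, where ?'a = real] by simp
  have d: "real d = 2 * real (d div 2) + real (d mod 2)" by (metis mult_div_mod_eq of_nat_add of_nat_mult of_nat_numeral)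
  have "(q * (2 + 3 / (2 * (p - 1))) + r * (p / (p - 1))) / p = (2 * q + r) / (p - 1) - q / (2 * p * (p - 1))" for q r
    using assms by (simp add: divide_simps) (simp add: algebra_simps)
  then have "(real (d div 2) * (2 + 3 / (2 * (p - 1))) + real (d mod 2) * (p / (p - 1))) / p
      = (2 * real (d div 2) + real (d mod 2)) / (p - 1) - real (d div 2) / (2 * p * (p - 1))" .
  then show ?thesis unfolding strong_exponent_def fl d[symmetric] of_int_of_nat_eq .
qed

theorem theorem1p1:
  fixes p :: real
  assumes "1 < p" and "CARD('n::finite) \<ge> 2"
  shows "\<exists>C::real. 0 < C \<and>
           (\<forall>w :: real ^ 'n \<Rightarrow> real. w \<in> Ap p \<longrightarrow>
             (\<forall>f \<in> Lp p w.
                Lp_norm p w (strong_maximal f)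
                \<le> ennreal C * Ap_const p w epowr strong_exponent p CARD('n)
                   * Lp_norm p w (\<lambda>x. ennreal \<bar>f x\<bar>)))"
proof -
  let ?d = "CARD('n)"
  \<comment> \<open>Everything independent of \<open>A\<close>: the enlargement of rectangles, the
    number of grids, and the constants of the pair steps and of the possible single step. The
    constant of the theorem is its root of order \<open>p\<close>.\<close>
  define B where "B = (6 ^ ?d) powr p * 2 ^ ?d * (pair_const p ^ (?d div 2) * row_const p ^ (?d mod 2))"
  have "0 < pair_const p" "0 < row_const p" by (simp_all add: pair_const_def row_const_def)
  then have B: "0 < B" by (simp add: B_def)
  have "Lp_norm p w (strong_maximal f)
      \<le> ennreal (B powr (1 / p)) * Ap_const p w epowr strong_exponent p ?d * Lp_norm p w (\<lambda>x. ennreal \<bar>f x\<bar>)"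
    if wA: "w \<in> Ap p" and fL: "f \<in> Lp p w" for w :: "real ^ 'n \<Rightarrow> real" and f
  proof -
    interpret Ap_weight_fun w p f by unfold_locales (use assms wA fL in auto)
    define \<beta> where "\<beta> = real (?d div 2) * (2 + 3 / (2 * (p - 1))) + real (?d mod 2) * (p / (p - 1))"
    define T where "T = enn2real total"
    have T: "total = ennreal T" "0 \<le> T" using total_finite by (simp_all add: T_def)
    have A1: "0 < A" using A_ge_1 by simp
    have pw: "(A powr x) ^ k = A powr (real k * x)" for x k using A1 by (simp add: powr_power mult.commute)
    have "grid_const = pair_const p ^ (?d div 2) * row_const p ^ (?d mod 2)
        * (A powr (real (?d div 2) * (2 + 3 / (2 * (p - 1)))) * A powr (real (?d mod 2) * (p / (p - 1))))"
      unfolding grid_const_def power_mult_distrib pw by (simp only: ac_simps)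
    also have "\<dots> = pair_const p ^ (?d div 2) * row_const p ^ (?d mod 2) * A powr \<beta>"
      by (simp only: \<beta>_def powr_add)
    finally have "grid_const = pair_const p ^ (?d div 2) * row_const p ^ (?d mod 2) * A powr \<beta>" .
    then have grid_const: "(6 ^ ?d) powr p * 2 ^ ?d * grid_const = B * A powr \<beta>" by (simp add: B_def)
    have "Lp_norm p w (strong_maximal f) \<le> (ennreal (B * A powr \<beta>) * total) epowr (1 / p)"
      unfolding Lp_norm_def grid_const[symmetric] using assms(1)
      by (intro epowr_mono strong_maximal_bound[OF assms(2)]) auto
    also have "\<dots> = ennreal ((B * A powr \<beta> * T) powr (1 / p))"
      using B T by (simp add: ennreal_mult'[symmetric] epowr_ennreal)
    also have "(B * A powr \<beta> * T) powr (1 / p) = B powr (1 / p) * A powr strong_exponent p ?d * T powr (1 / p)"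
      using B T A1 by (simp add: powr_mult powr_powr strong_exponent_eq[OF assms(1), symmetric] \<beta>_def)
    also have "ennreal \<dots> = ennreal (B powr (1 / p)) * Ap_const p w epowr strong_exponent p ?d * Lp_norm p w (\<lambda>x. ennreal \<bar>f x\<bar>)"
      using A1 T by (simp add: Lp_norm_f Ap_const_eq epowr_ennreal ennreal_mult)
    finally show ?thesis .
  qed
  moreover have "0 < B powr (1 / p)" using B by simp
  ultimately show ?thesis by blast
qed

end
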